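(* Let $n=p^r$ be an odd prime power, where $p$ is a prime with $p\equiv 3\pmod 4$. If $2\in\mathbf{R}_{\mathbb{Q}(\zeta_n)/\mathbb{Q}}$, then the class number of the quadratic field contained in $\mathbb{Q}(\zeta_n)$ is trivial outside $\phi(n)/2$, i.e. every prime dividing this class number divides $\phi(n)/2$.
   Context: Here $\zeta_n$ is a primitive $n$-th root of unity and $\phi$ is Euler's totient function. For a Galois extension of number fields $L/K$, the residue degree of a prime ideal $\wp$ of $L$ above a prime $\mathfrak{p}$ of $K$ is $[\mathcal{O}_L/\wp:\mathcal{O}_K/\mathfrak{p}]$, and $$\mathbf{R}_{L/K}=\{f\in\mathbb{N}: \text{the class group of } L \text{ is generated by the classes of prime ideals of } L \text{ that are unramified over } K \text{ and have residue degree } f \text{ for } L/K\}.$$ *)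

theory Defs
  imports
    "HOL-Algebra.Algebra"
    "HOL-Algebra.Algebraic_Closure_Type"
    "HOL-Number_Theory.Number_Theory"
    "HOL-Computational_Algebra.Computational_Algebra"
begin

text \<open>
  Number fields are subfields of the complex numbers, where \<open>\<complex>\<close> is regarded as a
  HOL-Algebra ring. The definitions below are meant for number fields \<open>K\<close> and
  \<open>L\<close> with \<open>K \<subseteq> L\<close>.
\<close>

abbreviation complex_ring :: "complex ring"
  where "complex_ring \<equiv> ring_of_type_algebra"

definition primitive_root_of_unity :: "nat \<Rightarrow> complex \<Rightarrow> bool"
  where "primitive_root_of_unity n \<zeta> \<longleftrightarrow> \<zeta> ^ n = 1 \<and> (\<forall>k. 0 < k \<and> k < n \<longrightarrow> \<zeta> ^ k \<noteq> 1)"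

definition cyclotomic_field :: "complex \<Rightarrow> complex set"
  where "cyclotomic_field \<zeta> = generate_field complex_ring {\<zeta>}"

definition quadratic_field :: "complex set \<Rightarrow> bool"
  where "quadratic_field F \<longleftrightarrow> subfield F complex_ring \<and> ring.dimension complex_ring 2 \<rat> F"

definition integers_of :: "complex set \<Rightarrow> complex set"
  where "integers_of K = {x \<in> K. algebraic_int x}"

definition integer_ring :: "complex set \<Rightarrow> complex ring"
  where "integer_ring K = complex_ring \<lparr>carrier := integers_of K\<rparr>"


subsection \<open>The class group\<close>

definition fractional_ideal :: "complex set \<Rightarrow> complex set \<Rightarrow> bool"
  where "fractional_ideal K I \<longleftrightarrow>
    I \<subseteq> K \<and> I \<noteq> {0} \<and> additive_subgroup I complex_ring \<and>
    (\<forall>a \<in> integers_of K. \<forall>x \<in> I. a * x \<in> I) \<and>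
    (\<exists>d \<in> integers_of K - {0}. \<forall>x \<in> I. d * x \<in> integers_of K)"

text \<open>
  \<^const>\<open>ideal_prod\<close> taken in \<open>\<complex>\<close> yields the finite sums of products; it does not
  require its arguments to be ideals of \<open>\<complex>\<close>.
\<close>

definition fractional_ideals :: "complex set \<Rightarrow> complex set monoid"
  where "fractional_ideals K =
    \<lparr>carrier = {I. fractional_ideal K I}, monoid.mult = ideal_prod complex_ring, one = integers_of K\<rparr>"

definition principal_fractional_ideals :: "complex set \<Rightarrow> complex set set"
  where "principal_fractional_ideals K = {(*) a ` integers_of K | a. a \<in> K - {0}}"

definition class_group :: "complex set \<Rightarrow> complex set set monoid"
  where "class_group K = fractional_ideals K Mod principal_fractional_ideals K"

definition ideal_class :: "complex set \<Rightarrow> complex set \<Rightarrow> complex set set"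
  where "ideal_class K I = principal_fractional_ideals K #>\<^bsub>fractional_ideals K\<^esub> I"

definition class_number :: "complex set \<Rightarrow> nat"
  where "class_number K = Coset.order (class_group K)"


subsection \<open>Primes in an extension\<close>

text \<open>As usual for Dedekind domains, the zero ideal is not counted as a prime of the field.\<close>

definition field_primes :: "complex set \<Rightarrow> complex set set"
  where "field_primes L = {P. primeideal P (integer_ring L) \<and> P \<noteq> {0}}"

text \<open>
  For a prime \<open>P\<close> of \<open>L\<close>, the prime of \<open>K\<close> below it is \<open>P \<inter> integers_of K\<close>. Its residue
  field is identified with its image in the residue field of \<open>P\<close>.
\<close>

definition residue_degree :: "complex set \<Rightarrow> complex set \<Rightarrow> complex set \<Rightarrow> nat"
  where "residue_degree L K P =
    ring.dim (integer_ring L Quot P)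
      ((\<lambda>x. P +>\<^bsub>integer_ring L\<^esub> x) ` integers_of K)
      (carrier (integer_ring L Quot P))"

text \<open>
  The exponent of \<open>P\<close> in the factorisation of the extension to \<open>L\<close> of the prime below \<open>P\<close>.
\<close>

definition ramification_index :: "complex set \<Rightarrow> complex set \<Rightarrow> complex set \<Rightarrow> nat"
  where "ramification_index L K P =
    (GREATEST e. P [^]\<^bsub>ideals_set (integer_ring L)\<^esub> e
       divides\<^bsub>ideals_set (integer_ring L)\<^esub> (Idl\<^bsub>integer_ring L\<^esub> (P \<inter> integers_of K)))"

definition unramified :: "complex set \<Rightarrow> complex set \<Rightarrow> complex set \<Rightarrow> bool"
  where "unramified L K P \<longleftrightarrow> ramification_index L K P = 1"

definition generating_residue_degrees :: "complex set \<Rightarrow> complex set \<Rightarrow> nat set"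
  where "generating_residue_degrees L K =
    {f. generate (class_group L)
          (ideal_class L ` {P \<in> field_primes L. unramified L K P \<and> residue_degree L K P = f})
        = carrier (class_group L)}"

end

theory Submission
  imports Defs "Jordan_Normal_Form.Char_Poly"
begin

text \<open>
  Let \<open>L\<close> be the cyclotomic field, \<open>H\<close> its Galois group over \<open>F\<close>, and \<open>m = \<phi>(n)/2\<close> the order
  of \<open>H\<close>, which is odd since \<open>p \<equiv> 3\<close> modulo 4; hence complex conjugation acts nontrivially on \<open>F\<close>.
  If a prime \<open>P\<close> of \<open>L\<close> above \<open>q\<close> has residue degree 2, then \<open>q \<equiv> -1\<close> modulo \<open>n\<close>, so the Frobenius at
  \<open>q\<close> is complex conjugation. It fixes \<open>P\<close>, while the conjugates of \<open>P\<close> under \<open>H\<close> are pairwise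
  comaximal and run through all primes above \<open>q\<close>: the product of these conjugates, the norm of \<open>P\<close>
  to \<open>F\<close>, is generated by \<open>q\<close>.
  If such primes generate the class group of \<open>L\<close>, every ideal of \<open>L\<close> therefore has principal norm.
  Applied to the extension of an ideal \<open>I\<close> of \<open>F\<close>, whose norm is the extension of \<open>I\<^sup>m\<close>, this shows
  that \<open>I\<^sup>m\<close> is principal. So \<open>m\<close> annihilates the finite class group of \<open>F\<close>, and Cauchy's theorem
  concludes.

  Invertibility of ideals is needed only in \<open>F\<close>, where the conjugate of an ideal is an inverse up to
  a principal factor, and for the primes \<open>P\<close>, where the norm formula supplies an inverse.
\<close>

section \<open>Additive subgroups of the complex numbers\<close>

definition zscale :: "int \<Rightarrow> complex \<Rightarrow> complex"
  where "zscale k x = of_int k * x"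

interpretation zm: Modules.module zscale
  by unfold_locales (simp_all add: zscale_def algebra_simps)

lemma zm_subspace_iff:
  "zm.subspace S \<longleftrightarrow> 0 \<in> S \<and> (\<forall>x\<in>S. \<forall>y\<in>S. x + y \<in> S) \<and> (\<forall>x\<in>S. - x \<in> S)"
proof (intro iffI conjI ballI)
  assume S: "0 \<in> S \<and> (\<forall>x\<in>S. \<forall>y\<in>S. x + y \<in> S) \<and> (\<forall>x\<in>S. - x \<in> S)"
  have nat: "of_nat m * x \<in> S" if "x \<in> S" for m x
    using that S by (induction m) (auto simp: algebra_simps)
  have "zscale k x \<in> S" if "x \<in> S" for k x
    using nat[OF that] S by (cases k rule: int_cases2) (auto simp: zscale_def)
  then show "zm.subspace S"
    using S by (intro zm.subspaceI) auto
qed (auto simp: zm.subspace_0 zm.subspace_add zm.subspace_neg)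

typedef zmod = "{S. zm.subspace S}" morphisms elts Zmod
  by (rule exI[of _ "{0}"]) simp

setup_lifting type_definition_zmod

lemma elts_zm [simp]: "zm.subspace (elts I)"
  using elts by simp

lemma elts_0 [simp, intro]: "0 \<in> elts I"
  and elts_add [intro]: "x \<in> elts I \<Longrightarrow> y \<in> elts I \<Longrightarrow> x + y \<in> elts I"
  and elts_minus [intro]: "x \<in> elts I \<Longrightarrow> - x \<in> elts I"
  and elts_diff [intro]: "x \<in> elts I \<Longrightarrow> y \<in> elts I \<Longrightarrow> x - y \<in> elts I"
  and elts_of_int_mult: "x \<in> elts I \<Longrightarrow> of_int k * x \<in> elts I"
  using zm.subspace_0[OF elts_zm[of I]] zm.subspace_add[OF elts_zm[of I]]
    zm.subspace_neg[OF elts_zm[of I]] zm.subspace_diff[OF elts_zm[of I]]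
    zm.subspace_scale[OF elts_zm[of I], of x k, unfolded zscale_def] by - assumption+

lemma elts_sum [intro]: "(\<And>i. i \<in> A \<Longrightarrow> f i \<in> elts I) \<Longrightarrow> sum f A \<in> elts I"
  by (rule zm.subspace_sum) auto

lemma elts_Zmod: "zm.subspace S \<Longrightarrow> elts (Zmod S) = S"
  by (simp add: Zmod_inverse)

instantiation zmod :: order
begin

lift_definition less_eq_zmod :: "zmod \<Rightarrow> zmod \<Rightarrow> bool" is "(\<subseteq>)" .

definition less_zmod :: "zmod \<Rightarrow> zmod \<Rightarrow> bool" where "less_zmod I J \<longleftrightarrow> I \<le> J \<and> \<not> J \<le> I"

instance
  by standard (transfer, auto simp: less_zmod_def)+

end

lemma zmod_eqI: "(\<And>x. x \<in> elts I \<longleftrightarrow> x \<in> elts J) \<Longrightarrow> I = J"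
  by transfer auto

lemma zmod_leD: "I \<le> J \<Longrightarrow> x \<in> elts I \<Longrightarrow> x \<in> elts J"
  by transfer auto

lemma zmod_leI: "(\<And>x. x \<in> elts I \<Longrightarrow> x \<in> elts J) \<Longrightarrow> I \<le> J"
  by transfer auto

lift_definition zspan :: "complex set \<Rightarrow> zmod" is zm.span
  by simp

lemma zspan_le_iff: "zspan A \<le> J \<longleftrightarrow> A \<subseteq> elts J"
  by transfer (metis zm.span_minimal zm.span_superset subset_trans)

lemma zspan_base: "x \<in> A \<Longrightarrow> x \<in> elts (zspan A)"
  by transfer (rule zm.span_base)

instantiation zmod :: comm_semiring_1
begin

lift_definition zero_zmod :: zmod is "{0}" by simp

definition one_zmod :: zmod where "one_zmod = zspan {1}"

lift_definition plus_zmod :: "zmod \<Rightarrow> zmod \<Rightarrow> zmod" is "\<lambda>I J. {x + y | x y. x \<in> I \<and> y \<in> J}"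
proof -
  fix I J :: "complex set"
  assume IJ: "zm.subspace I" "zm.subspace J"
  show "zm.subspace {x + y | x y. x \<in> I \<and> y \<in> J}"
    unfolding zm_subspace_iff
  proof (intro conjI ballI)
    show "0 \<in> {x + y | x y. x \<in> I \<and> y \<in> J}"
      using IJ zm.subspace_0 by force
  next
    fix a b
    assume "a \<in> {x + y | x y. x \<in> I \<and> y \<in> J}" "b \<in> {x + y | x y. x \<in> I \<and> y \<in> J}"
    then obtain x y x' y' where "a = x + y" "b = x' + y'" "x \<in> I" "y \<in> J" "x' \<in> I" "y' \<in> J"
      by blast
    moreover from this have "a + b = (x + x') + (y + y')" by simp
    ultimately show "a + b \<in> {x + y | x y. x \<in> I \<and> y \<in> J}"
      using IJ zm.subspace_add by blast
  next
    fix a assume "a \<in> {x + y | x y. x \<in> I \<and> y \<in> J}"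
    then obtain x y where "a = x + y" "x \<in> I" "y \<in> J"
      by blast
    moreover from this have "- a = - x + - y" by simp
    ultimately show "- a \<in> {x + y | x y. x \<in> I \<and> y \<in> J}"
      using IJ zm.subspace_neg by blast
  qed
qed

definition times_zmod :: "zmod \<Rightarrow> zmod \<Rightarrow> zmod"
  where "times_zmod I J = zspan {x * y | x y. x \<in> elts I \<and> y \<in> elts J}"

lemma elts_one: "elts 1 = \<int>"
proof -
  have "elts 1 = range (\<lambda>k. zscale k 1)"
    unfolding one_zmod_def by transfer (rule zm.span_singleton)
  then show ?thesis by (auto simp: zscale_def Ints_def)
qed

lemma elts_zero [simp]: "elts 0 = {0}"
  by transfer simp

lemma elts_mult: "x \<in> elts I \<Longrightarrow> y \<in> elts J \<Longrightarrow> x * y \<in> elts (I * J)"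
  unfolding times_zmod_def by (rule zspan_base) auto

lemma zmod_mult_le_iff: "I * J \<le> K \<longleftrightarrow> (\<forall>x\<in>elts I. \<forall>y\<in>elts J. x * y \<in> elts K)"
  unfolding times_zmod_def zspan_le_iff by auto

lemma zmod_mult_induct [consumes 1, case_names prod add minus]:
  assumes "x \<in> elts (I * J)"
    and "\<And>a b. a \<in> elts I \<Longrightarrow> b \<in> elts J \<Longrightarrow> P (a * b)"
    and "\<And>x y. P x \<Longrightarrow> P y \<Longrightarrow> P (x + y)" and "\<And>x. P x \<Longrightarrow> P (- x)"
  shows "P x"
proof -
  have P0: "P 0" using assms(2)[of 0 0] by simp
  have sub: "zm.subspace {x. P x}"
    unfolding zm_subspace_iff mem_Collect_eq
    by (intro conjI ballI CollectI; (elim CollectE)?)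
       (rule P0, rule assms(3), assumption+, rule assms(4), assumption)
  have "I * J \<le> Zmod {x. P x}"
    unfolding zmod_mult_le_iff elts_Zmod[OF sub] mem_Collect_eq
    by (intro ballI) (rule assms(2))
  from zmod_leD[OF this assms(1)] show ?thesis
    by (simp add: elts_Zmod[OF sub])
qed

lemma zmod_mult3_le: "I * J * K \<le> M"
  if "\<And>x y z. x \<in> elts I \<Longrightarrow> y \<in> elts J \<Longrightarrow> z \<in> elts K \<Longrightarrow> x * y * z \<in> elts M"
  unfolding zmod_mult_le_iff
proof (intro ballI)
  fix u z assume "u \<in> elts (I * J)" and z: "z \<in> elts K"
  then show "u * z \<in> elts M"
    by (induction rule: zmod_mult_induct) (auto simp: that distrib_right)
qed

lemma zmod_mult_comm_le: "I * J \<le> J * (I :: zmod)"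
  unfolding zmod_mult_le_iff by (metis elts_mult mult.commute)

lemma elts_add_iff: "x \<in> elts (I + J) \<longleftrightarrow> (\<exists>a\<in>elts I. \<exists>b\<in>elts J. x = a + b)"
  by transfer auto

instance
proof
  fix I J K :: zmod
  show comm: "I * J = J * I" for I J :: zmod
    by (rule antisym) (rule zmod_mult_comm_le)+
  have le: "I * J * K \<le> I * (J * K)" for I J K :: zmod
    by (rule zmod_mult3_le) (simp add: mult.assoc elts_mult)
  show "I * J * K = I * (J * K)"
    by (rule antisym) (use le[of I J K] le[of K J I] in \<open>simp_all add: comm\<close>)
  have "I \<le> 1 * I"
  proof (rule zmod_leI)
    fix x assume "x \<in> elts I"
    then have "1 * x \<in> elts (1 * I)"
      by (intro elts_mult) (simp_all add: elts_one)
    then show "x \<in> elts (1 * I)" by simp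
  qed
  moreover have "1 * I \<le> I"
    by (auto simp: zmod_mult_le_iff elts_one elim!: Ints_cases intro: elts_of_int_mult)
  ultimately show "1 * I = I" by simp
  show "I + J + K = I + (J + K)"
  proof (rule zmod_eqI)
    fix x
    have "x \<in> elts (I + J + K) \<longleftrightarrow> (\<exists>a\<in>elts I. \<exists>b\<in>elts J. \<exists>c\<in>elts K. x = a + b + c)"
      by (subst elts_add_iff, unfold Bex_def elts_add_iff) blast
    also have "\<dots> \<longleftrightarrow> x \<in> elts (I + (J + K))"
      by (subst elts_add_iff, unfold Bex_def elts_add_iff add.assoc) blast
    finally show "x \<in> elts (I + J + K) \<longleftrightarrow> x \<in> elts (I + (J + K))" .
  qed
  show comm_add: "I + J = J + I" for I J :: zmod
  proof (rule zmod_eqI)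
    fix x
    show "x \<in> elts (I + J) \<longleftrightarrow> x \<in> elts (J + I)"
      unfolding elts_add_iff by (auto intro: add.commute)
  qed
  show "0 + I = I"
    by (rule zmod_eqI) (simp add: elts_add_iff)
  show zero: "0 * I = 0" for I :: zmod
    by (rule antisym) (auto simp: zmod_mult_le_iff intro!: zmod_leI)
  show "I * 0 = 0"
    using zero[of I] comm[of I 0] by simp
  show "(I + J) * K = I * K + J * K"
  proof (rule antisym)
    show "(I + J) * K \<le> I * K + J * K"
      unfolding zmod_mult_le_iff
    proof (intro ballI)
      fix x y assume "x \<in> elts (I + J)" and y: "y \<in> elts K"
      then obtain a b where "a \<in> elts I" "b \<in> elts J" "x = a + b"
        unfolding elts_add_iff by blast
      with y show "x * y \<in> elts (I * K + J * K)"
        unfolding elts_add_iff by (auto intro!: bexI elts_mult simp: distrib_right)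
    qed
    have le: "I * K \<le> (I + J) * K" for I J
      unfolding zmod_mult_le_iff
    proof (intro ballI)
      fix x y assume x: "x \<in> elts I" and y: "y \<in> elts K"
      have "x \<in> elts (I + J)"
        unfolding elts_add_iff by (rule bexI[OF _ x], rule bexI[of _ 0]) auto
      with y show "x * y \<in> elts ((I + J) * K)"
        by (rule elts_mult[rotated])
    qed
    show "I * K + J * K \<le> (I + J) * K"
    proof (rule zmod_leI)
      fix x assume "x \<in> elts (I * K + J * K)"
      then obtain a b where "a \<in> elts (I * K)" "b \<in> elts (J * K)" "x = a + b"
        unfolding elts_add_iff by blast
      then show "x \<in> elts ((I + J) * K)"
        using zmod_leD[OF le[of I J]] zmod_leD[OF le[of J I]] comm_add[of J I] by auto
    qed
  qed
  show "(0 :: zmod) \<noteq> 1"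
    by (metis Ints_1 elts_one elts_zero singletonD zero_neq_one)
qed

end

lemma zmod_mult_mono: "I \<le> I' \<Longrightarrow> J \<le> J' \<Longrightarrow> I * J \<le> I' * (J' :: zmod)"
  by (auto simp: zmod_mult_le_iff dest: zmod_leD intro: elts_mult)

lemma zmod_le_add: "I \<le> I + (J :: zmod)" "J \<le> I + J"
  by (rule zmod_leI, unfold elts_add_iff, force)+

lemma ideal_prod_eq_elts: "ideal_prod complex_ring (elts I) (elts J) = elts (I * J)"
proof (intro equalityI subsetI)
  have ring: "monoid.mult complex_ring = (*)" "add complex_ring = (+)"
    by (auto simp: ring_of_type_algebra_def)
  fix x assume "x \<in> ideal_prod complex_ring (elts I) (elts J)"
  then show "x \<in> elts (I * J)"
    by induction (auto simp: ring elts_mult)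
next
  have ring: "monoid.mult complex_ring = (*)" "add complex_ring = (+)"
    by (auto simp: ring_of_type_algebra_def)
  let ?S = "ideal_prod complex_ring (elts I) (elts J)"
  have prod: "a * b \<in> ?S" if "a \<in> elts I" "b \<in> elts J" for a b
    using ideal_prod.prod[OF that, of complex_ring] by (simp add: ring)
  have add: "a + b \<in> ?S" if "a \<in> ?S" "b \<in> ?S" for a b
    using ideal_prod.sum[OF that] by (simp add: ring)
  have minus: "- x \<in> ?S" if "x \<in> ?S" for x
    using that
  proof induction
    case (prod i j)
    then show ?case using \<open>\<And>b a. a \<in> elts I \<Longrightarrow> b \<in> elts J \<Longrightarrow> a * b \<in> ?S\<close>[of "- i" j] by (auto simp: ring)
  next
    case (sum a b)
    then show ?case using add[of "- a" "- b"] by (simp add: ring)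
  qed
  fix x assume "x \<in> elts (I * J)"
  then show "x \<in> ?S"
    by (induction rule: zmod_mult_induct) (auto intro: prod add minus)
qed

definition pr :: "complex \<Rightarrow> zmod" where "pr x = zspan {x}"

lemma elts_pr: "elts (pr x) = {of_int k * x | k. True}"
proof -
  have "elts (pr x) = range (\<lambda>k. zscale k x)"
    unfolding pr_def by transfer (rule zm.span_singleton)
  then show ?thesis by (auto simp: zscale_def)
qed

lemma pr_le_iff: "pr x \<le> I \<longleftrightarrow> x \<in> elts I"
  by (simp add: pr_def zspan_le_iff)

lemma pr_1: "pr 1 = 1"
  by (simp add: pr_def one_zmod_def)

lemma elts_pr_mult: "elts (pr x * J) = (*) x ` elts J"
proof (intro equalityI subsetI)
  fix u assume "u \<in> elts (pr x * J)"
  then show "u \<in> (*) x ` elts J"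
  proof (induction rule: zmod_mult_induct)
    case (prod a b)
    then obtain k where "a = of_int k * x" by (auto simp: elts_pr)
    then have "a * b = x * (of_int k * b)" by simp
    with prod show ?case using elts_of_int_mult by blast
  next
    case (add u v)
    then show ?case by (auto simp flip: distrib_left)
  next
    case (minus u)
    then show ?case by (auto simp flip: mult_minus_right)
  qed
next
  fix u assume "u \<in> (*) x ` elts J"
  moreover have "x \<in> elts (pr x)"
    using pr_le_iff by blast
  ultimately show "u \<in> elts (pr x * J)" by (auto intro: elts_mult)
qed

lemma pr_mult: "pr (x * y) = pr x * pr y"
proof (rule zmod_eqI)
  have "elts (pr x * pr y) = {x * (of_int k * y) | k. True}"
    by (auto simp: elts_pr_mult elts_pr)
  also have "\<dots> = elts (pr (x * y))"
    by (simp add: elts_pr mult_ac)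
  finally show "u \<in> elts (pr (x * y)) \<longleftrightarrow> u \<in> elts (pr x * pr y)" for u
    by simp
qed

lemma pr_prod: "pr (prod f A) = (\<Prod>i\<in>A. pr (f i))"
  by (induction A rule: infinite_finite_induct) (auto simp: pr_1 pr_mult)

lemma pr_inverse_mult: "x \<noteq> 0 \<Longrightarrow> pr x * (pr (inverse x) * I) = I" "x \<noteq> 0 \<Longrightarrow> pr (inverse x) * (pr x * I) = I"
  by (simp_all add: pr_1 flip: mult.assoc pr_mult)

section \<open>Algebraic integers form a ring\<close>

lemma algebraic_int_if_stable:
  fixes v :: "nat \<Rightarrow> complex" and z :: complex and c :: "nat \<Rightarrow> nat \<Rightarrow> int"
  assumes eq: "\<And>i. i < n \<Longrightarrow> z * v i = (\<Sum>j<n. of_int (c i j) * v j)"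
    and nz: "k < n" "v k \<noteq> 0"
  shows "algebraic_int z"
proof -
  define B where "B = Matrix.mat n n (\<lambda>(i,j). c i j)"
  define A where "A = map_mat (of_int :: int \<Rightarrow> complex) B"
  have B: "B \<in> carrier_mat n n" and A: "A \<in> carrier_mat n n"
    by (auto simp: A_def B_def)
  have "A *\<^sub>v Matrix.vec n v = z \<cdot>\<^sub>v Matrix.vec n v"
    by (rule eq_vecI)
       (auto simp: A_def B_def eq scalar_prod_def atLeast0LessThan intro!: sum.cong)
  moreover have "Matrix.vec n v \<noteq> 0\<^sub>v n"
    using nz by (metis index_vec index_zero_vec(1))
  ultimately have "eigenvalue A z"
    using A unfolding eigenvalue_def eigenvector_def by (intro exI[of _ "Matrix.vec n v"]) auto
  then have "poly (char_poly A) z = 0"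
    using eigenvalue_root_char_poly[OF A] by simp
  also have "char_poly A = map_poly of_int (char_poly B)"
    unfolding A_def by (rule of_int_hom.char_poly_hom[OF B])
  finally show ?thesis
    using degree_monic_char_poly[OF B] algebraic_int_altdef_ipoly by blast
qed

lemma algebraic_int_power_reduce:
  fixes x :: complex
  assumes "algebraic_int x"
  obtains a p where "a > 0" and "x ^ a = (\<Sum>i<a. of_int (p i) * x ^ i)"
proof -
  obtain p where p: "poly (map_poly of_int p) x = 0" "lead_coeff p = 1"
    using assms by (auto simp: algebraic_int_altdef_ipoly)
  define a where "a = degree p"
  have eq: "(\<Sum>i\<le>a. of_int (coeff p i) * x ^ i) = 0"
    using p(1) by (simp add: poly_altdef a_def degree_map_poly)
  have "a > 0"
  proof (rule ccontr)
    assume "\<not> a > 0"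
    with eq p(2) show False by (simp add: a_def)
  qed
  moreover have "x ^ a = (\<Sum>i<a. of_int (- coeff p i) * x ^ i)"
    using eq p(2) unfolding lessThan_Suc_atMost[symmetric] a_def
    by (simp add: sum_negf) (metis add.commute add_eq_0_iff)
  ultimately show thesis by (rule that)
qed

lemma algebraic_int_plus_times:
  fixes x y :: complex
  assumes "algebraic_int x" "algebraic_int y"
  shows "algebraic_int (x + y)" and "algebraic_int (x * y)"
proof -
  obtain a p where a: "a > 0" "x ^ a = (\<Sum>i<a. of_int (p i) * x ^ i)"
    using algebraic_int_power_reduce[OF assms(1)] by blast
  obtain b q where b: "b > 0" "y ^ b = (\<Sum>i<b. of_int (q i) * y ^ i)"
    using algebraic_int_power_reduce[OF assms(2)] by blast
  define v where "v k = x ^ (k div b) * y ^ (k mod b)" for k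
  define W where "W = zspan (v ` {..<a*b})"
  have W0: "x ^ i * y ^ j \<in> elts W" if "i < a" "j < b" for i j
  proof -
    have "i * b + j < a * b"
    proof -
      have "i * b + j < Suc i * b" using that by simp
      also have "\<dots> \<le> a * b" using that by (intro mult_right_mono) auto
      finally show ?thesis .
    qed
    moreover have "v (i * b + j) = x ^ i * y ^ j"
      using that by (simp add: v_def)
    ultimately show ?thesis
      unfolding W_def by (metis imageI lessThan_iff zspan_base)
  qed
  have W1: "x ^ i * y ^ j \<in> elts W" if "i \<le> a" "j < b" for i j
  proof (cases "i = a")
    case True
    have "x ^ a * y ^ j = (\<Sum>i<a. of_int (p i) * (x ^ i * y ^ j))"
      unfolding a(2) by (simp add: sum_distrib_right mult.assoc)
    also have "\<dots> \<in> elts W"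
      using W0 that by (intro elts_sum elts_of_int_mult) auto
    finally show ?thesis using True by simp
  qed (use W0 that in auto)
  have W2: "x ^ i * y ^ j \<in> elts W" if "i \<le> a" "j \<le> b" for i j
  proof (cases "j = b")
    case True
    have "x ^ i * y ^ b = (\<Sum>j<b. of_int (q j) * (x ^ i * y ^ j))"
      unfolding b(2) by (simp add: sum_distrib_left mult.left_commute mult.assoc)
    also have "\<dots> \<in> elts W"
      using W1 that by (intro elts_sum elts_of_int_mult) auto
    finally show ?thesis using True by simp
  qed (use W1 that in auto)
  have W_sum: "\<exists>c. w = (\<Sum>j<a*b. of_int (c j) * v j)" if "w \<in> elts W" for w
  proof -
    have "w \<in> zm.span (v ` {..<a*b})"
      using that unfolding W_def by transfer
    then obtain S r where S: "finite S" "S \<subseteq> v ` {..<a*b}" "w = (\<Sum>s\<in>S. zscale (r s) s)"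
      unfolding zm.span_explicit by blast
    obtain T where T: "T \<subseteq> {..<a*b}" "S = v ` T" "inj_on v T"
      using S(2) by (metis subset_image_inj)
    have "w = (\<Sum>j\<in>T. of_int (r (v j)) * v j)"
      unfolding S(3) T(2) using T(3) by (simp add: sum.reindex zscale_def)
    also have "\<dots> = (\<Sum>j<a*b. of_int (if j \<in> T then r (v j) else 0) * v j)"
      by (rule sum.mono_neutral_cong_left) (use T in auto)
    finally show ?thesis
      by (rule exI[of _ "\<lambda>j. if j \<in> T then r (v j) else 0"])
  qed
  have main: "algebraic_int z" if z: "\<And>k. k < a * b \<Longrightarrow> z * v k \<in> elts W" for z
  proof -
    have "\<forall>k. \<exists>c. k < a * b \<longrightarrow> z * v k = (\<Sum>j<a*b. of_int (c j) * v j)"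
      using W_sum[OF z] by blast
    then obtain c where "\<And>k. k < a * b \<Longrightarrow> z * v k = (\<Sum>j<a*b. of_int (c k j) * v j)"
      by metis
    then show ?thesis
      by (rule algebraic_int_if_stable[where k = 0]) (use a(1) b(1) in \<open>auto simp: v_def\<close>)
  qed
  have idx: "k div b < a" "k mod b < b" if "k < a * b" for k
    using that b(1) by (auto simp: less_mult_imp_div_less)
  show "algebraic_int (x + y)"
  proof (rule main)
    fix k assume "k < a * b"
    then show "(x + y) * v k \<in> elts W"
      using W2[of "Suc (k div b)" "k mod b"] W2[of "k div b" "Suc (k mod b)"] idx[of k]
      by (auto simp: v_def algebra_simps)
  qed
  show "algebraic_int (x * y)"
  proof (rule main)
    fix k assume "k < a * b"
    then show "x * y * v k \<in> elts W"
      using W2[of "Suc (k div b)" "Suc (k mod b)"] idx[of k]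
      by (auto simp: v_def algebra_simps)
  qed
qed

lemmas algebraic_int_plus = algebraic_int_plus_times(1)
lemmas algebraic_int_times = algebraic_int_plus_times(2)

lemma algebraic_int_diff: "algebraic_int x \<Longrightarrow> algebraic_int y \<Longrightarrow> algebraic_int (x - y :: complex)"
  using algebraic_int_plus[of x "- y"] by simp

lemma algebraic_int_sum: "(\<And>i. i \<in> A \<Longrightarrow> algebraic_int (f i)) \<Longrightarrow> algebraic_int (\<Sum>i\<in>A. f i :: complex)"
  by (induction A rule: infinite_finite_induct) (auto intro: algebraic_int_plus)

lemma algebraic_int_prod: "(\<And>i. i \<in> A \<Longrightarrow> algebraic_int (f i)) \<Longrightarrow> algebraic_int (\<Prod>i\<in>A. f i :: complex)"
  by (induction A rule: infinite_finite_induct) (auto intro: algebraic_int_times)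

lemma algebraic_int_power: "algebraic_int x \<Longrightarrow> algebraic_int (x ^ k :: complex)"
  by (induction k) (auto intro: algebraic_int_times)

section \<open>Prime power cyclotomic fields\<close>

definition ev :: "rat poly \<Rightarrow> complex \<Rightarrow> complex"
  where "ev f x = poly (map_poly of_rat f) x"

definition evi :: "int poly \<Rightarrow> complex \<Rightarrow> complex"
  where "evi f x = poly (map_poly of_int f) x"

interpretation of_rat_poly: map_poly_comm_ring_hom "of_rat :: rat \<Rightarrow> complex" ..

lemma ev_simps [simp]:
  "ev 0 x = 0" "ev 1 x = 1" "ev (pCons c f) x = of_rat c + x * ev f x"
  "ev (f + g) x = ev f x + ev g x" "ev (f - g) x = ev f x - ev g x" "ev (- f) x = - ev f x"
  "ev (f * g) x = ev f x * ev g x" "ev (smult c f) x = of_rat c * ev f x"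
  "ev (monom c i) x = of_rat c * x ^ i" "ev (f \<circ>\<^sub>p g) x = ev f (ev g x)"
  "ev (map_poly of_int F) x = evi F x"
  by (simp_all add: ev_def evi_def of_rat_poly.hom_add of_rat_poly.hom_minus of_rat_poly.hom_uminus
      of_rat_poly.hom_mult of_rat_hom.map_poly_pCons_hom of_rat_hom.map_poly_pcompose poly_pcompose poly_monom map_poly_map_poly o_def
      map_poly_monom of_rat_hom.map_poly_hom_smult)

lemma evi_simps [simp]:
  "evi 0 x = 0" "evi 1 x = 1" "evi (pCons c f) x = of_int c + x * evi f x"
  "evi (f + g) x = evi f x + evi g x" "evi (f - g) x = evi f x - evi g x" "evi (- f) x = - evi f x"
  "evi (f * g) x = evi f x * evi g x" "evi (smult c f) x = of_int c * evi f x"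
  "evi (monom c i) x = of_int c * x ^ i" "evi (f \<circ>\<^sub>p g) x = evi f (evi g x)"
  by (simp_all add: evi_def of_int_poly_hom.hom_add of_int_poly_hom.hom_minus of_int_poly_hom.hom_uminus
      of_int_poly_hom.hom_mult of_int_hom.map_poly_pCons_hom of_int_hom.map_poly_pcompose poly_pcompose poly_monom
      map_poly_monom of_int_hom.map_poly_hom_smult)


lemma evi_sum [simp]: "evi (\<Sum>i\<in>A. f i) x = (\<Sum>i\<in>A. evi (f i) x)"
  by (induction A rule: infinite_finite_induct) auto

lemma evi_altdef: "degree f < N \<Longrightarrow> evi f x = (\<Sum>i<N. of_int (coeff f i) * x ^ i)"
  unfolding evi_def by (subst poly_altdef, rule sum.mono_neutral_cong_left) (auto simp: degree_map_poly coeff_eq_0)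

lemma ev_altdef: "degree f < N \<Longrightarrow> ev f x = (\<Sum>i<N. of_rat (coeff f i) * x ^ i)"
  unfolding ev_def by (subst poly_altdef, rule sum.mono_neutral_cong_left) (auto simp: degree_map_poly coeff_eq_0)

lemma algebraic_int_evi: "algebraic_int x \<Longrightarrow> algebraic_int (evi f x)"
  by (induction f) (auto intro!: algebraic_int_plus algebraic_int_times)

lemma rat_poly_common_denominator:
  obtains d :: int and B where "d > 0" "smult (of_int d) f = (map_poly of_int B :: rat poly)"
proof -
  have "\<exists>d>0. \<exists>B. smult (of_int d) f = (map_poly of_int B :: rat poly)"
  proof (induction f)
    case 0
    have "smult (of_int 1) 0 = (map_poly of_int 0 :: rat poly)" by simp
    then show ?case by (intro exI[of _ "1::int"] conjI exI[of _ "0::int poly"]) simp_all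
  next
    case (pCons a f)
    then obtain d B where d: "d > 0" "smult (of_int d) f = (map_poly of_int B :: rat poly)" by blast
    obtain s t where st: "t > 0" "a = of_int s / of_int t"
      by (metis Fract_of_int_quotient Rat_cases)
    have "smult (of_int (d * t)) (pCons a f) = map_poly of_int (pCons (s * d) (smult t B))"
      using st(1) by (simp add: st(2) of_int_hom.map_poly_hom_smult of_int_hom.map_poly_pCons_hom mult.commute flip: d(2))
    then show ?case using d(1) st(1) by (meson mult_pos_pos)
  qed
  then show thesis using that by blast
qed

lift_definition AI :: zmod is "{x. algebraic_int x}"
  by (auto simp: zm_subspace_iff algebraic_int_plus)

lemma elts_AI: "x \<in> elts AI \<longleftrightarrow> algebraic_int x"
  by transfer auto

lemma elts_pr_AI: "x \<in> elts (pr y * AI) \<longleftrightarrow> (\<exists>a. algebraic_int a \<and> x = y * a)"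
  by (auto simp: elts_pr_mult elts_AI)

locale prime_power_cyclotomic =
  fixes p r :: nat and \<zeta> :: complex
  assumes prime_p: "Factorial_Ring.prime p" and odd_p: "odd p" and r_pos: "r \<ge> 1"
    and prim: "primitive_root_of_unity (p ^ r) \<zeta>"
begin

definition n :: nat where "n = p ^ r"
definition m :: nat where "m = p ^ (r - 1)"
definition N :: nat where "N = n - m"
definition T :: "nat set" where "T = {k. k < n \<and> coprime k p}"

lemma p_gt_2: "p > 2"
  using prime_p odd_p prime_gt_1_nat[of p] by (cases "p = 2") auto

lemma n_eq: "n = p * m"
  using r_pos by (simp add: n_def m_def flip: power_Suc)

lemma m_pos: "m > 0"
  using p_gt_2 by (simp add: m_def)

lemma N_eq: "N = m * (p - 1)" "N + m = n" "N > 0" "N < n" "n > 2"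
proof -
  show "N = m * (p - 1)" by (simp add: N_def n_eq diff_mult_distrib2 mult.commute[of p])
  show "N + m = n" using n_eq p_gt_2 by (simp add: N_def)
  show "N > 0" "N < n" using n_eq p_gt_2 m_pos by (auto simp: N_def)
  have "p * 1 \<le> p * m" using m_pos by (intro mult_le_mono2) simp
  then show "n > 2" using n_eq p_gt_2 by linarith
qed

lemma totient_n: "totient n = N"
  using totient_prime_power[OF prime_p, of r] r_pos by (simp add: n_def N_eq m_def)

lemma finite_T [simp, intro]: "finite T"
  by (auto simp: T_def)

lemma coprime_n: "coprime k n \<longleftrightarrow> coprime k p"
  using r_pos by (simp add: n_def)

lemma coprime_p_iff: "coprime k p \<longleftrightarrow> \<not> p dvd k"
proof
  assume "coprime k p"
  then show "\<not> p dvd k"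
    using p_gt_2 by (metis coprime_common_divisor_nat dvd_refl nat_neq_iff numeral_2_eq_2 Suc_lessD One_nat_def)
next
  assume "\<not> p dvd k"
  then show "coprime k p"
    using prime_p by (metis coprime_commute prime_imp_coprime)
qed

lemma T_altdef: "T = totatives n"
proof (intro equalityI subsetI)
  fix k assume k: "k \<in> T"
  then have "k \<noteq> 0" by (intro notI) (simp add: T_def coprime_p_iff)
  with k show "k \<in> totatives n" by (simp add: T_def totatives_def coprime_n)
next
  fix k assume k: "k \<in> totatives n"
  then have "coprime k p" "k \<le> n" by (auto simp: totatives_def coprime_n)
  moreover have "k \<noteq> n" using \<open>coprime k p\<close> by (auto simp: coprime_p_iff n_eq)
  ultimately show "k \<in> T" by (simp add: T_def)
qed

lemma card_T: "card T = N"
  using totient_n by (simp add: T_altdef totient_def)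

lemma zeta_n: "\<zeta> ^ n = 1"
  using prim by (simp add: primitive_root_of_unity_def n_def)

lemma zeta_ne_0: "\<zeta> \<noteq> 0"
  using zeta_n N_eq(5) by (auto simp: power_0_left)

lemma zeta_mod: "\<zeta> ^ (k mod n) = \<zeta> ^ k"
proof -
  have "\<zeta> ^ k = \<zeta> ^ (n * (k div n) + k mod n)" by simp
  also have "\<dots> = \<zeta> ^ (k mod n)" by (simp only: power_add power_mult zeta_n) simp
  finally show ?thesis by simp
qed

lemma zeta_pow_eq_1_iff: "\<zeta> ^ k = 1 \<longleftrightarrow> n dvd k"
proof -
  have "k mod n < n" using N_eq(5) by simp
  then have "\<zeta> ^ (k mod n) = 1 \<longleftrightarrow> k mod n = 0"
    using prim by (auto simp: primitive_root_of_unity_def n_def)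
  then show ?thesis by (simp add: zeta_mod dvd_eq_mod_eq_0)
qed

lemma zeta_pow_eq_iff: "\<zeta> ^ i = \<zeta> ^ j \<longleftrightarrow> i mod n = j mod n"
proof (induction i j rule: linorder_wlog)
  case (le i j)
  then have "\<zeta> ^ j = \<zeta> ^ i * \<zeta> ^ (j - i)" by (simp flip: power_add)
  then have "\<zeta> ^ i = \<zeta> ^ j \<longleftrightarrow> n dvd j - i"
    using zeta_ne_0 by (auto simp flip: zeta_pow_eq_1_iff)
  also have "\<dots> \<longleftrightarrow> i mod n = j mod n"
    using le by (metis mod_eq_dvd_iff_nat)
  finally show ?case .
qed metis

lemma cnj_zeta: "cnj \<zeta> = inverse \<zeta>" "\<zeta> ^ (n - 1) = inverse \<zeta>"
proof -
  have "norm \<zeta> ^ n = 1" using zeta_n by (metis norm_one norm_power)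
  then have "norm \<zeta> = 1"
    using N_eq(5) power_eq_1_iff[of "norm \<zeta>" n] by auto
  then have "cnj \<zeta> * \<zeta> = 1"
    by (metis complex_norm_square mult.commute of_real_1 one_power2)
  then show "cnj \<zeta> = inverse \<zeta>" by (metis inverse_unique mult.commute)
  have "\<zeta> ^ (n - 1) * \<zeta> = 1"
    using zeta_n N_eq(5) by (metis One_nat_def Suc_pred not_less_zero power_Suc2 zero_less_iff_neq_zero)
  then show "\<zeta> ^ (n - 1) = inverse \<zeta>" by (metis inverse_unique mult.commute)
qed

lemma algebraic_int_zeta: "algebraic_int \<zeta>"
proof (rule algebraic_int_root)
  show "poly (monom 1 n) \<zeta> = 1" by (simp add: poly_monom zeta_n)
qed (use N_eq in \<open>auto simp: degree_monom_eq\<close>)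

lemma n_dvd_mult_p: "n dvd i * p \<longleftrightarrow> m dvd i"
  using p_gt_2 by (simp add: n_eq mult.commute)

lemma sum_zeta_T: "(\<Sum>k\<in>T. \<zeta> ^ (i * k)) = (if n dvd i then of_nat n else 0) - (if m dvd i then of_nat m else 0)"
proof -
  have 1: "(\<Sum>k<n. \<zeta> ^ (i * k)) = (if n dvd i then of_nat n else 0)"
  proof -
    have "(\<zeta> ^ i) ^ n = 1" by (simp add: zeta_pow_eq_1_iff flip: power_mult)
    then show ?thesis
      by (simp add: power_mult sum_gp_strict zeta_pow_eq_1_iff)
  qed
  have 2: "(\<Sum>k<m. \<zeta> ^ (i * (p * k))) = (if m dvd i then of_nat m else 0)"
  proof -
    have "(\<zeta> ^ (i * p)) ^ m = 1"
      by (simp add: zeta_pow_eq_1_iff n_eq mult.assoc flip: power_mult)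
    then show ?thesis
      by (simp add: power_mult[of _ "i * p"] sum_gp_strict zeta_pow_eq_1_iff n_dvd_mult_p flip: mult.assoc)
  qed
  have "T = {..<n} - (\<lambda>k. p * k) ` {..<m}"
  proof (intro equalityI subsetI)
    fix k assume "k \<in> {..<n} - (\<lambda>k. p * k) ` {..<m}"
    then have k: "k < n" "k \<notin> (\<lambda>k. p * k) ` {..<m}" by auto
    have "\<not> p dvd k"
    proof
      assume "p dvd k"
      then obtain j where "k = p * j" by (elim dvdE)
      with k show False by (auto simp: n_eq)
    qed
    with k show "k \<in> T" by (simp add: T_def coprime_p_iff)
  qed (auto simp: T_def coprime_p_iff)
  moreover have "(\<lambda>k. p * k) ` {..<m} \<subseteq> {..<n}"
    using p_gt_2 by (auto simp: n_eq)
  ultimately have "(\<Sum>k\<in>T. \<zeta> ^ (i * k)) = (\<Sum>k<n. \<zeta> ^ (i * k)) - (\<Sum>k\<in>(\<lambda>k. p * k) ` {..<m}. \<zeta> ^ (i * k))"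
    by (simp add: sum_diff)
  also have "(\<Sum>k\<in>(\<lambda>k. p * k) ` {..<m}. \<zeta> ^ (i * k)) = (\<Sum>k<m. \<zeta> ^ (i * (p * k)))"
    using p_gt_2 by (subst sum.reindex) (auto simp: inj_on_def)
  finally show ?thesis unfolding 1 2 .
qed

definition Phi :: "int poly" where "Phi = (\<Sum>i<p. monom 1 (m * i))"

lemma evi_Phi: "evi Phi x = (\<Sum>i<p. (x ^ m) ^ i)"
  by (simp add: Phi_def power_mult)

lemma degree_Phi: "degree Phi = N" and lead_coeff_Phi: "coeff Phi N = 1"
proof -
  have "coeff Phi N = (\<Sum>i<p. if m * i = N then 1 else 0)"
    by (simp add: Phi_def coeff_sum)
  also have "\<dots> = (\<Sum>i<p. if i = p - 1 then 1 else 0)"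
    using m_pos p_gt_2 by (intro sum.cong) (auto simp: N_eq(1))
  also have "\<dots> = 1" using p_gt_2 by simp
  finally show 1: "coeff Phi N = 1" .
  have "degree Phi \<le> N"
    unfolding Phi_def
  proof (rule degree_sum_le)
    fix i assume "i \<in> {..<p}"
    then have "m * i \<le> N" unfolding N_eq(1) by (intro mult_left_mono) auto
    then show "degree (monom (1::int) (m * i)) \<le> N" by (metis degree_monom_le le_trans)
  qed simp
  with 1 show "degree Phi = N" by (metis le_antisym le_degree zero_neq_one)
qed

lemma evi_Phi_root: "coprime k p \<Longrightarrow> evi Phi (\<zeta> ^ k) = 0"
proof -
  assume "coprime k p"
  let ?x = "\<zeta> ^ (k * m)"
  have "\<not> n dvd k * m"
    using \<open>coprime k p\<close> m_pos by (simp add: n_eq coprime_p_iff)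
  then have "?x \<noteq> 1" by (simp add: zeta_pow_eq_1_iff)
  moreover have "?x ^ p = 1"
    by (simp add: zeta_pow_eq_1_iff n_eq mult_ac flip: power_mult)
  ultimately have "(\<Sum>i<p. ?x ^ i) = 0"
    by (simp only: sum_gp_strict) simp
  then show ?thesis
    by (simp only: evi_Phi power_mult)
qed

lemma inj_zeta_T: "inj_on (\<lambda>k. \<zeta> ^ k) T"
  by (auto simp: inj_on_def T_def zeta_pow_eq_iff)

lemma prod_T: "(\<Prod>k\<in>T. x - \<zeta> ^ k) = evi Phi x"
proof -
  have "(\<Prod>k\<in>T. [:- (\<zeta> ^ k), 1:]) = map_poly of_int Phi"
  proof (rule poly_eqI_degree_lead_coeff[where A = "(\<lambda>k. \<zeta> ^ k) ` T" and n = N])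
    have deg: "degree (\<Prod>k\<in>T. [:- (\<zeta> ^ k), 1:]) = N"
      by (subst degree_prod_eq_sum_degree) (auto simp: card_T)
    then show "degree (\<Prod>k\<in>T. [:- (\<zeta> ^ k), 1:]) \<le> N" by simp
    have "lead_coeff (\<Prod>k\<in>T. [:- (\<zeta> ^ k), 1:]) = 1"
      by (subst lead_coeff_prod) auto
    then show "coeff (\<Prod>k\<in>T. [:- (\<zeta> ^ k), 1:]) N = coeff (map_poly of_int Phi) N"
      by (simp add: deg lead_coeff_Phi)
    show "N \<le> card ((\<lambda>k. \<zeta> ^ k) ` T)"
      by (simp add: card_image inj_zeta_T card_T)
    fix z assume "z \<in> (\<lambda>k. \<zeta> ^ k) ` T"
    then obtain k where k: "k \<in> T" "z = \<zeta> ^ k" by auto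
    then show "poly (\<Prod>k\<in>T. [:- (\<zeta> ^ k), 1:]) z = poly (map_poly of_int Phi) z"
      using evi_Phi_root[of k] by (auto simp: poly_prod evi_def T_def)
  qed (simp add: degree_Phi)
  then have "poly (\<Prod>k\<in>T. [:- (\<zeta> ^ k), 1:]) x = evi Phi x" by (simp add: evi_def)
  then show ?thesis by (simp add: poly_prod)
qed

lemma prod_one_minus: "(\<Prod>k\<in>T. 1 - \<zeta> ^ k) = of_nat p"
  by (simp add: prod_T evi_Phi)

lemma one_minus_dvd: "\<exists>a. algebraic_int a \<and> 1 - \<zeta> ^ (k * l) = (1 - \<zeta> ^ k) * a"
  using algebraic_int_zeta
  by (intro exI[of _ "\<Sum>i<l. (\<zeta> ^ k) ^ i"])
     (auto intro!: algebraic_int_sum algebraic_int_power simp: one_diff_power_eq power_mult)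

lemma one_minus_dvd': "coprime k p \<Longrightarrow> \<exists>a. algebraic_int a \<and> 1 - \<zeta> = (1 - \<zeta> ^ k) * a"
proof -
  assume "coprime k p"
  then have "coprime k n" by (simp add: coprime_n)
  from cong_solve_coprime_nat[OF this] obtain l where "[k * l = 1] (mod n)" by auto
  then have "\<zeta> ^ (k * l) = \<zeta> ^ 1" unfolding zeta_pow_eq_iff by (simp add: cong_def)
  then show ?thesis using one_minus_dvd[of k l] by simp
qed

lemma p_eq_pi_power: "\<exists>a. algebraic_int a \<and> of_nat p = (1 - \<zeta>) ^ N * a"
proof -
  have "\<forall>k. \<exists>a. algebraic_int a \<and> 1 - \<zeta> ^ k = (1 - \<zeta>) * a"
    using one_minus_dvd[of 1] by simp
  then obtain a where a: "\<And>k. algebraic_int (a k)" "\<And>k. 1 - \<zeta> ^ k = (1 - \<zeta>) * a k"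
    by metis
  have "of_nat p = (1 - \<zeta>) ^ N * (\<Prod>k\<in>T. a k)"
    using prod_one_minus by (simp add: a(2) prod.distrib card_T)
  moreover have "algebraic_int (\<Prod>k\<in>T. a k)"
    using a(1) by (rule algebraic_int_prod)
  ultimately show ?thesis by blast
qed

lemma zeta_ne_1: "\<zeta> \<noteq> 1"
  using zeta_pow_eq_1_iff[of 1] N_eq(5) by auto

lemma pi_not_unit: "\<not> algebraic_int (inverse (1 - \<zeta>))"
proof
  assume unit: "algebraic_int (inverse (1 - \<zeta>))"
  have "algebraic_int (inverse (1 - \<zeta> ^ k))" if "k \<in> T" for k
  proof -
    have kp: "coprime k p" using that by (auto simp: T_def)
    from one_minus_dvd'[OF this] obtain a where a: "algebraic_int a" "1 - \<zeta> = (1 - \<zeta> ^ k) * a"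
      by blast
    then have "inverse (1 - \<zeta> ^ k) = a * inverse (1 - \<zeta>)"
    proof -
      have "(1 - \<zeta> ^ k) * (a * inverse (1 - \<zeta>)) = 1"
        using zeta_ne_1 by (simp flip: a(2) mult.assoc)
      then show ?thesis by (rule inverse_unique)
    qed
    then show ?thesis using a(1) unit by (simp add: algebraic_int_times)
  qed
  then have "algebraic_int (\<Prod>k\<in>T. inverse (1 - \<zeta> ^ k))"
    by (rule algebraic_int_prod)
  also have "(\<Prod>k\<in>T. inverse (1 - \<zeta> ^ k)) = inverse (of_nat p)"
    by (subst prod_one_minus[symmetric]) (simp flip: prod_inversef add: o_def)
  finally have "inverse (of_nat p) \<in> (\<int> :: complex set)"
    by (intro rational_algebraic_int_is_int) auto
  then obtain k where "inverse (of_nat p) = (of_int k :: complex)" by (auto elim: Ints_cases)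
  then have "of_int (int p * k) = (of_int 1 :: complex)"
    using p_gt_2 by (simp add: field_simps)
  then have "int p * k = 1" by (simp only: of_int_eq_iff)
  then have "int p dvd 1" by (metis dvd_triv_left)
  then show False using p_gt_2 by simp
qed

lemma p_dvd_if_pi_dvd:
  assumes "algebraic_int a" "of_int b = (1 - \<zeta>) * a"
  shows "int p dvd b"
proof (rule ccontr)
  assume "\<not> int p dvd b"
  then have "coprime (int p) b" using prime_p by (intro prime_imp_coprime) auto
  then obtain u v where uv: "u * int p + v * b = 1"
    by (metis coprime_iff_gcd_eq_1 bezout_int)
  obtain c where c: "algebraic_int c" "of_nat p = (1 - \<zeta>) ^ N * c"
    using p_eq_pi_power by blast
  have "(1::complex) = of_int (u * int p + v * b)" by (simp only: uv of_int_1)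
  also have "\<dots> = of_int u * ((1 - \<zeta>) ^ N * c) + of_int v * ((1 - \<zeta>) * a)"
    using c(2) assms(2) by simp
  also have "\<dots> = (1 - \<zeta>) * (of_int u * ((1 - \<zeta>) ^ (N - 1) * c) + of_int v * a)"
    using N_eq(3) by (cases N) (auto simp: algebra_simps)
  finally have "inverse (1 - \<zeta>) = of_int u * ((1 - \<zeta>) ^ (N - 1) * c) + of_int v * a"
    by (metis inverse_unique)
  also have "algebraic_int \<dots>"
    using c(1) assms(1) algebraic_int_zeta
    by (intro algebraic_int_plus algebraic_int_times algebraic_int_power algebraic_int_diff) auto
  finally show False using pi_not_unit by blast
qed

lemma p_dvd_coeff_pi:
  assumes "degree B < N" "algebraic_int a" "evi B (1 - \<zeta>) = of_nat p * a"
  shows "int p dvd coeff B i"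
proof (induction i rule: less_induct)
  case (less i)
  show ?case
  proof (cases "i < N")
    case True
    let ?\<pi> = "1 - \<zeta>"
    define M where "M = pr (?\<pi> ^ Suc i) * AI"
    have int_pi: "algebraic_int ?\<pi>" using algebraic_int_zeta by (intro algebraic_int_diff) auto
    have M: "?\<pi> ^ j * c \<in> elts M" if "j > i" "algebraic_int c" for j c
    proof -
      have "?\<pi> ^ j * c = ?\<pi> ^ Suc i * (?\<pi> ^ (j - Suc i) * c)"
        using that(1) by (metis mult.assoc power_add le_add_diff_inverse Suc_leI)
      moreover have "algebraic_int (?\<pi> ^ (j - Suc i) * c)"
        using that(2) int_pi by (intro algebraic_int_times algebraic_int_power)
      ultimately show ?thesis
        unfolding M_def elts_pr_AI by blast
    qed
    obtain c where c: "algebraic_int c" "of_nat p = ?\<pi> ^ N * c"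
      using p_eq_pi_power by blast
    have pM: "of_nat p * d \<in> elts M" if "algebraic_int d" for d
      unfolding c(2) mult.assoc using True c(1) that by (intro M algebraic_int_times)
    have "(\<Sum>j<N. of_int (coeff B j) * ?\<pi> ^ j) \<in> elts M"
      using assms by (simp add: pM flip: evi_altdef)
    moreover have "(\<Sum>j\<in>{..<N}-{i}. of_int (coeff B j) * ?\<pi> ^ j) \<in> elts M"
    proof (rule elts_sum)
      fix j assume j: "j \<in> {..<N} - {i}"
      show "of_int (coeff B j) * ?\<pi> ^ j \<in> elts M"
      proof (cases "j < i")
        case True
        then obtain k where "coeff B j = int p * k" using less by (metis dvdE)
        then have "of_int (coeff B j) * ?\<pi> ^ j = of_nat p * (of_int k * ?\<pi> ^ j)" by simp
        moreover have "algebraic_int (of_int k * ?\<pi> ^ j)"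
          using int_pi by (intro algebraic_int_times algebraic_int_power) auto
        ultimately show ?thesis using pM by metis
      next
        case False
        then show ?thesis using j M[of j "of_int (coeff B j)"] by (auto simp: mult.commute)
      qed
    qed
    ultimately have "(\<Sum>j<N. of_int (coeff B j) * ?\<pi> ^ j)
        - (\<Sum>j\<in>{..<N}-{i}. of_int (coeff B j) * ?\<pi> ^ j) \<in> elts M"
      by (rule elts_diff)
    also have "(\<Sum>j<N. of_int (coeff B j) * ?\<pi> ^ j)
        - (\<Sum>j\<in>{..<N}-{i}. of_int (coeff B j) * ?\<pi> ^ j) = of_int (coeff B i) * ?\<pi> ^ i"
      using True by (subst sum.remove[of _ i]) auto
    finally obtain d where "algebraic_int d" "of_int (coeff B i) * ?\<pi> ^ i = ?\<pi> ^ Suc i * d"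
      by (auto simp: M_def elts_pr_AI)
    then show ?thesis
      using zeta_ne_1 by (intro p_dvd_if_pi_dvd[of d]) (auto simp: mult_ac)
  qed (use assms(1) in \<open>simp add: coeff_eq_0\<close>)
qed

lemma int_poly_zeta_dvd:
  assumes "degree B < N" "algebraic_int a" "evi B \<zeta> = of_nat p * a"
  obtains B' where "B = smult (int p) B'" "degree B' < N" "evi B' \<zeta> = a"
proof -
  let ?l = "[:1, -1:] :: int poly"
  have "\<forall>i. int p dvd coeff (B \<circ>\<^sub>p ?l) i"
    using assms by (intro allI p_dvd_coeff_pi[where a = a]) auto
  then have "[:int p:] dvd B \<circ>\<^sub>p ?l" by (simp add: const_poly_dvd_iff)
  then obtain C where "B \<circ>\<^sub>p ?l = smult (int p) C" by (auto elim: dvdE)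
  then have "(B \<circ>\<^sub>p ?l) \<circ>\<^sub>p ?l = smult (int p) (C \<circ>\<^sub>p ?l)" by (simp add: pcompose_smult)
  moreover have "(B \<circ>\<^sub>p ?l) \<circ>\<^sub>p ?l = B"
    by (simp add: pcompose_pCons flip: pcompose_assoc)
  ultimately have "B = smult (int p) (C \<circ>\<^sub>p ?l)" by simp
  moreover from this have "of_nat p * evi (C \<circ>\<^sub>p ?l) \<zeta> = of_nat p * a" 
    using assms(3) by (metis evi_simps(8) of_int_of_nat_eq)
  ultimately show thesis
    using that assms(1) p_gt_2 by (auto simp del: evi_simps(10))
qed

lemma int_poly_zeta_eq_0:
  assumes "degree B < N" "evi B \<zeta> = 0"
  shows "B = 0"
proof -
  have dvd: "int p ^ k dvd coeff B i" if "degree B < N" "evi B \<zeta> = 0" for k i B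
    using that
  proof (induction k arbitrary: B)
    case (Suc k)
    obtain B' where B': "B = smult (int p) B'" "degree B' < N" "evi B' \<zeta> = 0"
      using int_poly_zeta_dvd[of B 0] Suc.prems by auto
    from Suc.IH[OF this(2,3)] show ?case by (simp add: B'(1))
  qed simp
  have "coeff B i = 0" for i
  proof (rule ccontr)
    assume nz: "coeff B i \<noteq> 0"
    let ?k = "nat \<bar>coeff B i\<bar>"
    have "int p ^ ?k \<le> \<bar>coeff B i\<bar>"
      using dvd[OF assms] nz by (metis dvd_abs_iff zdvd_imp_le zero_less_abs_iff)
    moreover have "?k < p ^ ?k" using p_gt_2 by (intro power_gt_expt) auto
    then have "int ?k < int p ^ ?k" by (metis of_nat_less_iff of_nat_power)
    ultimately show False by simp
  qed
  then show ?thesis by (simp add: poly_eq_iff)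
qed

definition PhiQ :: "rat poly" where "PhiQ = map_poly of_int Phi"

lemma degree_PhiQ: "degree PhiQ = N" "PhiQ \<noteq> 0"
  using degree_Phi N_eq(3) by (auto simp: PhiQ_def degree_map_poly)

lemma ev_PhiQ: "coprime k p \<Longrightarrow> ev PhiQ (\<zeta> ^ k) = 0"
  using evi_Phi_root by (simp add: PhiQ_def)

lemma ev_PhiQ_zeta: "ev PhiQ \<zeta> = 0"
  using ev_PhiQ[of 1] by simp

lemma rat_poly_zeta_eq_0:
  assumes "degree f < N" "ev f \<zeta> = 0"
  shows "f = 0"
proof -
  obtain d B where d: "d > 0" "smult (of_int d) f = map_poly of_int B"
    by (rule rat_poly_common_denominator)
  have "degree (smult (of_int d) f) = degree B"
    unfolding d(2) by (rule degree_map_poly) simp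
  then have "degree B = degree f"
    using d(1) by simp
  moreover have "evi B \<zeta> = 0"
    using assms(2) by (simp flip: ev_simps(11) d(2))
  ultimately have "B = 0" using assms(1) int_poly_zeta_eq_0 by simp
  with d show ?thesis by auto
qed

lemma ev_mod_PhiQ: "ev (f mod PhiQ) \<zeta> = ev f \<zeta>" "degree (f mod PhiQ) < N"
proof -
  have "ev f \<zeta> = ev (PhiQ * (f div PhiQ) + f mod PhiQ) \<zeta>" by simp
  also have "\<dots> = ev (f mod PhiQ) \<zeta>" by (simp only: ev_simps ev_PhiQ_zeta mult_zero_left add_0)
  finally show "ev (f mod PhiQ) \<zeta> = ev f \<zeta>" by simp
  show "degree (f mod PhiQ) < N"
    using degree_mod_less'[of PhiQ f] degree_PhiQ N_eq(3) by (cases "f mod PhiQ = 0") auto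
qed

lemma PhiQ_dvd: "ev f \<zeta> = 0 \<Longrightarrow> PhiQ dvd f"
  using rat_poly_zeta_eq_0[of "f mod PhiQ"] ev_mod_PhiQ[of f] by (simp add: dvd_eq_mod_eq_0)

lemma ev_conjugate_eq:
  assumes "ev f \<zeta> = ev g \<zeta>" "coprime k p"
  shows "ev f (\<zeta> ^ k) = ev g (\<zeta> ^ k)"
proof -
  have "PhiQ dvd f - g" using assms(1) by (intro PhiQ_dvd) simp
  then obtain h where "f - g = PhiQ * h" by (elim dvdE)
  then have "ev (f - g) (\<zeta> ^ k) = 0" using ev_PhiQ[OF assms(2)] by simp
  then show ?thesis by simp
qed

lemma ex_inverse_ev:
  assumes "ev f \<zeta> \<noteq> 0"
  obtains g where "inverse (ev f \<zeta>) = ev g \<zeta>"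
proof -
  define g where "g = gcd f PhiQ"
  obtain h where h: "PhiQ = g * h" unfolding g_def by (metis dvdE gcd_dvd2)
  have gh0: "g \<noteq> 0" "h \<noteq> 0" using h degree_PhiQ(2) by auto
  then have deg: "degree g + degree h = N" using degree_PhiQ(1) h by (simp add: degree_mult_eq)
  have "ev g \<zeta> * ev h \<zeta> = 0" using ev_PhiQ_zeta h by simp
  moreover have "ev g \<zeta> \<noteq> 0"
  proof
    assume "ev g \<zeta> = 0"
    moreover obtain f' where "f = g * f'" unfolding g_def by (metis dvdE gcd_dvd1)
    ultimately show False using assms by simp
  qed
  ultimately have "ev h \<zeta> = 0" by simp
  then have "\<not> degree h < N" using rat_poly_zeta_eq_0[of h] gh0 by auto
  then have "degree g = 0" using deg by simp
  then obtain c where c: "g = [:c:]" by (metis degree_eq_zeroE)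
  obtain u v where uv: "u * f + v * PhiQ = g"
    unfolding g_def by (metis bezout_coefficients_fst_snd)
  then have "ev (u * f + v * PhiQ) \<zeta> = ev g \<zeta>" by simp
  then have "ev u \<zeta> * ev f \<zeta> = of_rat c" using ev_PhiQ_zeta c by simp
  moreover have "c \<noteq> 0" using c gh0 by auto
  ultimately have "inverse (ev f \<zeta>) = ev (smult (inverse c) u) \<zeta>"
    using assms by (simp add: of_rat_inverse of_rat_divide field_simps)
  then show thesis by (rule that)
qed

end

section \<open>Subfields of the complex numbers\<close>

lemma complex_ring_simps [simp]:
  "carrier complex_ring = UNIV" "monoid.mult complex_ring = (*)" "monoid.one complex_ring = 1"
  "ring.zero complex_ring = 0" "add complex_ring = (+)"
  by (simp_all add: ring_of_type_algebra_def)

lemma complex_ring_field: "field complex_ring"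
  by (rule field_from_type_algebra)

interpretation CR: cring complex_ring
  by (rule cring_from_type_algebra)

lemma complex_ring_inv [simp]:
  "a_inv complex_ring x = - x" "x \<noteq> 0 \<Longrightarrow> m_inv complex_ring x = inverse x"
proof -
  show "a_inv complex_ring x = - x"
    using CR.minus_equality[of "- x" x] by simp
  show "m_inv complex_ring x = inverse x" if "x \<noteq> 0"
    using CR.inv_char[of x "inverse x"] that by simp
qed

locale number_field =
  fixes K :: "complex set"
  assumes subfield: "subfield K complex_ring"
begin

lemma K_closed [simp, intro]:
  "0 \<in> K" "1 \<in> K" "x \<in> K \<Longrightarrow> - x \<in> K" "x \<in> K \<Longrightarrow> y \<in> K \<Longrightarrow> x + y \<in> K"
  "x \<in> K \<Longrightarrow> y \<in> K \<Longrightarrow> x * y \<in> K" "x \<in> K \<Longrightarrow> inverse x \<in> K"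
proof -
  note sub = subringE[OF subfieldE(1)[OF subfield]]
  show "0 \<in> K" "1 \<in> K" "x \<in> K \<Longrightarrow> - x \<in> K" "x \<in> K \<Longrightarrow> y \<in> K \<Longrightarrow> x + y \<in> K"
    "x \<in> K \<Longrightarrow> y \<in> K \<Longrightarrow> x * y \<in> K"
    using sub(2,3,5-7) by auto
  show "inverse x \<in> K" if "x \<in> K"
    using CR.subfield_m_inv(1)[OF subfield, of x] that sub(2) by (cases "x = 0") auto
qed

lemma K_diff [simp, intro]: "x \<in> K \<Longrightarrow> y \<in> K \<Longrightarrow> x - y \<in> K"
  using K_closed(4)[of x "- y"] by simp

lemma K_divide [simp, intro]: "x \<in> K \<Longrightarrow> y \<in> K \<Longrightarrow> x / y \<in> K"
  by (simp add: divide_inverse)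

lemma K_power [simp, intro]: "x \<in> K \<Longrightarrow> x ^ k \<in> K"
  by (induction k) auto

lemma K_of_nat [simp, intro]: "of_nat k \<in> K"
  by (induction k) auto

lemma K_of_int [simp, intro]: "of_int k \<in> K"
  by (cases k rule: int_cases2) auto

lemma K_of_rat [simp, intro]: "of_rat q \<in> K"
  by (cases q) (simp add: of_rat_rat)

lemma K_numeral [simp, intro]: "numeral k \<in> K"
  using K_of_nat[of "numeral k"] by simp

lemma K_sum [intro]: "(\<And>i. i \<in> A \<Longrightarrow> f i \<in> K) \<Longrightarrow> sum f A \<in> K"
  by (induction A rule: infinite_finite_induct) auto

lemma K_prod [intro]: "(\<And>i. i \<in> A \<Longrightarrow> f i \<in> K) \<Longrightarrow> prod f A \<in> K"
  by (induction A rule: infinite_finite_induct) auto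

lemma ev_in_K: "x \<in> K \<Longrightarrow> ev f x \<in> K"
  by (induction f) auto

end

section \<open>The Galois action on a prime power cyclotomic field\<close>


context prime_power_cyclotomic
begin

abbreviation L :: "complex set" where "L \<equiv> cyclotomic_field \<zeta>"

sublocale L: number_field "cyclotomic_field \<zeta>"
  unfolding cyclotomic_field_def
  by (rule number_field.intro) (simp add: field.generate_field_is_subfield[OF complex_ring_field])

lemma zeta_in_L [simp, intro]: "\<zeta> \<in> L"
  unfolding cyclotomic_field_def by (rule generate_field.incl) simp

lemma L_eq: "L = range (\<lambda>f. ev f \<zeta>)"
proof (intro equalityI subsetI)
  fix x assume "x \<in> L"
  then show "x \<in> range (\<lambda>f. ev f \<zeta>)"
    unfolding cyclotomic_field_def
  proof induction
    case one
    have "1 = ev 1 \<zeta>" by simp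
    then show ?case by (metis complex_ring_simps(3) rangeI)
  next
    case (incl h)
    then have "h = ev (monom 1 1) \<zeta>" by simp
    then show ?case by blast
  next
    case (m_inv h)
    then obtain f where "h = ev f \<zeta>" "ev f \<zeta> \<noteq> 0" by auto
    moreover from this(2) obtain g where "inverse (ev f \<zeta>) = ev g \<zeta>" by (rule ex_inverse_ev)
    ultimately show ?case by auto
  qed (auto intro: rangeI[of _ 1] simp flip: ev_simps)
qed (auto intro: L.ev_in_K)

lemma L_cases:
  assumes "x \<in> L"
  obtains f where "x = ev f \<zeta>"
  using assms unfolding L_eq by auto

definition gal :: "nat \<Rightarrow> complex \<Rightarrow> complex"
  where "gal k x = ev (SOME f. ev f \<zeta> = x) (\<zeta> ^ k)"

lemma gal_ev: "coprime k p \<Longrightarrow> gal k (ev f \<zeta>) = ev f (\<zeta> ^ k)"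
  unfolding gal_def by (rule ev_conjugate_eq) (metis (mono_tags) someI)

lemma gal_simps:
  assumes "coprime k p" "x \<in> L"
  shows "y \<in> L \<Longrightarrow> gal k (x + y) = gal k x + gal k y" "y \<in> L \<Longrightarrow> gal k (x - y) = gal k x - gal k y"
    "y \<in> L \<Longrightarrow> gal k (x * y) = gal k x * gal k y" "gal k (- x) = - gal k x"
proof -
  obtain f where f: "x = ev f \<zeta>" using assms(2) by (rule L_cases)
  show "gal k (- x) = - gal k x"
    using gal_ev[OF assms(1), of "- f"] by (simp add: f gal_ev[OF assms(1)])
  assume "y \<in> L"
  then obtain g where g: "y = ev g \<zeta>" by (rule L_cases)
  show "gal k (x + y) = gal k x + gal k y" "gal k (x - y) = gal k x - gal k y" "gal k (x * y) = gal k x * gal k y"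
    using gal_ev[OF assms(1), of "f + g"] gal_ev[OF assms(1), of "f - g"] gal_ev[OF assms(1), of "f * g"]
    by (simp_all add: f g gal_ev[OF assms(1)])
qed

lemma gal_of_rat: "coprime k p \<Longrightarrow> gal k (of_rat q) = of_rat q"
  using gal_ev[of k "[:q:]"] by simp

lemma gal_of_int: "coprime k p \<Longrightarrow> gal k (of_int c) = of_int c"
  using gal_of_rat[of k "of_int c"] by simp

lemma gal_0_1: "coprime k p \<Longrightarrow> gal k 0 = 0" "coprime k p \<Longrightarrow> gal k 1 = 1"
  using gal_of_int[of k 0] gal_of_int[of k 1] by auto

lemma gal_zeta: "coprime k p \<Longrightarrow> gal k (\<zeta> ^ i) = \<zeta> ^ (k * i)"
  using gal_ev[of k "monom 1 i"] by (simp add: power_mult)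

lemma gal_in_L [simp, intro]: "coprime k p \<Longrightarrow> x \<in> L \<Longrightarrow> gal k x \<in> L"
  by (erule L_cases) (auto simp: gal_ev intro!: L.ev_in_K)

lemma gal_gal:
  assumes "coprime k p" "coprime l p" "x \<in> L"
  shows "gal k (gal l x) = gal (k * l) x"
proof -
  obtain f where f: "x = ev f \<zeta>" using assms(3) by (rule L_cases)
  have "gal l x = ev (f \<circ>\<^sub>p monom 1 l) \<zeta>" by (simp add: f gal_ev assms)
  then have "gal k (gal l x) = ev (f \<circ>\<^sub>p monom 1 l) (\<zeta> ^ k)" using assms(1) by (simp only: gal_ev)
  moreover have "gal (k * l) x = ev f (\<zeta> ^ (k * l))" using assms by (simp add: f gal_ev)
  ultimately show ?thesis by (simp add: power_mult)
qed

lemma gal_cong: "k mod n = l mod n \<Longrightarrow> gal k x = gal l x"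
proof -
  assume "k mod n = l mod n"
  then have "\<zeta> ^ k = \<zeta> ^ l" by (simp only: zeta_pow_eq_iff)
  then show ?thesis by (simp only: gal_def)
qed

lemma gal_one: "x \<in> L \<Longrightarrow> gal 1 x = x"
  by (erule L_cases) (simp add: gal_ev del: One_nat_def)

lemma ev_cnj: "cnj (ev f x) = ev f (cnj x)"
proof (induction f)
  case (pCons a f)
  have "cnj (of_rat a) = of_rat a" by (cases a) (simp add: of_rat_rat)
  with pCons show ?case by simp
qed simp

lemma coprime_n_minus_1: "coprime (n - 1) p"
  using N_eq(5) coprime_diff_one_left_nat[of n] coprime_n[of "n - 1"] by simp

lemma gal_cnj: "x \<in> L \<Longrightarrow> gal (n - 1) x = cnj x"
  by (erule L_cases) (simp only: gal_ev coprime_n_minus_1 ev_cnj cnj_zeta)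

lemma cnj_in_L [simp, intro]: "x \<in> L \<Longrightarrow> cnj x \<in> L"
  using gal_in_L[OF coprime_n_minus_1] gal_cnj by metis

lemma obtain_inverse_mod:
  assumes "coprime k p"
  obtains l where "coprime l p" "k * l mod n = 1 mod n"
proof -
  have "coprime k n" using assms by (simp add: coprime_n)
  from cong_solve_coprime_nat[OF this] obtain l where l: "[k * l = 1] (mod n)" by auto
  then have "coprime (k * l) n" using cong_imp_coprime[OF cong_sym[OF l]] by simp
  then show thesis using l that[of l] by (simp add: coprime_n cong_def)
qed

lemma gal_inverse_gal:
  assumes "coprime k p" "coprime l p" "k * l mod n = 1 mod n" "x \<in> L"
  shows "gal k (gal l x) = x" "gal l (gal k x) = x"
  using assms gal_gal gal_one[OF assms(4)] gal_cong[OF assms(3), of x] by (simp_all add: mult.commute)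

lemma gal_eq_0_iff:
  assumes "coprime k p" "x \<in> L"
  shows "gal k x = 0 \<longleftrightarrow> x = 0"
proof -
  obtain l where "coprime l p" "k * l mod n = 1 mod n"
    using assms(1) by (rule obtain_inverse_mod)
  then show ?thesis using gal_inverse_gal(2)[OF assms(1), of l x] assms gal_0_1 by metis
qed

lemma gal_inverse: 
  assumes "coprime k p" "x \<in> L"
  shows "gal k (inverse x) = inverse (gal k x)"
proof (cases "x = 0")
  case False
  then have "gal k x * gal k (inverse x) = 1"
    using gal_simps(3)[OF assms, of "inverse x"] assms gal_0_1 by simp
  then show ?thesis by (metis inverse_unique)
qed (use assms gal_0_1 in auto)

lemma gal_sum:
  assumes "coprime k p" "\<And>i. i \<in> A \<Longrightarrow> f i \<in> L"
  shows "gal k (sum f A) = (\<Sum>i\<in>A. gal k (f i))"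
  using assms(2)
  by (induction A rule: infinite_finite_induct) (auto simp: gal_0_1 gal_simps assms(1) L.K_sum)

lemma gal_prod:
  assumes "coprime k p" "\<And>i. i \<in> A \<Longrightarrow> f i \<in> L"
  shows "gal k (prod f A) = (\<Prod>i\<in>A. gal k (f i))"
  using assms(2)
  by (induction A rule: infinite_finite_induct) (auto simp: gal_0_1 gal_simps assms(1) L.K_prod)

lemma gal_evi:
  assumes "coprime k p" "x \<in> L"
  shows "gal k (evi B x) = evi B (gal k x)"
proof -
  obtain f where f: "x = ev f \<zeta>" using assms(2) by (rule L_cases)
  have "evi B x = ev (map_poly of_int B \<circ>\<^sub>p f) \<zeta>" by (simp add: f)
  then show ?thesis by (simp add: gal_ev assms(1) f del: ev_simps(10)) (simp add: gal_ev assms(1))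
qed

lemma algebraic_int_gal:
  assumes "coprime k p" "x \<in> L" "algebraic_int x"
  shows "algebraic_int (gal k x)"
proof -
  obtain B where B: "evi B x = 0" "lead_coeff B = 1"
    using assms(3) unfolding algebraic_int_altdef_ipoly evi_def by blast
  then have "evi B (gal k x) = 0" using gal_evi[OF assms(1,2), of B] gal_0_1 assms(1) by simp
  then show ?thesis using B(2) unfolding algebraic_int_altdef_ipoly evi_def by blast
qed

definition Tr :: "complex \<Rightarrow> complex" where "Tr x = (\<Sum>k\<in>T. gal k x)"

lemma T_coprime: "k \<in> T \<Longrightarrow> coprime k p"
  by (simp add: T_def)

lemma Tr_zeta: "Tr (\<zeta> ^ i) = (if n dvd i then of_nat n else 0) - (if m dvd i then of_nat m else 0)"
  unfolding sum_zeta_T[symmetric] Tr_def by (intro sum.cong) (auto simp: gal_zeta T_coprime mult.commute)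

lemma Tr_diff: "x \<in> L \<Longrightarrow> y \<in> L \<Longrightarrow> Tr (x - y) = Tr x - Tr y"
  unfolding Tr_def by (simp add: gal_simps T_coprime sum_subtractf cong: sum.cong)

lemma Tr_sum: "(\<And>i. i \<in> A \<Longrightarrow> f i \<in> L) \<Longrightarrow> Tr (sum f A) = (\<Sum>i\<in>A. Tr (f i))"
  unfolding Tr_def by (subst sum.swap) (auto simp: gal_sum T_coprime intro!: sum.cong)

lemma Tr_of_rat_mult: "x \<in> L \<Longrightarrow> Tr (of_rat q * x) = of_rat q * Tr x"
  unfolding Tr_def by (simp add: gal_simps gal_of_rat T_coprime sum_distrib_left cong: sum.cong)

lemma Tr_zeta_dual:
  assumes "i < N" "j < N"
  shows "Tr (\<zeta> ^ i * (\<zeta> ^ (n - j) - \<zeta> ^ (n - (N + j mod m)))) = (if i = j then of_nat n else 0)"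
proof -
  have mn: "m dvd n" "m dvd N" by (simp_all add: n_eq N_eq)
  have j': "N + j mod m < n" using N_eq(2) m_pos by (metis add_less_cancel_left mod_less_divisor)
  have 1: "n dvd i + (n - j) \<longleftrightarrow> i = j"
  proof
    assume "n dvd i + (n - j)"
    moreover have "0 < i + (n - j)" "i + (n - j) < 2 * n" using assms N_eq(4) by auto
    ultimately have "i + (n - j) = n"
    proof -
      assume "n dvd i + (n - j)" "0 < i + (n - j)" "i + (n - j) < 2 * n"
      then obtain c where c: "i + (n - j) = n * c" by (elim dvdE)
      have "c > 0" using c \<open>0 < i + (n - j)\<close> by (cases c) auto
      moreover have "n * c < n * 2" using c \<open>i + (n - j) < 2 * n\<close> by simp
      then have "c < 2" by (simp only: mult_less_cancel1)
      ultimately have "c = 1" by simp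
      with c show ?thesis by simp
    qed
    then show "i = j" using assms N_eq(4) by auto
  qed (use assms N_eq(4) in auto)
  have 2: "\<not> n dvd i + (n - (N + j mod m))"
    using assms(1) j' by (intro nat_dvd_not_less) auto
  have 3: "m dvd i + (n - j) \<longleftrightarrow> m dvd i + (n - (N + j mod m))"
  proof -
    have "j \<le> n" using assms N_eq(4) by simp
    then have "int i + (int n - int j) = int (i + (n - j))" by simp
    moreover have "int (i + (n - (N + j mod m))) = int i + int n - int N - int j mod int m"
      using j' by (simp add: zmod_int)
    moreover have "int m dvd (int i + (int n - int j)) - (int i + int n - int N - int j mod int m)"
      using mn(2) by (simp add: minus_mod_eq_mult_div dvd_diff dvd_add)
        (metis add_uminus_conv_diff dvd_add_left_iff dvd_minus_iff dvd_minus_mod int_dvd_int_iff minus_diff_eq)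
    ultimately have "int m dvd int (i + (n - j)) \<longleftrightarrow> int m dvd int (i + (n - (N + j mod m)))"
      by (metis (no_types, lifting) dvd_add_right_iff diff_add_cancel)
    then show ?thesis by (simp only: int_dvd_int_iff)
  qed
  have "Tr (\<zeta> ^ i * (\<zeta> ^ (n - j) - \<zeta> ^ (n - (N + j mod m))))
      = Tr (\<zeta> ^ (i + (n - j)) - \<zeta> ^ (i + (n - (N + j mod m))))"
    by (simp add: algebra_simps power_add)
  also have "\<dots> = (if i = j then of_nat n else 0)"
    by (subst Tr_diff) (auto simp: Tr_zeta 1 2 3)
  finally show ?thesis .
qed

lemma coeff_via_Tr:
  assumes "degree f < N" "j < N"
  shows "of_nat n * of_rat (coeff f j) = Tr (ev f \<zeta> * (\<zeta> ^ (n - j) - \<zeta> ^ (n - (N + j mod m))))"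
proof -
  let ?d = "\<zeta> ^ (n - j) - \<zeta> ^ (n - (N + j mod m))"
  have "Tr (ev f \<zeta> * ?d) = Tr (\<Sum>i<N. of_rat (coeff f i) * (\<zeta> ^ i * ?d))"
    by (simp add: ev_altdef[OF assms(1)] sum_distrib_right mult.assoc)
  also have "\<dots> = (\<Sum>i<N. of_rat (coeff f i) * Tr (\<zeta> ^ i * ?d))"
    by (subst Tr_sum) (auto simp: Tr_of_rat_mult)
  also have "\<dots> = (\<Sum>i<N. if i = j then of_rat (coeff f j) * of_nat n else 0)"
    using assms(2) by (intro sum.cong) (auto simp: Tr_zeta_dual)
  also have "\<dots> = of_nat n * of_rat (coeff f j)" using assms(2) by simp
  finally show ?thesis by simp
qed

lemma Tr_rat: "x \<in> L \<Longrightarrow> Tr x \<in> \<rat>"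
proof -
  assume "x \<in> L"
  then obtain f where f: "x = ev f \<zeta>" "degree f < N"
    using ev_mod_PhiQ by (metis L_cases)
  have "Tr x = (\<Sum>i<N. of_rat (coeff f i) * Tr (\<zeta> ^ i))"
    unfolding f(1) ev_altdef[OF f(2)] by (subst Tr_sum) (auto simp: Tr_of_rat_mult)
  also have "\<dots> \<in> \<rat>"
    by (rule Rats_sum) (auto simp: Tr_zeta)
  finally show ?thesis .
qed

lemma Tr_int: "x \<in> L \<Longrightarrow> algebraic_int x \<Longrightarrow> Tr x \<in> \<int>"
  by (intro rational_algebraic_int_is_int Tr_rat)
     (auto simp: Tr_def intro!: algebraic_int_sum algebraic_int_gal T_coprime)

lemma fixed_imp_rat:
  assumes "x \<in> L" "\<And>k. k \<in> T \<Longrightarrow> gal k x = x"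
  shows "x \<in> \<rat>"
proof -
  have "Tr x = of_nat N * x" unfolding Tr_def using assms(2) by (simp add: card_T)
  then have "x = Tr x / of_nat N" using N_eq(3) by simp
  then show ?thesis using Tr_rat[OF assms(1)] by (metis Rats_divide Rats_of_nat)
qed

lemma integers_of_L:
  assumes "x \<in> L" "algebraic_int x"
  obtains B where "degree B < N" "x = evi B \<zeta>"
proof -
  obtain f where f: "x = ev f \<zeta>" "degree f < N"
    using ev_mod_PhiQ assms(1) by (metis L_cases)
  have "\<exists>c. of_nat n * of_rat (coeff f j) = (of_int c :: complex)" for j
  proof (cases "j < N")
    case True
    let ?d = "\<zeta> ^ (n - j) - \<zeta> ^ (n - (N + j mod m))"
    have "algebraic_int (x * ?d)" using assms(2) algebraic_int_zeta
      by (intro algebraic_int_times algebraic_int_diff algebraic_int_power)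
    moreover have "x * ?d \<in> L" using assms(1) by auto
    ultimately have "of_nat n * of_rat (coeff f j) \<in> (\<int> :: complex set)"
      using coeff_via_Tr[OF f(2) True] Tr_int f(1) by simp
    then show ?thesis by (auto elim: Ints_cases)
  next
    case False
    then show ?thesis using f(2) by (intro exI[of _ 0]) (simp add: coeff_eq_0)
  qed
  then obtain c where c: "\<And>j. of_nat n * of_rat (coeff f j) = (of_int (c j) :: complex)" by metis
  define C where "C = (\<Sum>j<N. monom (c j) j)"
  have "evi C \<zeta> = of_nat n * x"
    by (simp add: C_def f(1) ev_altdef[OF f(2)] sum_distrib_left mult.assoc flip: c)
  moreover have "degree C < N"
    unfolding C_def using N_eq(3) by (intro degree_sum_less) (auto simp: degree_monom_eq intro: le_less_trans[OF degree_monom_le])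
  moreover have "\<exists>B. degree B < N \<and> evi B \<zeta> = x" if "degree C < N" "evi C \<zeta> = of_nat (p ^ k) * x" for k C
    using that
  proof (induction k arbitrary: C)
    case (Suc k)
    have "algebraic_int (of_nat (p ^ k) * x)"
      using assms(2) by (simp add: algebraic_int_times algebraic_int_power)
    moreover have "evi C \<zeta> = of_nat p * (of_nat (p ^ k) * x)" using Suc.prems(2) by simp
    ultimately obtain B' where "degree B' < N" "evi B' \<zeta> = of_nat (p ^ k) * x"
      using int_poly_zeta_dvd[OF Suc.prems(1)] by blast
    then show ?case by (rule Suc.IH)
  qed auto
  ultimately show thesis using that unfolding n_def by metis
qed

lemma dvd_if_Tr_dvd:
  assumes "x \<in> L" "algebraic_int x" "Factorial_Ring.prime q" "q \<noteq> p"
    and "\<And>z. z \<in> L \<Longrightarrow> algebraic_int z \<Longrightarrow> \<exists>c. Tr (x * z) = of_int (int q * c)"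
  obtains y where "y \<in> L" "algebraic_int y" "x = of_nat q * y"
proof -
  obtain B where B: "degree B < N" "x = evi B \<zeta>" using integers_of_L assms(1,2) by blast
  have "int q dvd coeff B j" for j
  proof (cases "j < N")
    case True
    let ?d = "\<zeta> ^ (n - j) - \<zeta> ^ (n - (N + j mod m))"
    have "algebraic_int ?d" using algebraic_int_zeta
      by (intro algebraic_int_diff algebraic_int_power)
    then obtain c where "Tr (x * ?d) = of_int (int q * c)" using assms(5)[of ?d] by auto
    moreover have "of_nat n * of_int (coeff B j) = Tr (x * ?d)"
      using coeff_via_Tr[of "map_poly of_int B" j] B True by (simp add: degree_map_poly)
    ultimately have "of_int (int n * coeff B j) = (of_int (int q * c) :: complex)" by simp
    then have "int n * coeff B j = int q * c" by (simp only: of_int_eq_iff)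
    then have "int q dvd int n * coeff B j" by simp
    moreover have "coprime (int q) (int n)"
      using assms(3,4) prime_p by (simp add: n_def primes_coprime)
    ultimately show ?thesis by (simp add: coprime_dvd_mult_right_iff)
  qed (use B in \<open>simp add: coeff_eq_0\<close>)
  then have "[:int q:] dvd B" by (simp add: const_poly_dvd_iff)
  then obtain C where "B = smult (int q) C" by (auto elim: dvdE)
  then have "x = of_nat q * evi C \<zeta>" by (simp add: B(2))
  moreover have "evi C \<zeta> \<in> L"
    using L.ev_in_K[of \<zeta> "map_poly of_int C"] by simp
  ultimately show thesis using that algebraic_int_evi[OF algebraic_int_zeta] by blast
qed

end

lemma freshman_dream:
  assumes "Factorial_Ring.prime (q::nat)" "algebraic_int u" "algebraic_int v"
  shows "(u + v) ^ q - (u ^ q + v ^ q) \<in> elts (pr (of_nat q) * AI)"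
proof -
  have q: "q > 1" using assms(1) by (rule prime_gt_1_nat)
  have "{..q} = insert 0 (insert q {0<..<q})" using q by auto
  then have "(u + v) ^ q = (\<Sum>k\<in>insert 0 (insert q {0<..<q}). of_nat (q choose k) * u ^ k * v ^ (q - k))"
    by (simp only: binomial_ring)
  also have "\<dots> = v ^ q + (u ^ q + (\<Sum>k\<in>{0<..<q}. of_nat (q choose k) * u ^ k * v ^ (q - k)))"
    using q by (subst sum.insert, simp, simp, subst sum.insert) auto
  finally have "(u + v) ^ q - (u ^ q + v ^ q) = (\<Sum>k\<in>{0<..<q}. of_nat (q choose k) * u ^ k * v ^ (q - k))"
    by simp
  also have "\<dots> \<in> elts (pr (of_nat q) * AI)"
  proof (rule elts_sum)
    fix k assume k: "k \<in> {0<..<q}"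
    then have "q dvd q choose k" using assms(1) by (intro dvd_choose_prime) auto
    then obtain c where "q choose k = q * c" by (elim dvdE)
    then have "of_nat (q choose k) * u ^ k * v ^ (q - k) = of_nat q * (of_nat c * (u ^ k * v ^ (q - k)))"
      by simp
    then show "of_nat (q choose k) * u ^ k * v ^ (q - k) \<in> elts (pr (of_nat q) * AI)"
      unfolding elts_pr_AI using assms(2,3)
      by (intro exI[of _ "of_nat c * (u ^ k * v ^ (q - k))"] conjI algebraic_int_times algebraic_int_power) auto
  qed
  finally show ?thesis .
qed

lemma fermat_AI:
  assumes "Factorial_Ring.prime (q::nat)"
  shows "of_int c ^ q - of_int c \<in> elts (pr (of_nat q) * AI)"
proof (induction c rule: int_induct[of _ 0])
  case base
  show ?case using prime_gt_0_nat[OF assms] by (simp add: power_0_left)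
next
  case (step1 i)
  have "(of_int i + 1) ^ q - (of_int i ^ q + 1 ^ q) \<in> elts (pr (of_nat q) * AI)"
    by (intro freshman_dream assms) auto
  from elts_add[OF this step1(2)] show ?case by (simp add: algebra_simps)
next
  case (step2 i)
  have "(of_int (i - 1) + 1) ^ q - (of_int (i - 1) ^ q + 1 ^ q) \<in> elts (pr (of_nat q) * AI)"
    by (intro freshman_dream assms algebraic_int_of_int algebraic_int_1)
  from elts_diff[OF step2(2) this] show ?case by (simp add: algebra_simps)
qed

lemma evi_frobenius:
  assumes "Factorial_Ring.prime (q::nat)" "algebraic_int x"
  shows "evi B x ^ q - evi B (x ^ q) \<in> elts (pr (of_nat q) * AI)"
proof (induction B)
  case 0
  show ?case using prime_gt_0_nat[OF assms(1)] by (simp add: power_0_left)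
next
  case (pCons c B)
  let ?M = "pr (of_nat q) * AI"
  have "(of_int c + x * evi B x) ^ q - (of_int c ^ q + (x * evi B x) ^ q) \<in> elts ?M"
    using assms by (intro freshman_dream algebraic_int_times algebraic_int_evi) auto
  moreover have "of_int c ^ q - of_int c \<in> elts ?M" by (rule fermat_AI[OF assms(1)])
  moreover have "x ^ q * (evi B x ^ q - evi B (x ^ q)) \<in> elts ?M"
    using pCons.IH assms(2) unfolding elts_pr_AI
    by (metis algebraic_int_power algebraic_int_times mult.left_commute)
  ultimately have "((of_int c + x * evi B x) ^ q - (of_int c ^ q + (x * evi B x) ^ q))
    + (of_int c ^ q - of_int c) + x ^ q * (evi B x ^ q - evi B (x ^ q)) \<in> elts ?M" by blast
  then show ?case by (simp add: algebra_simps power_mult_distrib)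
qed

section \<open>Fractional ideals and ideal classes\<close>

lemma additive_subgroup_complex_iff: "additive_subgroup I complex_ring \<longleftrightarrow> zm.subspace I"
proof
  assume "additive_subgroup I complex_ring"
  then interpret additive_subgroup I complex_ring .
  show "zm.subspace I"
    unfolding zm_subspace_iff
  proof (intro conjI ballI)
    show "0 \<in> I" using zero_closed by simp
    show "x + y \<in> I" if "x \<in> I" "y \<in> I" for x y using a_closed[OF that] by simp
    show "- x \<in> I" if "x \<in> I" for x
      using subgroup.m_inv_closed[OF a_subgroup that] by (metis a_inv_def complex_ring_inv(1))
  qed
next
  assume I: "zm.subspace I"
  have "subgroup I (add_monoid complex_ring)"
    using I by (intro CR.add.subgroupI) (auto simp: zm_subspace_iff simp flip: a_inv_def)
  then show "additive_subgroup I complex_ring" by (rule additive_subgroup.intro)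
qed

locale algebraic_number_field = number_field +
  assumes common_denominator: "a \<in> K \<Longrightarrow> \<exists>d::int. d > 0 \<and> algebraic_int (of_int d * a)"
begin

definition OK :: zmod where "OK = Zmod (integers_of K)"

lemma elts_OK: "elts OK = integers_of K"
  unfolding OK_def
  by (rule elts_Zmod) (auto simp: zm_subspace_iff integers_of_def algebraic_int_plus)

lemma mem_OK: "x \<in> elts OK \<longleftrightarrow> x \<in> K \<and> algebraic_int x"
  by (simp add: elts_OK integers_of_def)

lemma one_le_OK: "1 \<le> OK"
  by (rule zmod_leI) (auto simp: elts_one mem_OK elim!: Ints_cases)

lemma le_OK_mult: "I \<le> OK * I"
  using zmod_mult_mono[OF one_le_OK, of I I] by simp

lemma OK_mult_eqI: "OK * I \<le> I \<Longrightarrow> OK * I = I"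
  by (rule antisym) (use le_OK_mult in auto)

lemma OK_OK: "OK * OK = OK"
  by (rule OK_mult_eqI) (auto simp: zmod_mult_le_iff mem_OK algebraic_int_times)

definition frac_ideal :: "zmod \<Rightarrow> bool"
  where "frac_ideal I \<longleftrightarrow> I \<noteq> 0 \<and> OK * I = I \<and> elts I \<subseteq> K \<and> (\<exists>d\<in>elts OK. d \<noteq> 0 \<and> pr d * I \<le> OK)"

lemma frac_idealD: 
  "frac_ideal I \<Longrightarrow> OK * I = I" "frac_ideal I \<Longrightarrow> I * OK = I" "frac_ideal I \<Longrightarrow> elts I \<subseteq> K"
  "frac_ideal I \<Longrightarrow> I \<noteq> 0" "frac_ideal I \<Longrightarrow> x \<in> elts I \<Longrightarrow> x \<in> K"
  by (auto simp: frac_ideal_def mult.commute)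

lemma fractional_ideal_iff: "fractional_ideal K I \<longleftrightarrow> (\<exists>J. I = elts J \<and> frac_ideal J)"
proof
  assume I: "fractional_ideal K I"
  then have sub: "zm.subspace I"
    by (simp add: fractional_ideal_def additive_subgroup_complex_iff)
  define J where "J = Zmod I"
  have J: "elts J = I" using sub by (simp add: J_def elts_Zmod)
  have "J \<noteq> 0" using I by (auto simp: fractional_ideal_def simp flip: J)
  moreover have "OK * J = J"
    using I by (intro OK_mult_eqI) (auto simp: zmod_mult_le_iff fractional_ideal_def J elts_OK)
  moreover obtain d where "d \<in> elts OK" "d \<noteq> 0" "\<forall>x\<in>I. d * x \<in> elts OK"
    using I by (auto simp: fractional_ideal_def elts_OK)
  then have "\<exists>d\<in>elts OK. d \<noteq> 0 \<and> pr d * J \<le> OK"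
    by (intro bexI[of _ d] conjI zmod_leI) (auto simp: elts_pr_mult J)
  ultimately have "frac_ideal J"
    using I by (simp add: frac_ideal_def J fractional_ideal_def)
  with J show "\<exists>J. I = elts J \<and> frac_ideal J" by blast
next
  assume "\<exists>J. I = elts J \<and> frac_ideal J"
  then obtain J where J: "I = elts J" "frac_ideal J" by blast
  then have "elts J \<noteq> {0}" unfolding frac_ideal_def by (metis elts_inverse elts_zero)
  moreover have "a * x \<in> elts J" if "a \<in> elts OK" "x \<in> elts J" for a x
    using J(2) elts_mult[OF that] by (simp add: frac_ideal_def)
  moreover obtain d where d: "d \<in> elts OK" "d \<noteq> 0" "pr d * J \<le> OK"
    using J(2) by (auto simp: frac_ideal_def)
  have "d * x \<in> elts OK" if "x \<in> elts J" for x
    using zmod_leD[OF d(3)] that by (auto simp: elts_pr_mult)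
  ultimately show "fractional_ideal K I"
    using J(1) d(1,2) frac_idealD(3)[OF J(2)] \<open>elts J \<noteq> {0}\<close>
    unfolding fractional_ideal_def elts_OK[symmetric]
    by (intro conjI ballI bexI[of _ d]) (auto simp: additive_subgroup_complex_iff)
qed

lemma carrier_fractional_ideals: "carrier (fractional_ideals K) = elts ` {J. frac_ideal J}"
  by (auto simp: fractional_ideals_def fractional_ideal_iff)

lemma mult_fractional_ideals: "elts I \<otimes>\<^bsub>fractional_ideals K\<^esub> elts J = elts (I * J)"
  by (simp add: fractional_ideals_def ideal_prod_eq_elts)

lemma frac_ideal_nonzero_elt:
  assumes "frac_ideal I"
  obtains x where "x \<in> elts I" "x \<noteq> 0"
proof -
  have "elts I \<noteq> {0}" using frac_idealD(4)[OF assms] by (metis elts_inverse elts_zero)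
  then show thesis using that elts_0 by blast
qed

lemma zmod_mult_subset_K: "elts I \<subseteq> K \<Longrightarrow> elts J \<subseteq> K \<Longrightarrow> elts (I * J) \<subseteq> K"
proof
  fix x assume "elts I \<subseteq> K" "elts J \<subseteq> K" "x \<in> elts (I * J)"
  from this(3,1,2) show "x \<in> K"
    by (induction rule: zmod_mult_induct) auto
qed

lemma zmod_mult_ne_0: "I \<noteq> 0 \<Longrightarrow> J \<noteq> 0 \<Longrightarrow> I * J \<noteq> (0 :: zmod)"
proof
  assume IJ: "I \<noteq> 0" "J \<noteq> 0" "I * J = 0"
  then have "elts I \<noteq> {0}" "elts J \<noteq> {0}" by (metis elts_inverse elts_zero)+
  then obtain x y where "x \<in> elts I" "x \<noteq> 0" "y \<in> elts J" "y \<noteq> 0" using elts_0 by blast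
  then show False using elts_mult[of x I y J] IJ(3) by simp
qed

lemma frac_ideal_OK: "frac_ideal OK"
proof -
  have "OK \<noteq> 0" using mem_OK[of 1] by (metis K_closed(2) algebraic_int_1 elts_zero singletonD zero_neq_one)
  moreover have "pr 1 * OK \<le> OK" by (simp add: pr_1)
  ultimately show ?thesis
    unfolding frac_ideal_def by (auto simp: OK_OK mem_OK intro!: bexI[of _ 1])
qed

lemma frac_ideal_mult:
  assumes "frac_ideal I" "frac_ideal J"
  shows "frac_ideal (I * J)"
proof -
  obtain d where d: "d \<in> elts OK" "d \<noteq> 0" "pr d * I \<le> OK"
    using assms by (auto simp: frac_ideal_def)
  obtain e where e: "e \<in> elts OK" "e \<noteq> 0" "pr e * J \<le> OK"
    using assms by (auto simp: frac_ideal_def)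
  have "pr (d * e) * (I * J) = (pr d * I) * (pr e * J)" by (simp add: pr_mult mult_ac)
  also have "\<dots> \<le> OK * OK" by (intro zmod_mult_mono d e)
  finally have "pr (d * e) * (I * J) \<le> OK" by (simp add: OK_OK)
  moreover have "d * e \<in> elts OK" using elts_mult[OF d(1) e(1)] by (simp add: OK_OK)
  moreover have "OK * (I * J) = I * J" using frac_idealD(1)[OF assms(1)] by (simp flip: mult.assoc)
  ultimately show ?thesis
    unfolding frac_ideal_def using assms d(2) e(2)
    by (auto simp: zmod_mult_ne_0 frac_idealD dest: zmod_mult_subset_K[OF frac_idealD(3,3), THEN subsetD]
        intro!: bexI[of _ "d * e"])
qed

definition ideal_cls :: "zmod \<Rightarrow> complex set set" where "ideal_cls I = ideal_class K (elts I)"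

lemma ideal_cls_altdef: "frac_ideal I \<Longrightarrow> ideal_cls I = {elts (pr a * I) | a. a \<in> K - {0}}"
proof -
  assume I: "frac_ideal I"
  have "ideal_prod complex_ring ((*) a ` integers_of K) (elts I) = elts (pr a * I)" for a
    using frac_idealD(1)[OF I] by (simp add: ideal_prod_eq_elts mult.assoc flip: elts_OK elts_pr_mult)
  then show ?thesis
    by (auto simp: ideal_cls_def ideal_class_def r_coset_def principal_fractional_ideals_def
        fractional_ideals_def)
qed

lemma carrier_class_group: "carrier (class_group K) = ideal_cls ` {I. frac_ideal I}"
  by (auto simp: class_group_def FactGroup_def RCOSETS_def carrier_fractional_ideals
      ideal_cls_def ideal_class_def)

lemma ideal_cls_eq_iff:
  assumes "frac_ideal I" "frac_ideal J"
  shows "ideal_cls I = ideal_cls J \<longleftrightarrow> (\<exists>a\<in>K - {0}. I = pr a * J)"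
proof
  assume "ideal_cls I = ideal_cls J"
  moreover have "elts I \<in> ideal_cls I"
    using assms by (auto simp: ideal_cls_altdef pr_1 intro!: exI[of _ 1])
  ultimately show "\<exists>a\<in>K - {0}. I = pr a * J"
    using assms by (auto simp: ideal_cls_altdef elts_inject)
next
  assume "\<exists>a\<in>K - {0}. I = pr a * J"
  then obtain a where a: "a \<in> K" "a \<noteq> 0" "I = pr a * J" by blast
  have "{pr b * I | b. b \<in> K - {0}} = {pr b * J | b. b \<in> K - {0}}"
  proof (intro equalityI subsetI)
    fix Y assume "Y \<in> {pr b * I | b. b \<in> K - {0}}"
    then obtain b where "b \<in> K" "b \<noteq> 0" "Y = pr b * I" by auto
    then have "Y = pr (b * a) * J" "b * a \<in> K - {0}" using a by (auto simp: pr_mult mult.assoc)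
    then show "Y \<in> {pr b * J | b. b \<in> K - {0}}" by blast
  next
    fix Y assume "Y \<in> {pr b * J | b. b \<in> K - {0}}"
    then obtain b where b: "b \<in> K" "b \<noteq> 0" "Y = pr b * J" by auto
    have "pr (b * inverse a) * I = pr b * (pr (inverse a) * (pr a * J))"
      by (simp add: a(3) pr_mult mult.assoc)
    then have "Y = pr (b * inverse a) * I" using a(2) b(3) by (simp add: pr_inverse_mult)
    moreover have "b * inverse a \<in> K - {0}" using a b by auto
    ultimately show "Y \<in> {pr b * I | b. b \<in> K - {0}}" by blast
  qed
  then have "elts ` {pr b * I | b. b \<in> K - {0}} = elts ` {pr b * J | b. b \<in> K - {0}}" by simp
  moreover have "elts ` {pr b * I | b. b \<in> K - {0}} = {elts (pr b * I) | b. b \<in> K - {0}}" for I by auto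
  ultimately show "ideal_cls I = ideal_cls J" using assms by (simp add: ideal_cls_altdef)
qed

lemma mult_class_group:
  assumes "frac_ideal I" "frac_ideal J"
  shows "ideal_cls I \<otimes>\<^bsub>class_group K\<^esub> ideal_cls J = ideal_cls (I * J)"
proof -
  have *: "elts (pr a * I) \<otimes>\<^bsub>fractional_ideals K\<^esub> elts (pr b * J) = elts (pr (a * b) * (I * J))" for a b
    by (simp add: mult_fractional_ideals pr_mult mult_ac)
  have "ideal_cls I \<otimes>\<^bsub>class_group K\<^esub> ideal_cls J
      = {elts (pr (a * b) * (I * J)) | a b. a \<in> K - {0} \<and> b \<in> K - {0}}"
  proof (intro equalityI subsetI)
    fix Y assume "Y \<in> ideal_cls I \<otimes>\<^bsub>class_group K\<^esub> ideal_cls J"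
    then obtain a b where "a \<in> K - {0}" "b \<in> K - {0}"
      "Y = elts (pr a * I) \<otimes>\<^bsub>fractional_ideals K\<^esub> elts (pr b * J)"
      using assms unfolding class_group_def FactGroup_def set_mult_def
      by (auto simp: ideal_cls_altdef)
    then show "Y \<in> {elts (pr (a * b) * (I * J)) | a b. a \<in> K - {0} \<and> b \<in> K - {0}}"
      unfolding * by blast
  next
    fix Y assume "Y \<in> {elts (pr (a * b) * (I * J)) | a b. a \<in> K - {0} \<and> b \<in> K - {0}}"
    then obtain a b where ab: "a \<in> K - {0}" "b \<in> K - {0}" "Y = elts (pr (a * b) * (I * J))" by blast
    then have "elts (pr a * I) \<in> ideal_cls I" "elts (pr b * J) \<in> ideal_cls J"
      using assms by (auto simp: ideal_cls_altdef)
    then show "Y \<in> ideal_cls I \<otimes>\<^bsub>class_group K\<^esub> ideal_cls J"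
      unfolding class_group_def FactGroup_def set_mult_def ab(3) using *[of a b] by force
  qed
  also have "\<dots> = {elts (pr a * (I * J)) | a. a \<in> K - {0}}"
  proof (intro equalityI subsetI)
    fix Y assume "Y \<in> {elts (pr a * (I * J)) | a. a \<in> K - {0}}"
    then obtain a where "Y = elts (pr (a * 1) * (I * J))" "a \<in> K - {0}" by auto
    moreover have "1 \<in> K - {0}" by simp
    ultimately show "Y \<in> {elts (pr (a * b) * (I * J)) | a b. a \<in> K - {0} \<and> b \<in> K - {0}}" by blast
  next
    fix Y assume "Y \<in> {elts (pr (a * b) * (I * J)) | a b. a \<in> K - {0} \<and> b \<in> K - {0}}"
    then obtain a b where "Y = elts (pr (a * b) * (I * J))" "a \<in> K - {0}" "b \<in> K - {0}" by blast
    moreover from this have "a * b \<in> K - {0}" by auto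
    ultimately show "Y \<in> {elts (pr a * (I * J)) | a. a \<in> K - {0}}" by blast
  qed
  also have "\<dots> = ideal_cls (I * J)"
    using frac_ideal_mult[OF assms] by (simp add: ideal_cls_altdef)
  finally show ?thesis .
qed

lemma one_class_group: "\<one>\<^bsub>class_group K\<^esub> = ideal_cls OK"
proof -
  have "\<one>\<^bsub>class_group K\<^esub> = {elts (pr a * OK) | a. a \<in> K - {0}}"
    by (simp add: class_group_def FactGroup_def principal_fractional_ideals_def elts_pr_mult elts_OK)
  then show ?thesis by (simp add: ideal_cls_altdef frac_ideal_OK)
qed

lemma frac_ideal_pr_mult:
  assumes "a \<in> K" "a \<noteq> 0" "frac_ideal I"
  shows "frac_ideal (pr a * I)"
proof -
  obtain e where e: "e > 0" "algebraic_int (of_int e * a)"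
    using common_denominator[OF assms(1)] by blast
  obtain d where d: "d \<in> elts OK" "d \<noteq> 0" "pr d * I \<le> OK"
    using assms(3) by (auto simp: frac_ideal_def)
  have "pr (d * of_int e) * (pr a * I) = pr (of_int e * a) * (pr d * I)" by (simp add: pr_mult mult_ac)
  also have "\<dots> \<le> OK * OK" using e(2) assms(1) by (intro zmod_mult_mono d(3)) (simp add: pr_le_iff mem_OK)
  finally have "pr (d * of_int e) * (pr a * I) \<le> OK" by (simp add: OK_OK)
  moreover have "d * of_int e \<in> elts OK" using d(1) by (simp add: mem_OK algebraic_int_times)
  moreover have "OK * (pr a * I) = pr a * I"
    using frac_idealD(1)[OF assms(3)] by (simp add: mult.left_commute[of OK])
  moreover have "pr a * I \<noteq> 0"
    using assms(2) frac_idealD(4)[OF assms(3)] by (metis mult_zero_right pr_inverse_mult(2))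
  moreover have "elts (pr a * I) \<subseteq> K"
    using frac_idealD(3)[OF assms(3)] assms(1) by (auto simp: elts_pr_mult)
  ultimately show ?thesis
    unfolding frac_ideal_def using d(2) e(1) by (auto intro!: bexI[of _ "d * of_int e"])
qed

lemma class_group_monoid: "Group.monoid (class_group K)"
proof (rule monoidI)
  show "\<one>\<^bsub>class_group K\<^esub> \<in> carrier (class_group K)"
    using frac_ideal_OK by (auto simp: carrier_class_group one_class_group)
  show "x \<otimes>\<^bsub>class_group K\<^esub> y \<in> carrier (class_group K)"
    if "x \<in> carrier (class_group K)" "y \<in> carrier (class_group K)" for x y
    using that frac_ideal_mult by (auto simp: carrier_class_group mult_class_group)
  show "x \<otimes>\<^bsub>class_group K\<^esub> y \<otimes>\<^bsub>class_group K\<^esub> z = x \<otimes>\<^bsub>class_group K\<^esub> (y \<otimes>\<^bsub>class_group K\<^esub> z)"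
    if "x \<in> carrier (class_group K)" "y \<in> carrier (class_group K)" "z \<in> carrier (class_group K)" for x y z
    using that frac_ideal_mult by (auto simp: carrier_class_group mult_class_group mult.assoc)
  show "\<one>\<^bsub>class_group K\<^esub> \<otimes>\<^bsub>class_group K\<^esub> x = x" if "x \<in> carrier (class_group K)" for x
    using that frac_ideal_OK frac_idealD(1) by (auto simp: carrier_class_group one_class_group mult_class_group)
  show "x \<otimes>\<^bsub>class_group K\<^esub> \<one>\<^bsub>class_group K\<^esub> = x" if "x \<in> carrier (class_group K)" for x
    using that frac_ideal_OK frac_idealD(2) by (auto simp: carrier_class_group one_class_group mult_class_group)
qed

end

section \<open>Class groups of imaginary quadratic fields\<close>

locale imaginary_quadratic_field = number_field F for F +
  fixes w :: complex
  assumes w_in_F: "w \<in> F" and cnj_w: "cnj w = - w" and w_ne_0: "w \<noteq> 0"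
    and int_w: "algebraic_int w"
    and F_elt: "x \<in> F \<Longrightarrow> \<exists>a b. x = of_rat a + of_rat b * w"
begin

sublocale algebraic_number_field F
proof
  fix x assume "x \<in> F"
  then obtain a b where x: "x = of_rat a + of_rat b * w" using F_elt by blast
  obtain s t where st: "t > 0" "a = of_int s / of_int t" by (metis Fract_of_int_quotient Rat_cases)
  obtain u v where uv: "v > 0" "b = of_int u / of_int v" by (metis Fract_of_int_quotient Rat_cases)
  have "of_int (t * v) * x = of_int (s * v) + of_int (u * t) * w"
    using st(1) uv(1) by (simp add: x st(2) uv(2) of_rat_divide field_simps)
  also have "algebraic_int \<dots>"
    using int_w by (intro algebraic_int_plus algebraic_int_times algebraic_int_of_int)
  finally show "\<exists>d::int. d > 0 \<and> algebraic_int (of_int d * x)"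
    using st(1) uv(1) by (intro exI[of _ "t * v"]) simp
qed

lemma cnj_of_rat: "cnj (of_rat a) = of_rat a"
  by (cases a) (simp add: of_rat_rat)

lemma cnj_eq: "cnj (of_rat a + of_rat b * w) = of_rat a - of_rat b * w"
  by (simp add: cnj_of_rat cnj_w)

lemma cnj_in_F [simp, intro]: "x \<in> F \<Longrightarrow> cnj x \<in> F"
proof -
  assume "x \<in> F"
  then obtain a b where "x = of_rat a + of_rat b * w" using F_elt by blast
  then show ?thesis using w_in_F by (simp only: cnj_eq) auto
qed

lemma fixed_by_cnj: "x \<in> F \<Longrightarrow> cnj x = x \<Longrightarrow> x \<in> \<rat>"
proof -
  assume "x \<in> F" and fixed: "cnj x = x"
  then obtain a b where x: "x = of_rat a + of_rat b * w" using F_elt by blast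
  with fixed have "of_rat a - of_rat b * w = of_rat a + of_rat b * w" by (simp only: cnj_eq)
  then have "of_rat b * w = 0" by auto
  with x show ?thesis by simp
qed

lemma fixed_by_cnj_int: "x \<in> elts OK \<Longrightarrow> cnj x = x \<Longrightarrow> x \<in> \<int>"
  using fixed_by_cnj rational_algebraic_int_is_int by (auto simp: mem_OK)

lemma norm_OK:
  assumes "x \<in> elts OK" "x \<noteq> 0"
  obtains k :: int where "k > 0" "x * cnj x = of_int k"
proof -
  have "x * cnj x \<in> elts OK"
    using assms by (auto simp: mem_OK intro!: algebraic_int_times)
  then have "x * cnj x \<in> \<int>" by (rule fixed_by_cnj_int) simp
  then obtain k where k: "x * cnj x = of_int k" by (auto elim: Ints_cases)
  have "x * cnj x = of_real ((cmod x)\<^sup>2)" by (metis complex_norm_square)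
  with k have "(of_real (of_int k) :: complex) = of_real ((cmod x)\<^sup>2)" by simp
  then have "of_int k = (cmod x)\<^sup>2" by (simp only: of_real_eq_iff)
  then have "k > 0" using assms(2) by (metis of_int_0_less_iff zero_less_norm_iff zero_less_power)
  with k show thesis using that by blast
qed

lemma w_sq:
  obtains D :: int where "D > 0" "w * w = - of_int D"
proof -
  have "w \<in> elts OK" using w_in_F int_w by (simp add: mem_OK)
  then obtain k where "k > 0" "w * cnj w = of_int k" using norm_OK w_ne_0 by blast
  then show thesis using that[of k] by (simp add: cnj_w minus_equation_iff)
qed

lift_definition conj_ideal :: "zmod \<Rightarrow> zmod" is "\<lambda>I. cnj ` I"
  by (auto simp: zm_subspace_iff image_iff) (metis complex_cnj_add, metis complex_cnj_minus)

lemma elts_conj_ideal: "elts (conj_ideal I) = cnj ` elts I"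
  by transfer simp

lemma quadratic_algebraic_int:
  assumes "t + t' = of_int u" "t * t' = of_int v"
  shows "algebraic_int (t :: complex)"
proof (rule algebraic_int.intros[of "[:of_int v, - of_int u, 1:]"])
  show "\<forall>i. coeff [:of_int v, - of_int u, 1::complex:] i \<in> \<int>"
    by (auto simp: coeff_pCons split: nat.splits)
  show "poly [:of_int v, - of_int u, 1:] t = 0"
    by (simp flip: assms add: algebra_simps)
qed simp

text \<open>
  For integral \<open>S\<close>, the product of \<open>S\<close> with its conjugate is generated by the positive generator
  \<open>g\<close> of the ideal of rational integers in it: an element \<open>a * cnj b\<close> of the product has trace
  divisible by \<open>g\<close> and norm divisible by \<open>g\<^sup>2\<close>.
\<close>

lemma integral_ideal_mult_conj:
  assumes S: "S \<le> OK" "OK * S = S" "S \<noteq> 0"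
  obtains g :: int where "g > 0" "S * conj_ideal S = pr (of_int g) * OK"
proof -
  have SO: "a \<in> elts OK" if "a \<in> elts S" for a using zmod_leD[OF S(1) that] .
  define P where "P = S * conj_ideal S"
  have P: "a * cnj b \<in> elts P" if "a \<in> elts S" "b \<in> elts S" for a b
    unfolding P_def using that by (intro elts_mult) (auto simp: elts_conj_ideal)
  have "elts S \<noteq> {0}" using S(3) by (metis elts_inverse elts_zero)
  then obtain a0 where a0: "a0 \<in> elts S" "a0 \<noteq> 0" using elts_0 by blast
  obtain k0 where k0: "k0 > 0" "a0 * cnj a0 = of_int k0" using norm_OK SO a0 by blast
  define Q where "Q k \<longleftrightarrow> k > 0 \<and> of_int (int k) \<in> elts P" for k
  have "Q (nat k0)" using k0 P[OF a0(1) a0(1)] by (simp add: Q_def)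
  then obtain g where g: "Q g" "\<And>k. Q k \<Longrightarrow> g \<le> k"
    by (metis LeastI Least_le)
  have dvd: "int g dvd k" if "of_int k \<in> elts P" for k
  proof (rule ccontr)
    assume "\<not> int g dvd k"
    then have "k mod int g \<noteq> 0" by (simp add: dvd_eq_mod_eq_0)
    moreover have "k mod int g \<ge> 0" using g(1) by (simp add: Q_def)
    ultimately have pos: "k mod int g > 0" by simp
    have "of_int k - of_int (k div int g) * of_int (int g) \<in> elts P"
      using that g(1) by (intro elts_diff elts_of_int_mult) (auto simp: Q_def)
    also have "of_int k - of_int (k div int g) * of_int (int g) = (of_int (k mod int g) :: complex)"
      by (metis minus_div_mult_eq_mod of_int_diff of_int_mult)
    finally have "Q (nat (k mod int g))" using pos by (simp add: Q_def)
    then have "g \<le> nat (k mod int g)" by (rule g(2))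
    moreover have "k mod int g < int g" using g(1) by (simp add: Q_def)
    ultimately show False using pos by linarith
  qed
  have "P \<le> pr (of_int (int g)) * OK"
    unfolding P_def zmod_mult_le_iff
  proof (intro ballI)
    fix a b' assume a: "a \<in> elts S" and "b' \<in> elts (conj_ideal S)"
    then obtain b where b: "b \<in> elts S" "b' = cnj b" by (auto simp: elts_conj_ideal)
    let ?t = "a * cnj b"
    have "?t + cnj ?t \<in> elts P" using P[OF a b(1)] P[OF b(1) a] by (auto simp: mult.commute)
    moreover have "?t + cnj ?t \<in> \<int>"
      using SO[OF a] SO[OF b(1)]
      by (intro fixed_by_cnj_int) (auto simp: mem_OK intro!: algebraic_int_plus algebraic_int_times)
    ultimately obtain u where u: "?t + cnj ?t = of_int (int g * u)"
      by (metis Ints_cases dvd dvdE)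
    have nrm: "\<exists>v. c * cnj c = of_int (int g * v)" if "c \<in> elts S" for c
    proof -
      have "c * cnj c \<in> \<int>"
        using SO[OF that] by (intro fixed_by_cnj_int) (auto simp: mem_OK intro!: algebraic_int_times)
      then show ?thesis using P[OF that that] by (metis Ints_cases dvd dvdE)
    qed
    obtain v1 where v1: "a * cnj a = of_int (int g * v1)" using nrm[OF a] by blast
    obtain v2 where v2: "b * cnj b = of_int (int g * v2)" using nrm[OF b(1)] by blast
    have g0: "(of_int (int g) :: complex) \<noteq> 0" using g(1) by (simp add: Q_def)
    let ?g = "of_int (int g) :: complex"
    have "?t / ?g + cnj ?t / ?g = of_int u"
      using u g0 by (simp only: add_divide_distrib[symmetric] of_int_mult) simp
    moreover have "?t * cnj ?t = (a * cnj a) * (b * cnj b)" by (simp add: mult_ac)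
    then have "?t / ?g * (cnj ?t / ?g) = of_int (v1 * v2)"
      using g0 unfolding v1 v2 by simp
    ultimately have "algebraic_int (?t / ?g)" by (rule quadratic_algebraic_int)
    moreover have "?t / ?g \<in> F" using SO[OF a] SO[OF b(1)] by (auto simp: mem_OK)
    moreover have "?t = ?g * (?t / ?g)" using g0 by simp
    ultimately show "a * b' \<in> elts (pr ?g * OK)"
      unfolding elts_pr_mult b(2) by (intro image_eqI[of _ _ "?t / ?g"]) (simp_all only: mem_OK)
  qed
  moreover have "pr (of_int (int g)) * OK \<le> P"
  proof -
    have "pr (of_int (int g)) \<le> P" using g(1) by (simp add: pr_le_iff Q_def)
    then have "pr (of_int (int g)) * OK \<le> P * OK" by (intro zmod_mult_mono) auto
    also have "P * OK = (OK * S) * conj_ideal S" by (simp add: P_def mult_ac)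
    also have "\<dots> = P" by (simp add: S(2) P_def)
    finally show ?thesis .
  qed
  ultimately have "P = pr (of_int (int g)) * OK" by (rule antisym)
  then show thesis using that[of "int g"] g(1) by (simp add: P_def Q_def)
qed

lemma conj_ideal_OK_mult: "OK * S = S \<Longrightarrow> OK * conj_ideal S = conj_ideal S"
proof (rule OK_mult_eqI, unfold zmod_mult_le_iff, intro ballI)
  fix a b' assume S: "OK * S = S" and a: "a \<in> elts OK" and "b' \<in> elts (conj_ideal S)"
  then obtain b where b: "b \<in> elts S" "b' = cnj b" by (auto simp: elts_conj_ideal)
  have "cnj a * b \<in> elts S"
    using elts_mult[of "cnj a" OK b S] a b(1) S by (auto simp: mem_OK)
  then have "cnj (cnj a * b) \<in> elts (conj_ideal S)" unfolding elts_conj_ideal by (rule imageI)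
  then show "a * b' \<in> elts (conj_ideal S)" by (simp add: b(2))
qed

lemma frac_ideal_integral: "S \<le> OK \<Longrightarrow> OK * S = S \<Longrightarrow> S \<noteq> 0 \<Longrightarrow> frac_ideal S"
  unfolding frac_ideal_def using mem_OK
  by (auto simp: pr_1 dest: zmod_leD intro!: bexI[of _ 1])

lemma frac_ideal_inverse:
  assumes "frac_ideal I"
  obtains J where "frac_ideal J" "I * J = OK"
proof -
  obtain d where d: "d \<in> elts OK" "d \<noteq> 0" "pr d * I \<le> OK"
    using assms by (auto simp: frac_ideal_def)
  define S where "S = pr d * I"
  have S: "S \<le> OK" "OK * S = S" "S \<noteq> 0"
    using d frac_idealD[OF assms] pr_inverse_mult(2)[of d I]
    by (auto simp: S_def mult.left_commute[of OK])
  then obtain g where g: "g > 0" "S * conj_ideal S = pr (of_int g) * OK"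
    by (rule integral_ideal_mult_conj)
  have g0: "(of_int g :: complex) \<noteq> 0" using g(1) by simp
  have "conj_ideal S \<le> OK"
    using zmod_leD[OF S(1)] by (auto simp: elts_conj_ideal mem_OK intro!: zmod_leI)
  moreover have "conj_ideal S \<noteq> 0"
    using S(3) by (metis elts_conj_ideal elts_inverse elts_zero image_empty image_insert complex_cnj_zero 
        image_is_empty inj_image_eq_iff inj_def complex_cnj_cancel_iff)
  ultimately have "frac_ideal (conj_ideal S)"
    using conj_ideal_OK_mult[OF S(2)] by (intro frac_ideal_integral)
  then have "frac_ideal (pr (d * inverse (of_int g)) * conj_ideal S)"
    using d g0 by (intro frac_ideal_pr_mult) (auto simp: mem_OK)
  moreover have "I * (pr (d * inverse (of_int g)) * conj_ideal S) = pr (inverse (of_int g)) * (S * conj_ideal S)"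
    by (simp add: S_def pr_mult mult_ac)
  then have "I * (pr (d * inverse (of_int g)) * conj_ideal S) = OK"
    using g0 by (simp add: g(2) pr_inverse_mult)
  ultimately show thesis by (rule that)
qed

lemma class_group_group: "group (class_group F)"
proof (intro group.intro class_group_monoid group_axioms.intro subsetI)
  fix C assume "C \<in> carrier (class_group F)"
  then obtain I where I: "frac_ideal I" "C = ideal_cls I" by (auto simp: carrier_class_group)
  obtain J where J: "frac_ideal J" "I * J = OK" using frac_ideal_inverse[OF I(1)] .
  then have "ideal_cls J \<otimes>\<^bsub>class_group F\<^esub> C = \<one>\<^bsub>class_group F\<^esub>"
    "C \<otimes>\<^bsub>class_group F\<^esub> ideal_cls J = \<one>\<^bsub>class_group F\<^esub>"
    using I by (simp_all add: mult_class_group one_class_group mult.commute)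
  then show "C \<in> Units (class_group F)"
    using I J by (auto simp: Units_def carrier_class_group)
qed

definition reduced :: "zmod \<Rightarrow> bool"
  where "reduced J \<longleftrightarrow> frac_ideal J \<and> 1 \<in> elts J \<and> (\<forall>y\<in>elts J. y \<noteq> 0 \<longrightarrow> cmod y \<ge> 1)"

lemma ex_reduced:
  assumes "frac_ideal I"
  obtains J where "reduced J" "ideal_cls J = ideal_cls I"
proof -
  obtain d where d: "d \<in> elts OK" "d \<noteq> 0" "pr d * I \<le> OK"
    using assms by (auto simp: frac_ideal_def)
  define f where "f x = nat \<lfloor>(cmod (d * x))\<^sup>2\<rfloor>" for x
  have f: "of_nat (f x) = (cmod (d * x))\<^sup>2" if "x \<in> elts I" for x
  proof (cases "x = 0")
    case False
    have "d * x \<in> elts OK" using zmod_leD[OF d(3)] that by (auto simp: elts_pr_mult)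
    then obtain k where k: "k > 0" "(d * x) * cnj (d * x) = of_int k"
      using False d(2) norm_OK[of "d * x"] by auto
    have "(d * x) * cnj (d * x) = of_real ((cmod (d * x))\<^sup>2)" by (metis complex_norm_square)
    with k have "(of_real (of_int k) :: complex) = of_real ((cmod (d * x))\<^sup>2)" by simp
    then have "of_int k = (cmod (d * x))\<^sup>2" by (simp only: of_real_eq_iff)
    then show ?thesis using k(1) unfolding f_def by (metis floor_of_int of_int_of_nat_eq int_nat_eq less_imp_le)
  qed (simp add: f_def)
  obtain x1 where x1: "x1 \<in> elts I" "x1 \<noteq> 0" using frac_ideal_nonzero_elt[OF assms] .
  obtain x where x: "x \<in> elts I" "x \<noteq> 0" "\<And>y. y \<in> elts I \<Longrightarrow> y \<noteq> 0 \<Longrightarrow> f x \<le> f y"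
    using ex_has_least_nat[of "\<lambda>x. x \<in> elts I \<and> x \<noteq> 0" x1 f] x1 by blast
  have le: "cmod x \<le> cmod y" if "y \<in> elts I" "y \<noteq> 0" for y
  proof -
    have "real (f x) \<le> real (f y)" using x(3)[OF that] by simp
    then have "(cmod (d * x))\<^sup>2 \<le> (cmod (d * y))\<^sup>2" by (simp only: f x(1) that(1))
    then have "cmod (d * x) \<le> cmod (d * y)" by (rule power2_le_imp_le) simp
    then show ?thesis using d(2) by (simp add: norm_mult)
  qed
  have xF: "inverse x \<in> F" "inverse x \<noteq> 0" using x frac_idealD(5)[OF assms] by auto
  let ?J = "pr (inverse x) * I"
  have "frac_ideal ?J" using xF assms by (rule frac_ideal_pr_mult)
  moreover have "1 \<in> elts ?J" using x by (auto simp: elts_pr_mult image_iff intro!: bexI[of _ x])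
  moreover have "cmod y \<ge> 1" if y: "y \<in> elts ?J" "y \<noteq> 0" for y
  proof -
    obtain z where z: "z \<in> elts I" "y = inverse x * z" using y(1) by (auto simp: elts_pr_mult)
    with y(2) have "z \<noteq> 0" by auto
    then show ?thesis using le[OF z(1)] x(2) by (simp add: z(2) norm_divide divide_inverse[symmetric] mult.commute[of "inverse x"] field_simps)
  qed
  ultimately have "reduced ?J" by (simp add: reduced_def)
  moreover have "ideal_cls ?J = ideal_cls I"
    using ideal_cls_eq_iff[OF \<open>frac_ideal ?J\<close> assms] xF by blast
  ultimately show thesis by (rule that)
qed

lemma cmod_F: 
  assumes "w * w = - of_int D"
  shows "(cmod (of_real a + of_real b * w))\<^sup>2 = a\<^sup>2 + of_int D * b\<^sup>2"
proof -
  have "of_real ((cmod (of_real a + of_real b * w))\<^sup>2) = (of_real a + of_real b * w) * cnj (of_real a + of_real b * w)"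
    by (metis complex_norm_square)
  also have "\<dots> = of_real a * of_real a - of_real b * of_real b * (w * w)"
    by (simp add: cnj_w algebra_simps)
  also have "\<dots> = of_real (a\<^sup>2 + of_int D * b\<^sup>2)"
    by (simp add: assms power2_eq_square)
  finally show ?thesis by (simp only: of_real_eq_iff)
qed

lemma reduced_bounded_denominator:
  obtains M :: nat where "M > 0" "\<And>J y. reduced J \<Longrightarrow> y \<in> elts J \<Longrightarrow> of_nat M * y \<in> elts OK"
proof -
  obtain D :: int where D: "D > 0" "w * w = - of_int D" by (rule w_sq)
  define T where "T = nat D + 1"
  have T: "T > 0" "1 + D \<le> int T" by (auto simp: T_def)
  have main: "of_nat (fact (T * T)) * y \<in> elts OK" if J0: "reduced J" and yJ: "y \<in> elts J" for J y
  proof -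
    have J: "frac_ideal J" "1 \<in> elts J" "\<And>y. y \<in> elts J \<Longrightarrow> y \<noteq> 0 \<Longrightarrow> cmod y \<ge> 1"
      using J0 by (auto simp: reduced_def)
    obtain a b where ab: "y = of_rat a + of_rat b * w"
      using F_elt frac_idealD(5)[OF J(1) yJ] by blast
    define a' b' where "a' = (of_rat a :: real)" and "b' = (of_rat b :: real)"
    have y: "y = of_real a' + of_real b' * w"     proof -
      have "of_real (of_rat q) = (of_rat q :: complex)" for q
        by (cases q) (simp add: of_rat_rat)
      then show ?thesis by (simp add: ab a'_def b'_def)
    qed
    define h where "h k = (\<lfloor>of_nat T * frac (of_nat k * a')\<rfloor>, \<lfloor>of_nat T * frac (of_nat k * b')\<rfloor>)" for k :: nat
    have "h ` {..T*T} \<subseteq> {0..<int T} \<times> {0..<int T}"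
    proof -
      have "0 \<le> \<lfloor>of_nat T * frac u\<rfloor> \<and> \<lfloor>of_nat T * frac u\<rfloor> < int T" for u :: real
      proof -
        have "of_nat T * frac u < of_nat T * 1"
          using frac_lt_1[of u] T(1) by (intro mult_strict_left_mono) auto
        then show ?thesis using frac_ge_0[of u] by (simp add: floor_less_iff)
      qed
      then show ?thesis by (auto simp: h_def)
    qed
    then have "card (h ` {..T*T}) \<le> card ({0..<int T} \<times> {0..<int T})"
      by (rule card_mono[rotated]) simp
    then have "card (h ` {..T*T}) < card {..T*T}" by simp
    then have "\<not> inj_on h {..T*T}" using pigeonhole by blast
    then obtain k l where kl: "k < l" "l \<le> T * T" "h k = h l"
      unfolding inj_on_def by (metis atMost_iff linorder_neqE_nat)
    define i where "i = l - k"
    define za zb where "za = \<lfloor>of_nat l * a'\<rfloor> - \<lfloor>of_nat k * a'\<rfloor>" and "zb = \<lfloor>of_nat l * b'\<rfloor> - \<lfloor>of_nat k * b'\<rfloor>"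
    define al where "al = of_nat i * a' - of_int za"
    define be where "be = of_nat i * b' - of_int zb"
    have small: "\<bar>frac u - frac v\<bar> < 1 / of_nat T" if "\<lfloor>of_nat T * frac u\<rfloor> = \<lfloor>of_nat T * frac v\<rfloor>" for u v :: real
    proof -
      have "\<bar>of_nat T * frac u - of_nat T * frac v\<bar> < 1" using that by linarith
      then have "of_nat T * \<bar>frac u - frac v\<bar> < 1" using T(1)
        by (simp add: abs_mult flip: right_diff_distrib)
      then show ?thesis using T(1) by (simp add: field_simps)
    qed
    have "al = frac (of_nat l * a') - frac (of_nat k * a')"
      using kl(1) by (simp add: al_def i_def za_def frac_def of_nat_diff algebra_simps)
    then have al: "\<bar>al\<bar> < 1 / of_nat T" using kl(3) small by (simp add: h_def)
    have "be = frac (of_nat l * b') - frac (of_nat k * b')"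
      using kl(1) by (simp add: be_def i_def zb_def frac_def of_nat_diff algebra_simps)
    then have be: "\<bar>be\<bar> < 1 / of_nat T" using kl(3) small by (simp add: h_def)
    define z where "z = of_int za + of_int zb * w"
    have z: "z \<in> elts OK" using w_in_F int_w
      by (auto simp: z_def mem_OK intro!: algebraic_int_plus algebraic_int_times)
    have diff: "of_nat i * y - z = of_real al + of_real be * w"
      by (simp add: y z_def al_def be_def algebra_simps)
    have "of_nat i * y - z = 0"
    proof (rule ccontr)
      assume nz: "of_nat i * y - z \<noteq> 0"
      have "z \<in> elts J" using elts_mult[OF z J(2)] frac_idealD(1)[OF J(1)] by simp
      moreover have "of_nat i * y \<in> elts J" using elts_of_int_mult[OF yJ, of "int i"] by simp
      ultimately have "1 \<le> cmod (of_nat i * y - z)" using nz J(3) by blast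
      then have "1 \<le> (cmod (of_nat i * y - z))\<^sup>2" by (simp add: one_le_power)
      also have "\<dots> = al\<^sup>2 + of_int D * be\<^sup>2" unfolding diff by (rule cmod_F[OF D(2)])
      also have "\<dots> < (1 / of_nat T)\<^sup>2 + of_int D * (1 / of_nat T)\<^sup>2"
      proof (rule add_less_le_mono)
        show "al\<^sup>2 < (1 / of_nat T)\<^sup>2" using al by (metis abs_ge_zero power2_abs power_strict_mono pos2)
        have "be\<^sup>2 \<le> (1 / of_nat T)\<^sup>2" using be by (metis abs_ge_zero power2_abs power_mono less_imp_le)
        then show "of_int D * be\<^sup>2 \<le> of_int D * (1 / of_nat T)\<^sup>2" using D(1) by (intro mult_left_mono) auto
      qed
      also have "\<dots> = (1 + of_int D) / (of_nat T)\<^sup>2" by (simp add: add_divide_distrib power_divide)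
      also have "\<dots> \<le> of_nat T / (of_nat T)\<^sup>2"
      proof (rule divide_right_mono)
        have "real_of_int (1 + D) \<le> real_of_int (int T)" using T(2) by (simp only: of_int_le_iff)
        then show "1 + real_of_int D \<le> of_nat T" by simp
      qed simp
      also have "\<dots> \<le> 1" using T(1) by (simp add: power2_eq_square)
      finally show False by simp
    qed
    then have iy: "of_nat i * y \<in> elts OK" using z by simp
    have "i dvd fact (T * T)" using kl by (intro dvd_fact) (auto simp: i_def)
    then obtain c where "fact (T * T) = i * c" by (elim dvdE)
    then have "of_nat (fact (T * T)) * y = of_int (int c) * (of_nat i * y)" by (simp add: mult_ac)
    then show ?thesis using elts_of_int_mult[OF iy] by metis
  qed
  have "(fact (T * T) :: nat) > 0" by simp
  then show thesis using that main by blast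
qed

lemma finite_reduced: "finite (Collect reduced)"
proof -
  obtain M where M: "M > 0" "\<And>J y. reduced J \<Longrightarrow> y \<in> elts J \<Longrightarrow> of_nat M * y \<in> elts OK"
    by (rule reduced_bounded_denominator) blast
  obtain D :: int where D: "D > 0" "w * w = - of_int D" by (rule w_sq)
  define E where "E = 2 * D * int M"
  have E: "E > 0" using D M by (simp add: E_def)
  have OKE: "\<exists>a b. of_int (2 * D) * x = of_int a + of_int b * w" if "x \<in> elts OK" for x
  proof -
    obtain a b where ab: "x = of_rat a + of_rat b * w" using F_elt \<open>x \<in> elts OK\<close> mem_OK by blast
    have wO: "w \<in> elts OK" using w_in_F int_w by (simp add: mem_OK)
    have cO: "cnj x \<in> elts OK" using that by (auto simp: mem_OK)
    have "x + cnj x \<in> \<int>" using that cO by (intro fixed_by_cnj_int) (auto simp: add.commute)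
    then obtain s where s: "x + cnj x = of_int s" by (elim Ints_cases)
    have "(x - cnj x) * w \<in> elts OK"
      using that cO wO by (auto simp: mem_OK intro!: algebraic_int_times algebraic_int_diff)
    moreover have "cnj ((x - cnj x) * w) = (x - cnj x) * w" by (simp add: cnj_w algebra_simps)
    ultimately have "(x - cnj x) * w \<in> \<int>" by (rule fixed_by_cnj_int)
    then obtain t where t: "(x - cnj x) * w = of_int t" by (elim Ints_cases)
    have "of_int (2 * D) * x = of_int D * (x + cnj x) + of_int D * (x - cnj x)" by (simp add: algebra_simps)
    also have "of_int D * (x - cnj x) = - ((x - cnj x) * w) * w"
      using D(2) by (simp add: mult.assoc)
    finally have "of_int (2 * D) * x = of_int (D * s) + of_int (- t) * w" unfolding s t by simp
    then show ?thesis by blast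
  qed
  have JE: "\<exists>a b. of_int E * y = of_int a + of_int b * w" if "reduced J" "y \<in> elts J" for J y
    using OKE[OF M(2)[OF that]] by (simp add: E_def mult.assoc)
  define pt where "pt = (\<lambda>(a, b). (of_int a + of_int b * w) / of_int E :: complex)"
  define R where "R = pt ` ({0..<E} \<times> {0..<E})"
  have finR: "finite R" by (simp add: R_def)
  have sub: "elts J \<subseteq> elts J'"
    if J: "reduced J" and J': "reduced J'" and le: "R \<inter> elts J \<subseteq> R \<inter> elts J'" for J J'
  proof
    fix y assume y: "y \<in> elts J"
    have lat: "of_int c + of_int d * w \<in> elts I" if "reduced I" for c d I
    proof -
      have I: "frac_ideal I" "1 \<in> elts I" using that by (auto simp: reduced_def)
      have "(of_int c + of_int d * w) * 1 \<in> elts (OK * I)" using w_in_F int_w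
        by (intro elts_mult I) (auto simp: mem_OK intro!: algebraic_int_plus algebraic_int_times)
      then show ?thesis by (simp add: frac_idealD(1)[OF I(1)])
    qed
    obtain a b where ab: "of_int E * y = of_int a + of_int b * w" using JE[OF J y] by blast
    define z where "z = of_int (a div E) + of_int (b div E) * w"
    have yz: "y - z = pt (a mod E, b mod E)"
    proof -
      have "of_int E * (y - z) = of_int (a mod E) + of_int (b mod E) * w"
        unfolding right_diff_distrib ab z_def
        by (simp add: algebra_simps flip: minus_mult_div_eq_mod)
      moreover have "y - z = of_int E * (y - z) / of_int E" using E by simp
      ultimately show ?thesis by (simp add: pt_def)
    qed
    have "y - z \<in> R" unfolding yz R_def using E by auto
    moreover have "y - z \<in> elts J" using y lat[OF J] unfolding z_def by blast
    ultimately have "y - z \<in> elts J'" using le by blast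
    then have "(y - z) + z \<in> elts J'" using lat[OF J'] unfolding z_def by blast
    then show "y \<in> elts J'" by simp
  qed
  have "inj_on (\<lambda>J. R \<inter> elts J) (Collect reduced)"
  proof (rule inj_onI)
    fix J J' assume "J \<in> Collect reduced" "J' \<in> Collect reduced" "R \<inter> elts J = R \<inter> elts J'"
    then have "elts J = elts J'" using sub[of J J'] sub[of J' J] by auto
    then show "J = J'" by (simp add: elts_inject)
  qed
  moreover have "finite ((\<lambda>J. R \<inter> elts J) ` Collect reduced)"
    by (rule finite_subset[of _ "Pow R"]) (use finR in auto)
  ultimately show ?thesis by (rule finite_imageD[rotated])
qed

lemma finite_class_group: "finite (carrier (class_group F))"
proof (rule finite_subset)
  show "carrier (class_group F) \<subseteq> ideal_cls ` Collect reduced"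
  proof
    fix C assume "C \<in> carrier (class_group F)"
    then obtain I where I: "frac_ideal I" "C = ideal_cls I" by (auto simp: carrier_class_group)
    obtain J where "reduced J" "ideal_cls J = ideal_cls I" using ex_reduced[OF I(1)] .
    then show "C \<in> ideal_cls ` Collect reduced" using I(2) by blast
  qed
qed (use finite_reduced in simp)

lemma frac_ideal_power: "frac_ideal I \<Longrightarrow> k > 0 \<Longrightarrow> frac_ideal (I ^ k)"
proof (induction k)
  case (Suc k)
  then show ?case by (cases k) (auto intro: frac_ideal_mult)
qed simp

lemma prime_dvd_class_number:
  assumes q: "Factorial_Ring.prime q" "q dvd class_number F" and k: "k > 0"
    and pow: "\<And>I. frac_ideal I \<Longrightarrow> \<exists>b\<in>F - {0}. I ^ k = pr b * OK"
  shows "q dvd k"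
proof -
  interpret G: group "class_group F" by (rule class_group_group)
  have exp: "C [^]\<^bsub>class_group F\<^esub> k = \<one>\<^bsub>class_group F\<^esub>" if C: "C \<in> carrier (class_group F)" for C
  proof -
    obtain I where I: "frac_ideal I" "C = ideal_cls I" using C by (auto simp: carrier_class_group)
    have "C [^]\<^bsub>class_group F\<^esub> j = ideal_cls (I ^ j)" if "j > 0" for j :: nat
      using that
    proof (induction j)
      case (Suc j)
      show ?case
      proof (cases "j = 0")
        case True
        then show ?thesis using C I(2) by simp
      next
        case False
        then show ?thesis
          using Suc I frac_ideal_power[OF I(1)] by (simp add: mult_class_group mult.commute)
      qed
    qed simp
    then have "C [^]\<^bsub>class_group F\<^esub> k = ideal_cls (I ^ k)" using k by simp
    also have "\<dots> = ideal_cls OK"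
      using ideal_cls_eq_iff[OF frac_ideal_power[OF I(1) k] frac_ideal_OK] pow[OF I(1)] by simp
    finally show ?thesis by (simp add: one_class_group)
  qed
  obtain c where c: "class_number F = q ^ 1 * c" using q(2) by (auto elim: dvdE)
  obtain H where H: "subgroup H (class_group F)" "card H = q ^ 1"
    using sylow_thm[OF q(1) class_group_group _ finite_class_group, of 1 c] c
    unfolding class_number_def by auto
  have "\<exists>h\<in>H. h \<noteq> \<one>\<^bsub>class_group F\<^esub>"
  proof (rule ccontr)
    assume "\<not> ?thesis"
    then have "H \<subseteq> {\<one>\<^bsub>class_group F\<^esub>}" by blast
    then have "card H \<le> 1" by (metis card_mono finite.emptyI finite.insertI is_singletonI is_singleton_altdef)
    then show False using H(2) prime_gt_1_nat[OF q(1)] by simp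
  qed
  then obtain h where h: "h \<in> H" "h \<noteq> \<one>\<^bsub>class_group F\<^esub>" by blast
  have hG: "h \<in> carrier (class_group F)" using H(1) h(1) by (metis subgroup.mem_carrier)
  interpret HG: group "(class_group F)\<lparr>carrier := H\<rparr>" using G.subgroup_imp_group[OF H(1)] .
  have "h [^]\<^bsub>(class_group F)\<lparr>carrier := H\<rparr>\<^esub> (card H) = \<one>\<^bsub>class_group F\<^esub>"
    using HG.pow_order_eq_1[of h] h(1) by (simp add: Coset.order_def)
  then have "h [^]\<^bsub>class_group F\<^esub> q = \<one>\<^bsub>class_group F\<^esub>"
    using H(2) G.nat_pow_consistent[of h q H] by simp
  then have "group.ord (class_group F) h dvd q" using G.pow_eq_id[OF hG] by simp
  moreover have "group.ord (class_group F) h \<noteq> 1" using G.ord_eq_1[OF hG] h(2) by simp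
  ultimately have "group.ord (class_group F) h = q" using q(1) by (metis prime_nat_iff)
  then show ?thesis using exp[OF hG] G.pow_eq_id[OF hG] by simp
qed

end

section \<open>The Galois action on ideals\<close>

lemma elts_zspan: "zm.subspace A \<Longrightarrow> elts (zspan A) = A"
  by (simp add: zspan.rep_eq)

context prime_power_cyclotomic
begin

sublocale L: algebraic_number_field "cyclotomic_field \<zeta>"
proof
  fix x assume "x \<in> L"
  then obtain f where f: "x = ev f \<zeta>" by (rule L_cases)
  obtain d B where d: "d > 0" "smult (of_int d) f = map_poly of_int B"
    by (rule rat_poly_common_denominator)
  have "of_int d * x = ev (smult (of_int d) f) \<zeta>" by (simp add: f)
  also have "\<dots> = evi B \<zeta>" unfolding d(2) by simp
  finally show "\<exists>d::int. d > 0 \<and> algebraic_int (of_int d * x)"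
    using d(1) algebraic_int_evi[OF algebraic_int_zeta] by metis
qed

definition im :: "nat \<Rightarrow> zmod \<Rightarrow> zmod"
  where "im k I = zspan (gal k ` (elts I \<inter> L))"

lemma elts_im:
  assumes "coprime k p" "elts I \<subseteq> L"
  shows "elts (im k I) = gal k ` elts I"
proof -
  have "zm.subspace (gal k ` elts I)"
    unfolding zm_subspace_iff
  proof (intro conjI ballI)
    show "0 \<in> gal k ` elts I" using gal_0_1(1)[OF assms(1)] by (intro image_eqI[of _ _ 0]) auto
  next
    fix x y assume "x \<in> gal k ` elts I" "y \<in> gal k ` elts I"
    then obtain a b where "x = gal k a" "y = gal k b" "a \<in> elts I" "b \<in> elts I" by auto
    moreover from this have "gal k (a + b) = x + y" using assms gal_simps(1)[OF assms(1), of a b] by auto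
    ultimately show "x + y \<in> gal k ` elts I" by (metis elts_add imageI)
  next
    fix x assume "x \<in> gal k ` elts I"
    then obtain a where "x = gal k a" "a \<in> elts I" by auto
    moreover from this have "gal k (- a) = - x" using assms by (auto simp: gal_simps)
    ultimately show "- x \<in> gal k ` elts I" by (metis elts_minus imageI)
  qed
  then show ?thesis
    using assms(2) by (simp add: im_def elts_zspan Int_absorb2)
qed

lemma im_subset_L: "coprime k p \<Longrightarrow> elts I \<subseteq> L \<Longrightarrow> elts (im k I) \<subseteq> L"
  by (auto simp: elts_im)

lemma im_mult:
  assumes k: "coprime k p" and I: "elts I \<subseteq> L" and J: "elts J \<subseteq> L"
  shows "im k (I * J) = im k I * im k J"
proof (rule antisym)
  have IJ: "elts (I * J) \<subseteq> L" using L.zmod_mult_subset_K[OF I J] .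
  show "im k (I * J) \<le> im k I * im k J"
  proof (rule zmod_leI)
    fix u assume "u \<in> elts (im k (I * J))"
    then obtain x where x: "x \<in> elts (I * J)" "u = gal k x" using elts_im[OF k IJ] by auto
    from x(1) have "x \<in> L \<and> gal k x \<in> elts (im k I * im k J)"
    proof (induction rule: zmod_mult_induct)
      case (prod a b)
      then have "a \<in> L" "b \<in> L" using I J by auto
      moreover have "gal k a * gal k b \<in> elts (im k I * im k J)"
        using prod by (intro elts_mult) (auto simp: elts_im k I J)
      ultimately show ?case using k by (simp add: gal_simps)
    qed (use k in \<open>auto simp: gal_simps\<close>)
    then show "u \<in> elts (im k I * im k J)" using x(2) by simp
  qed
  show "im k I * im k J \<le> im k (I * J)"
    unfolding zmod_mult_le_iff
  proof (intro ballI)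
    fix x y assume "x \<in> elts (im k I)" "y \<in> elts (im k J)"
    then obtain a b where ab: "a \<in> elts I" "b \<in> elts J" "x = gal k a" "y = gal k b"
      using elts_im k I J by auto
    then have "x * y = gal k (a * b)" using I J gal_simps(3)[OF k, of a b] by (metis subsetD)
    then show "x * y \<in> elts (im k (I * J))"
      using elts_mult[OF ab(1,2)] by (auto simp: elts_im[OF k IJ])
  qed
qed

lemma im_pr_mult:
  assumes k: "coprime k p" and a: "a \<in> L" and I: "elts I \<subseteq> L"
  shows "im k (pr a * I) = pr (gal k a) * im k I"
proof (rule zmod_eqI)
  have aI: "elts (pr a * I) \<subseteq> L" using a I by (auto simp: elts_pr_mult)
  have "elts (im k (pr a * I)) = (\<lambda>x. gal k (a * x)) ` elts I"
    unfolding elts_im[OF k aI] elts_pr_mult by auto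
  also have "\<dots> = (\<lambda>x. gal k a * gal k x) ` elts I"
    using k a I by (intro image_cong) (auto simp: gal_simps)
  also have "\<dots> = elts (pr (gal k a) * im k I)"
    unfolding elts_pr_mult elts_im[OF k I] by auto
  finally show "u \<in> elts (im k (pr a * I)) \<longleftrightarrow> u \<in> elts (pr (gal k a) * im k I)" for u by simp
qed

lemma gal_OK: "coprime k p \<Longrightarrow> x \<in> elts L.OK \<Longrightarrow> gal k x \<in> elts L.OK"
  by (auto simp: L.mem_OK algebraic_int_gal)

lemma OK_subset_L: "elts L.OK \<subseteq> L"
  by (auto simp: L.mem_OK)

lemma im_OK:
  assumes k: "coprime k p"
  shows "im k L.OK = L.OK"
proof -
  obtain l where l: "coprime l p" "k * l mod n = 1 mod n" using k by (rule obtain_inverse_mod)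
  have "gal k ` elts L.OK = elts L.OK"
  proof (intro equalityI subsetI)
    fix x assume x: "x \<in> elts L.OK"
    then have "x = gal k (gal l x)" using gal_inverse_gal(1)[OF k l] OK_subset_L by auto
    then show "x \<in> gal k ` elts L.OK" using gal_OK[OF l(1) x] by blast
  qed (use gal_OK[OF k] in auto)
  then show ?thesis by (simp add: elts_im[OF k OK_subset_L] elts_inject[symmetric])
qed

lemma im_1: "elts I \<subseteq> L \<Longrightarrow> im 1 I = I"
  by (rule zmod_eqI) (auto simp: elts_im gal_one subset_iff image_iff simp del: One_nat_def)

lemma L_ideal_image:
  assumes "coprime k p" "L.OK * I = I" "elts I \<subseteq> L"
  shows "L.OK * im k I = im k I"
  using im_mult[OF assms(1) OK_subset_L assms(3)] assms(1,2) by (simp add: im_OK)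

lemma im_frac_ideal:
  assumes k: "coprime k p" and I: "L.frac_ideal I"
  shows "L.frac_ideal (im k I)"
proof -
  note D = L.frac_idealD[OF I]
  obtain d where d: "d \<in> elts L.OK" "d \<noteq> 0" "pr d * I \<le> L.OK"
    using I by (auto simp: L.frac_ideal_def)
  have dL: "d \<in> L" using d(1) OK_subset_L by auto
  obtain x where x: "x \<in> elts I" "x \<noteq> 0" using L.frac_ideal_nonzero_elt[OF I] .
  have "gal k x \<noteq> 0" using x D(3) k by (auto simp: gal_eq_0_iff)
  then have "im k I \<noteq> 0" using x(1) elts_im[OF k D(3)] by (metis elts_zero imageI singletonD)
  moreover have "pr (gal k d) * im k I \<le> L.OK"
  proof (rule zmod_leI)
    fix u assume "u \<in> elts (pr (gal k d) * im k I)"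
    then obtain y where y: "y \<in> elts I" "u = gal k d * gal k y"
      using elts_im[OF k D(3)] by (auto simp: elts_pr_mult)
    then have "u = gal k (d * y)" using k dL D(3) by (auto simp: gal_simps)
    moreover have "d * y \<in> elts L.OK" using zmod_leD[OF d(3)] y(1) by (auto simp: elts_pr_mult)
    ultimately show "u \<in> elts L.OK" using gal_OK[OF k] by simp
  qed
  moreover have "gal k d \<in> elts L.OK" "gal k d \<noteq> 0" using d k dL by (auto simp: gal_OK gal_eq_0_iff)
  ultimately show ?thesis
    unfolding L.frac_ideal_def using L_ideal_image[OF k D(1) D(3)] im_subset_L[OF k D(3)] by blast
qed

end

section \<open>The quadratic subfield\<close>

context prime_power_cyclotomic
begin

lemma quadratic_field_generator:
  assumes F: "quadratic_field F" and FL: "F \<subseteq> L"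
  obtains w where "w \<in> F" "w \<notin> \<rat>" "w * w \<in> \<rat>" "algebraic_int w"
    "\<And>x. x \<in> F \<Longrightarrow> \<exists>a b. x = of_rat a + of_rat b * w"
proof -
  interpret F: number_field F using F by (simp add: number_field_def quadratic_field_def)
  have ring: "k \<otimes>\<^bsub>complex_ring\<^esub> v = k * v" for k v by simp
  have ext: "CR.line_extension \<rat> v E = {of_rat k * v + e | k e. e \<in> E}" for v E
  proof (intro equalityI subsetI)
    fix x assume "x \<in> CR.line_extension \<rat> v E"
    then obtain k e where "k \<in> \<rat>" "e \<in> E" "x = k * v + e"
      by (auto simp: CR.line_extension_def r_coset_def set_add_def')
    then show "x \<in> {of_rat k * v + e | k e. e \<in> E}" by (auto elim!: Rats_cases)
  next
    fix x assume "x \<in> {of_rat k * v + e | k e. e \<in> E}"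
    then obtain k e where "e \<in> E" "x = of_rat k * v + e" by blast
    then show "x \<in> CR.line_extension \<rat> v E"
      using Rats_of_rat[of k] by (auto simp: CR.line_extension_def r_coset_def set_add_def')
  qed
  have "CR.dimension 2 \<rat> F" using F by (simp add: quadratic_field_def)
  then have "\<exists>v E. F = CR.line_extension \<rat> v E \<and> v \<notin> E \<and> CR.dimension 1 \<rat> E"
    by (cases rule: CR.dimension.cases) (auto simp: numeral_2_eq_2)
  then obtain v E where v: "F = CR.line_extension \<rat> v E" "v \<notin> E" "CR.dimension 1 \<rat> E" by blast
  from v(3) have "\<exists>u E'. E = CR.line_extension \<rat> u E' \<and> u \<notin> E' \<and> CR.dimension 0 \<rat> E'"
    by (cases rule: CR.dimension.cases) auto
  then obtain u E' where u: "E = CR.line_extension \<rat> u E'" "u \<notin> E'" "CR.dimension 0 \<rat> E'" by blast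
  from u(3) have "E' = {0}" by (cases rule: CR.dimension.cases) auto
  with u have E: "E = {of_rat k * u | k. True}" "u \<noteq> 0" by (auto simp: ext)
  have Fe: "F = {of_rat k * v + of_rat l * u | k l. True}" unfolding v(1) ext E(1) by auto
  have "u = of_rat 0 * v + of_rat 1 * u" "v = of_rat 1 * v + of_rat 0 * u" by simp_all
  then have uF: "u \<in> F" and vF: "v \<in> F" unfolding Fe by blast+
  have not_sub: "\<not> F \<subseteq> \<rat>"
  proof
    assume "F \<subseteq> \<rat>"
    then have "v / u \<in> \<rat>" using uF vF by auto
    then obtain k where "v / u = of_rat k" by (elim Rats_cases)
    then have "v = of_rat k * u" using E(2) by (simp add: field_simps)
    then show False using v(2) E(1) by blast
  qed
  obtain k l where kl: "1 = of_rat k * v + of_rat l * u" using F.K_closed(2) Fe by auto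
  have "\<exists>w0\<in>F. \<forall>x\<in>F. \<exists>a b. x = of_rat a + of_rat b * w0"
  proof (cases "k = 0")
    case False
    have vk: "v = of_rat (1 / k) - of_rat (l / k) * u"
      using kl False by (simp add: of_rat_divide field_simps)
    have "of_rat a * v + of_rat b * u = of_rat (a / k) + of_rat (b - a * l / k) * u" for a b
      by (subst vk) (simp add: of_rat_divide of_rat_diff of_rat_mult algebra_simps)
    then show ?thesis using uF unfolding Fe by blast
  next
    case True
    then have l: "l \<noteq> 0" using kl by auto
    have "u = of_rat (1 / l)" using kl True l by (simp add: of_rat_divide field_simps)
    then have "of_rat a * v + of_rat b * u = of_rat (b / l) + of_rat a * v" for a b
      by (simp add: of_rat_divide algebra_simps)
    then show ?thesis using vF unfolding Fe by blast
  qed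
  then obtain w0 where w0: "w0 \<in> F" "\<And>x. x \<in> F \<Longrightarrow> \<exists>a b. x = of_rat a + of_rat b * w0" by blast
  obtain s t where st: "w0 * w0 = of_rat s + of_rat t * w0" using w0 by blast
  define w1 where "w1 = w0 - of_rat (t / 2)"
  have w1F: "w1 \<in> F" using w0(1) by (simp add: w1_def)
  have "w1 * w1 = of_rat (s + t * t / 4)"
    using st by (simp add: w1_def of_rat_divide of_rat_add of_rat_mult algebra_simps)
  then have w1sq: "w1 * w1 \<in> \<rat>" by simp
  obtain d :: int where d: "d > 0" "algebraic_int (of_int d * w1)"
    using L.common_denominator w1F FL by blast
  define w where "w = of_int d * w1"
  have gen: "\<exists>a b. x = of_rat a + of_rat b * w" if x: "x \<in> F" for x
  proof -
    obtain a b where ab: "x = of_rat a + of_rat b * w0" using w0(2)[OF x] by blast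
    have "w0 = of_rat (t / 2) + of_rat (1 / of_int d) * w"
      using d(1) by (simp add: w_def w1_def of_rat_divide)
    then have "x = of_rat (a + b * (t / 2)) + of_rat (b / of_int d) * w"
      unfolding ab by (simp add: of_rat_divide of_rat_add of_rat_mult algebra_simps)
    then show ?thesis by blast
  qed
  have "w \<in> F" using w1F by (simp add: w_def)
  moreover have "w \<notin> \<rat>"
  proof
    assume "w \<in> \<rat>"
    then have "F \<subseteq> \<rat>" using gen by (metis Rats_add Rats_mult Rats_of_rat subsetI)
    then show False using not_sub by blast
  qed
  moreover have "w * w = of_int d * of_int d * (w1 * w1)" by (simp add: w_def mult_ac)
  then have "w * w \<in> \<rat>" using w1sq by simp
  ultimately show thesis using that d(2) gen unfolding w_def[symmetric] by blast
qed

lemma sqrt_one_mod_n: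
  assumes "y * y mod n = 1 mod n"
  shows "y mod n = 1 mod n \<or> y mod n = (n - 1) mod n"
proof -
  have n1: "n > 1" using N_eq(5) by simp
  then have "y > 0" using assms by (cases y) auto
  then have sq: "(y - 1) * (y + 1) = y * y - 1" by (cases y) (auto simp: algebra_simps)
  have "n dvd y * y - 1" using assms \<open>y > 0\<close> by (subst mod_eq_dvd_iff_nat[symmetric]) auto
  then have dvd: "n dvd (y - 1) * (y + 1)" using sq by simp
  have "\<not> (p dvd y - 1 \<and> p dvd y + 1)"
  proof
    assume "p dvd y - 1 \<and> p dvd y + 1"
    then have "p dvd (y + 1) - (y - 1)" using dvd_diff_nat by blast
    then have "p dvd 2" using \<open>y > 0\<close> by simp
    then show False using p_gt_2 by (auto dest: dvd_imp_le)
  qed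
  then consider "coprime (y - 1) n" | "coprime (y + 1) n" by (auto simp: coprime_n coprime_p_iff)
  then show ?thesis
  proof cases
    case 1
    then have "n dvd y + 1" using dvd by (metis coprime_commute coprime_dvd_mult_right_iff)
    then obtain c where c: "y + 1 = n * c" by (elim dvdE)
    then have "c > 0" by (cases c) auto
    then have "y = (n - 1) + n * (c - 1)" using c n1 by (cases c) auto
    then show ?thesis by (metis mod_mult_self2)
  next
    case 2
    then have "n dvd y - 1" using dvd by (metis coprime_commute coprime_dvd_mult_left_iff)
    then show ?thesis using mod_eq_dvd_iff_nat[of 1 y n] \<open>y > 0\<close> by auto
  qed
qed

lemma half_N:
  assumes "p mod 4 = 3"
  shows "N = 2 * (N div 2)" "odd (N div 2)"
proof -
  obtain c where c: "p = 4 * c + 3" using assms by (metis mod_div_decomp mult.commute)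
  then have "p - 1 = 2 * (2 * c + 1)" by simp
  then have "N = 2 * (m * (2 * c + 1))" by (simp only: N_eq(1) mult.left_commute)
  moreover have "odd m" using odd_p by (simp add: m_def)
  ultimately show "N = 2 * (N div 2)" "odd (N div 2)" by simp_all
qed

text \<open>
  The character by which the Galois group acts on \<open>w\<close> is nontrivial. Since half the group order is
  odd, it takes the value -1 at an element of order 2, which has to be complex conjugation.
\<close>

lemma quadratic_subfield_imaginary:
  assumes p4: "p mod 4 = 3" and F: "quadratic_field F" and FL: "F \<subseteq> L"
  obtains w where "imaginary_quadratic_field F w"
proof -
  obtain w where w: "w \<in> F" "w \<notin> \<rat>" "w * w \<in> \<rat>" "algebraic_int w"
    "\<And>x. x \<in> F \<Longrightarrow> \<exists>a b. x = of_rat a + of_rat b * w"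
    by (rule quadratic_field_generator[OF F FL]) blast
  have wL: "w \<in> L" using w(1) FL by auto
  have gal_w: "gal k w = w \<or> gal k w = - w" if "coprime k p" for k
  proof -
    obtain s where "w * w = of_rat s" using w(3) by (elim Rats_cases)
    then have "gal k w * gal k w = w * w" using that wL gal_simps(3)[of k w w] gal_of_rat by simp
    then show ?thesis by (simp add: square_eq_iff)
  qed
  have "cnj w = - w"
  proof (rule ccontr)
    assume "cnj w \<noteq> - w"
    then have cw: "gal (n - 1) w = w" using gal_w[OF coprime_n_minus_1] gal_cnj[OF wL] by auto
    obtain k where k: "k \<in> T" "gal k w \<noteq> w" using fixed_imp_rat wL w(2) by blast
    then have kp: "coprime k p" and kw: "gal k w = - w" using gal_w by (auto simp: T_def)
    have pow: "coprime (k ^ j) p \<and> gal (k ^ j) w = (-1) ^ j * w" for j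
    proof (induction j)
      case 0
      show ?case using gal_one[OF wL] by simp
    next
      case (Suc j)
      then have "gal (k ^ Suc j) w = gal k ((-1) ^ j * w)" using kp wL gal_gal[of k "k ^ j" w] by simp
      also have "\<dots> = (-1) ^ Suc j * w"
        using kp wL kw by (cases "even j") (auto simp: gal_simps)
      finally show ?case using Suc kp by simp
    qed
    let ?y = "k ^ (N div 2)"
    have "?y * ?y = k ^ N" using half_N(1)[OF p4] by (metis power_add mult_2)
    moreover have "[k ^ totient n = 1] (mod n)"
      using kp by (intro euler_theorem) (simp add: coprime_n)
    ultimately have "?y * ?y mod n = 1 mod n" by (simp add: totient_n cong_def)
    then have "gal ?y w = gal 1 w \<or> gal ?y w = gal (n - 1) w"
      using sqrt_one_mod_n gal_cong by metis
    then have "gal ?y w = w" using cw gal_one[OF wL] by auto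
    moreover have "gal ?y w = - w" using pow half_N(2)[OF p4] by simp
    ultimately have "w = 0" by simp
    then show False using w(2) by simp
  qed
  moreover have "w \<noteq> 0" using w(2) by auto
  ultimately have "imaginary_quadratic_field F w"
    using F w by (intro imaginary_quadratic_field.intro imaginary_quadratic_field_axioms.intro number_field.intro)
      (auto simp: quadratic_field_def)
  then show thesis by (rule that)
qed

end

locale cyclotomic_quadratic =
  prime_power_cyclotomic p r \<zeta> + imaginary_quadratic_field F w for p r \<zeta> F w +
  assumes p_mod_4: "p mod 4 = 3" and F_subset_L: "F \<subseteq> cyclotomic_field \<zeta>"
begin

lemma w_in_L: "w \<in> L"
  using w_in_F F_subset_L by auto

definition H :: "nat set" where "H = {k \<in> T. gal k w = w}"

lemma H_T: "k \<in> H \<Longrightarrow> k \<in> T" and H_coprime: "k \<in> H \<Longrightarrow> coprime k p" and finite_H: "finite H"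
  by (auto simp: H_def T_def)

lemma gal_w: "coprime k p \<Longrightarrow> gal k w = w \<or> gal k w = - w"
proof -
  assume k: "coprime k p"
  obtain D :: int where D: "w * w = - of_int D" by (rule w_sq)
  then have D': "w * w = of_int (- D)" by simp
  have "gal k (w * w) = w * w" unfolding D' by (rule gal_of_int[OF k])
  then have "gal k w * gal k w = w * w" using k w_in_L gal_simps(3)[of k w w] by simp
  then show ?thesis by (simp add: square_eq_iff)
qed

lemma gal_minus:
  assumes "k \<in> T" "x \<in> L"
  shows "n - k \<in> T" "gal (n - k) x = cnj (gal k x)" "gal (n - k) x = gal k (cnj x)"
proof -
  have k: "k < n" "coprime k p" using assms(1) by (auto simp: T_def)
  then have k0: "k > 0" using coprime_p_iff by (intro gr0I) auto
  have eq: "(n - 1) * k mod n = (n - k) mod n"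
  proof -
    have "(n - 1) * k = (n - k) + n * (k - 1)"
      using k(1) k0 by (simp add: diff_mult_distrib diff_mult_distrib2)
    then show ?thesis by (simp only: mod_mult_self2)
  qed
  have "coprime ((n - 1) * k) p" using k(2) coprime_n_minus_1 by simp
  then have "coprime ((n - 1) * k) n" by (simp only: coprime_n)
  then have "coprime ((n - 1) * k mod n) n" using N_eq(5) by (subst coprime_mod_left_iff) auto
  then have "coprime (n - k) n" using k0 N_eq(5) by (simp only: eq) simp
  then show "n - k \<in> T" using k0 N_eq(5) by (simp add: T_def coprime_n)
  show "gal (n - k) x = cnj (gal k x)"
    using gal_gal[OF coprime_n_minus_1 k(2) assms(2)] gal_cong[OF eq, of x] gal_cnj[of "gal k x"] k(2) assms(2)
    by simp
  show "gal (n - k) x = gal k (cnj x)"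
    using gal_gal[OF k(2) coprime_n_minus_1 assms(2)] gal_cong[OF eq, of x] gal_cnj[OF assms(2)]
    by (simp add: mult.commute)
qed

lemma H_minus: "k \<in> T \<Longrightarrow> n - k \<in> H \<longleftrightarrow> k \<notin> H"
  using gal_minus[OF _ w_in_L, of k] gal_w[of k] w_ne_0 cnj_w by (auto simp: H_def T_coprime)

lemma card_H: "card H = N div 2" "N div 2 > 0"
proof -
  have inj: "inj_on (\<lambda>k. n - k) H"
    by (rule inj_onI) (auto simp: H_def T_def)
  have "T = H \<union> (\<lambda>k. n - k) ` H"
  proof (intro equalityI subsetI)
    fix k assume k: "k \<in> T"
    show "k \<in> H \<union> (\<lambda>k. n - k) ` H"
    proof (cases "k \<in> H")
      case False
      then have "n - k \<in> H" using H_minus[OF k] by simp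
      moreover have "k = n - (n - k)" using k by (simp add: T_def)
      ultimately show ?thesis by blast
    qed simp
  qed (use H_T gal_minus(1)[OF _ w_in_L] in auto)
  moreover have "H \<inter> (\<lambda>k. n - k) ` H = {}" using H_minus H_T by auto
  ultimately have "card T = card H + card H"
    using finite_H by (metis card_Un_disjoint card_image finite_imageI inj)
  then show "card H = N div 2" by (simp add: card_T)
  show "N div 2 > 0" using half_N(2)[OF p_mod_4] by (intro gr0I) auto
qed

lemma gal_H_F:
  assumes "k \<in> H" "x \<in> F"
  shows "gal k x = x"
proof -
  obtain a b where "x = of_rat a + of_rat b * w" using F_elt assms(2) by blast
  moreover have "gal k (of_rat a + of_rat b * w) = of_rat a + of_rat b * w"
    using assms(1) H_coprime w_in_L by (simp add: gal_simps gal_of_rat H_def)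
  ultimately show ?thesis by simp
qed

lemma F_if_fixed:
  assumes x: "x \<in> L" and fixed: "\<And>k. k \<in> H \<Longrightarrow> gal k x = x"
  shows "x \<in> F"
proof -
  have rat: "y \<in> \<rat>" if y: "y \<in> L" "cnj y = y" "\<And>k. k \<in> H \<Longrightarrow> gal k y = y" for y
  proof (rule fixed_imp_rat[OF y(1)])
    fix k assume k: "k \<in> T"
    show "gal k y = y"
    proof (cases "k \<in> H")
      case False
      then have "n - k \<in> H" using H_minus[OF k] by simp
      then have "gal k (cnj y) = y" using gal_minus(3)[OF k y(1)] y(3) by metis
      then show ?thesis by (simp add: y(2))
    qed (rule y(3))
  qed
  have cx: "gal k (cnj x) = cnj x" if k: "k \<in> H" for k
    using gal_minus(2,3)[OF H_T[OF k] x] fixed[OF k] by simp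
  have half: "gal k (1 / 2) = 1 / 2" if "coprime k p" for k
    using gal_of_rat[OF that, of "1/2"] by (simp add: of_rat_divide)
  have hL: "1 / 2 \<in> L" by simp
  define y where "y = 1 / 2 * (x + cnj x)"
  define z where "z = 1 / 2 * ((x - cnj x) * inverse w)"
  have "y \<in> \<rat>"
  proof (rule rat)
    show "y \<in> L" using x by (simp add: y_def)
    show "cnj y = y" by (simp add: y_def add.commute)
    show "gal k y = y" if k: "k \<in> H" for k
      using k H_coprime[OF k] x hL fixed[OF k] cx[OF k] unfolding y_def by (simp add: gal_simps half del: times_divide_eq_left)
  qed
  moreover have "z \<in> \<rat>"
  proof (rule rat)
    show "z \<in> L" using x w_in_L by (simp add: z_def)
    show "cnj z = z" using w_ne_0 by (simp add: z_def cnj_w field_simps)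
    show "gal k z = z" if k: "k \<in> H" for k
    proof -
      have "gal k (inverse w) = inverse w" using gal_inverse[OF H_coprime[OF k] w_in_L] k by (simp add: H_def)
      then show ?thesis
        using k H_coprime[OF k] x hL w_in_L fixed[OF k] cx[OF k] unfolding z_def
        by (simp add: gal_simps half del: times_divide_eq_left)
    qed
  qed
  moreover have "x = y + z * w" using w_ne_0 by (simp add: y_def z_def field_simps)
  ultimately show ?thesis using w_in_F by (auto elim!: Rats_cases)
qed

definition nm :: "complex \<Rightarrow> complex" where "nm x = (\<Prod>h\<in>H. gal h x)"

lemma nm_in_F:
  assumes x: "x \<in> L"
  shows "nm x \<in> F"
proof (rule F_if_fixed)
  show "nm x \<in> L" unfolding nm_def using x H_coprime by (intro L.K_prod) auto
  fix k assume k: "k \<in> H"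
  let ?f = "\<lambda>h. k * h mod n"
  have kp: "coprime k p" using H_coprime k by blast
  have fH: "?f h \<in> H" if h: "h \<in> H" for h
  proof -
    have hp: "coprime h p" using H_coprime h by blast
    have "coprime (k * h) n" using kp hp by (simp add: coprime_n)
    then have "coprime (?f h) n" using N_eq(5) by (subst coprime_mod_left_iff) auto
    then have "?f h \<in> T" using N_eq(5) by (simp add: T_def coprime_n)
    moreover have "gal (?f h) w = w"
      using gal_cong[of "?f h" "k * h" w] gal_gal[OF kp hp w_in_L] h k by (simp add: H_def)
    ultimately show ?thesis by (simp add: H_def)
  qed
  have "inj_on ?f H"
  proof (rule inj_onI)
    fix a b assume ab: "a \<in> H" "b \<in> H" "?f a = ?f b"
    then have "[k * a = k * b] (mod n)" by (simp add: cong_def)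
    then have "[a = b] (mod n)" using kp by (simp add: cong_mult_lcancel_nat coprime_n)
    then show "a = b" using ab H_T by (auto simp: cong_def T_def)
  qed
  then have bij: "bij_betw ?f H H"
    using fH finite_H by (metis bij_betw_def endo_inj_surj image_subsetI)
  have "gal k (nm x) = (\<Prod>h\<in>H. gal k (gal h x))"
    unfolding nm_def using kp x H_coprime by (intro gal_prod) auto
  also have "\<dots> = (\<Prod>h\<in>H. gal (?f h) x)"
  proof (intro prod.cong refl)
    fix h assume "h \<in> H"
    then have "gal k (gal h x) = gal (k * h) x" using gal_gal[OF kp _ x] H_coprime by blast
    also have "\<dots> = gal (?f h) x" by (rule gal_cong) simp
    finally show "gal k (gal h x) = gal (?f h) x" .
  qed
  also have "\<dots> = nm x"
    unfolding nm_def by (rule prod.reindex_bij_betw[OF bij])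
  finally show "gal k (nm x) = nm x" .
qed

lemma nm_ne_0: "x \<in> L \<Longrightarrow> x \<noteq> 0 \<Longrightarrow> nm x \<noteq> 0"
  using H_coprime finite_H by (auto simp: nm_def gal_eq_0_iff)

definition Nm :: "zmod \<Rightarrow> zmod" where "Nm J = (\<Prod>h\<in>H. im h J)"

lemma Nm_mult: "elts I \<subseteq> L \<Longrightarrow> elts J \<subseteq> L \<Longrightarrow> Nm (I * J) = Nm I * Nm J"
  using H_coprime by (simp add: Nm_def im_mult flip: prod.distrib)

lemma OK_power: "k > 0 \<Longrightarrow> L.OK ^ k = L.OK"
proof (induction k)
  case (Suc k)
  then show ?case by (cases k) (auto simp: L.OK_OK)
qed simp

lemma Nm_OK: "Nm L.OK = L.OK"
  using H_coprime card_H by (simp add: Nm_def im_OK OK_power)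

lemma Nm_pr_mult:
  assumes "a \<in> L" "elts I \<subseteq> L"
  shows "Nm (pr a * I) = pr (nm a) * Nm I"
  using assms H_coprime by (simp add: Nm_def nm_def pr_prod im_pr_mult flip: prod.distrib)

lemma Nm_extension:
  assumes "elts I \<subseteq> F"
  shows "Nm (I * L.OK) = I ^ (N div 2) * L.OK"
proof -
  have IL: "elts I \<subseteq> L" using assms F_subset_L by auto
  have "im h I = I" if h: "h \<in> H" for h
    using gal_H_F[OF h] assms
    by (intro zmod_eqI) (auto simp: elts_im[OF H_coprime[OF h] IL] image_iff subset_iff)
  then have "Nm I = I ^ card H" by (simp add: Nm_def)
  then show ?thesis using Nm_mult[OF IL OK_subset_L] by (simp add: Nm_OK card_H)
qed

lemma OK_F_le_OK_L: "OK \<le> L.OK"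
  using F_subset_L by (auto intro!: zmod_leI simp: mem_OK L.mem_OK)

lemma OK_mult_OK_L: "OK * L.OK = L.OK"
proof (rule antisym)
  show "OK * L.OK \<le> L.OK" using zmod_mult_mono[OF OK_F_le_OK_L, of L.OK L.OK] by (simp add: L.OK_OK)
  show "L.OK \<le> OK * L.OK" by (rule le_OK_mult)
qed

lemma extension_frac_ideal:
  assumes I: "frac_ideal I"
  shows "L.frac_ideal (I * L.OK)"
proof -
  obtain d where d: "d \<in> elts OK" "d \<noteq> 0" "pr d * I \<le> OK"
    using I by (auto simp: frac_ideal_def)
  have "pr d * (I * L.OK) \<le> OK * L.OK" using zmod_mult_mono[OF d(3), of L.OK L.OK] by (simp add: mult.assoc)
  then have "pr d * (I * L.OK) \<le> L.OK" by (simp add: OK_mult_OK_L)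
  moreover have "d \<in> elts L.OK" using zmod_leD[OF OK_F_le_OK_L d(1)] .
  moreover have "I * L.OK \<noteq> 0"
    using frac_idealD(4)[OF I] L.frac_idealD(4)[OF L.frac_ideal_OK] by (rule zmod_mult_ne_0)
  moreover have "elts (I * L.OK) \<subseteq> L"
    using frac_idealD(3)[OF I] F_subset_L OK_subset_L by (intro L.zmod_mult_subset_K) auto
  moreover have "L.OK * (I * L.OK) = I * L.OK" by (simp only: L.OK_OK mult.left_commute[of L.OK])
  ultimately show ?thesis unfolding L.frac_ideal_def using d(2) by blast
qed

lemma contract_principal:
  assumes I: "frac_ideal I" and b: "b \<in> F" "b \<noteq> 0" and eq: "I * L.OK = pr b * L.OK"
  shows "I = pr b * OK"
proof -
  obtain I' where I': "frac_ideal I'" "I * I' = OK" using frac_ideal_inverse[OF I] .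
  define J where "J = pr (inverse b) * I"
  define J' where "J' = pr b * I'"
  have "J * J' = pr (inverse b) * (pr b * (I * I'))" by (simp add: J_def J'_def mult_ac)
  then have JJ': "J * J' = OK" by (simp add: pr_inverse_mult(2)[OF b(2)] I'(2))
  have JL: "J * L.OK = L.OK"
    using pr_inverse_mult(2)[OF b(2), of L.OK] eq by (simp add: J_def mult.assoc)
  have "J' * L.OK = J' * (J * L.OK)" by (simp add: JL)
  also have "\<dots> = OK * L.OK" by (simp add: JJ' mult.assoc[symmetric] mult.commute[of J'])
  finally have J'L: "J' * L.OK = L.OK" by (simp add: OK_mult_OK_L)
  have le: "A \<le> OK" if A: "elts A \<subseteq> F" "A * L.OK = L.OK" for A
  proof (rule zmod_leI)
    fix x assume x: "x \<in> elts A"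
    then have "x * 1 \<in> elts (A * L.OK)" by (intro elts_mult) (auto simp: L.mem_OK)
    then show "x \<in> elts OK" using A x by (auto simp: mem_OK L.mem_OK)
  qed
  have JF: "elts J \<subseteq> F" "elts J' \<subseteq> F"
    using b frac_idealD(3)[OF I] frac_idealD(3)[OF I'(1)] by (auto simp: J_def J'_def elts_pr_mult)
  have "J \<le> OK" "J' \<le> OK" using le JF JL J'L by auto
  then have "OK \<le> J * OK" using zmod_mult_mono[of J J J' OK] JJ' by simp
  also have "J * OK = J" using frac_idealD(2)[OF I] by (simp add: J_def mult.assoc)
  finally have "J = OK" using \<open>J \<le> OK\<close> by simp
  then show ?thesis using pr_inverse_mult(1)[OF b(2), of I] by (simp add: J_def)
qed

end

section \<open>Primes of residue degree two\<close>

lemma int_poly_prime_dvd_coeff: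
  fixes g :: "int poly"
  assumes "Factorial_Ring.prime q" "k \<le> q" "degree g < k \<or> g = 0" "\<And>j. j < k \<Longrightarrow> int q dvd poly g (int j)"
  shows "int q dvd coeff g i"
  using assms(2-)
proof (induction k arbitrary: g i)
  case (Suc k)
  define h where "h = synthetic_div g (int k)"
  have g: "g = [:- int k, 1:] * h + [:poly g (int k):]"
    unfolding h_def using synthetic_div_correct'[of "int k" g] by simp
  have deg: "degree h < k \<or> h = 0"
    using Suc.prems(2) unfolding h_def
    by (cases "degree g = 0") (auto simp: degree_synthetic_div synthetic_div_eq_0_iff)
  have dvd_h: "int q dvd poly h (int j)" if "j < k" for j
  proof -
    have "poly g (int j) = poly ([:- int k, 1:] * h + [:poly g (int k):]) (int j)"
      using g by simp
    then have "(int j - int k) * poly h (int j) = poly g (int j) - poly g (int k)"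
      by (simp add: algebra_simps)
    then have "int q dvd (int j - int k) * poly h (int j)"
      using Suc.prems(3) that by (metis dvd_diff less_SucI lessI)
    moreover have "\<not> int q dvd int j - int k"
    proof
      assume "int q dvd int j - int k"
      then have "int q dvd int k - int j" by (simp add: dvd_diff_commute)
      then have "int q \<le> int k - int j" using that by (intro zdvd_imp_le) auto
      then show False using Suc.prems(1) by simp
    qed
    ultimately show ?thesis using assms(1) prime_dvd_mult_iff[of "int q"] by simp
  qed
  have "int q dvd coeff h i" for i
    using Suc.IH[OF _ deg dvd_h] Suc.prems(1) by simp
  then have "int q dvd coeff ([:- int k, 1:] * h) i" for i
    by (cases i) (auto simp: coeff_pCons)
  moreover have "int q dvd coeff [:poly g (int k):] i"
    using Suc.prems(3)[of k] by (cases i) auto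
  ultimately show ?case by (subst g) (simp only: coeff_add dvd_add)
qed simp

lemma prod_minus_residues:
  assumes q: "Factorial_Ring.prime (q::nat)" and t: "algebraic_int t"
  shows "(\<Prod>j<q. t - of_nat j) - (t ^ q - t) \<in> elts (pr (of_nat q) * AI)"
proof -
  have q1: "q > 1" using q by (rule prime_gt_1_nat)
  define g0 where "g0 = (\<Prod>j<q. [:- int j, 1:])"
  define g where "g = g0 - monom 1 q + monom 1 1"
  have deg0: "degree g0 = q" unfolding g0_def by (subst degree_prod_eq_sum_degree) auto
  have lead0: "coeff g0 q = 1" using deg0 lead_coeff_prod[of "\<lambda>j. [:- int j, 1:]" "{..<q}"]
    by (simp add: g0_def)
  have "degree (g0 - monom 1 q) < q"
  proof -
    have "degree (g0 - monom 1 q) \<le> q" using deg0 by (intro degree_diff_le) (auto simp: degree_monom_eq)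
    moreover have "coeff (g0 - monom 1 q) q = 0" using lead0 by simp
    ultimately show ?thesis
      using q1 leading_coeff_neq_0[of "g0 - monom 1 q"] by (cases "g0 - monom 1 q = 0") (auto simp: order_less_le)
  qed
  then have deg: "degree g < q"
    unfolding g_def using q1 by (intro degree_add_less) (auto simp: degree_monom_eq)
  have "int q dvd poly g (int j)" if "j < q" for j
  proof -
    have "poly g0 (int j) = 0" using that by (auto simp: g0_def poly_prod)
    then have eq: "poly g (int j) = - (int j ^ q - int j)" by (simp add: g_def poly_monom)
    obtain a where a: "algebraic_int a" "of_int (int j) ^ q - of_int (int j) = of_nat q * (a :: complex)"
      using fermat_AI[OF q, of "int j"] unfolding elts_pr_AI by blast
    have "a = of_int (int j ^ q - int j) / of_int (int q)" using a(2) q1 by (simp add: field_simps)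
    then have "a \<in> \<rat>" by (metis Rats_divide Rats_of_int)
    then obtain c where "a = of_int c" using a(1) rational_algebraic_int_is_int by (metis Ints_cases)
    then have "(of_int (int j ^ q - int j) :: complex) = of_int (int q * c)" using a(2) by simp
    then have "int j ^ q - int j = int q * c" by (simp only: of_int_eq_iff)
    then show ?thesis unfolding eq by simp
  qed
  then have "\<forall>i. int q dvd coeff g i"
    using int_poly_prime_dvd_coeff[OF q le_refl, of g] deg by blast
  then have "[:int q:] dvd g" by (simp add: const_poly_dvd_iff)
  then obtain h where "g = smult (int q) h" by (auto elim: dvdE)
  then have "evi g t = of_nat q * evi h t" by simp
  moreover have "evi g0 t = (\<Prod>j<q. t - of_nat j)"
  proof -
    have "evi (\<Prod>j\<in>A. [:- int j, 1:]) t = (\<Prod>j\<in>A. t - of_nat j)" if "finite A" for A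
      using that by (induction A) (auto simp: algebra_simps)
    then show ?thesis by (simp add: g0_def)
  qed
  then have "evi g t = (\<Prod>j<q. t - of_nat j) - (t ^ q - t)" by (simp add: g_def)
  ultimately show ?thesis unfolding elts_pr_AI using algebraic_int_evi[OF t] by metis
qed

lemma int_poly_root_dvd:
  assumes "B \<noteq> 0" "evi B x = 0" "x \<noteq> 0"
  shows "\<exists>c B'. c \<noteq> 0 \<and> of_int c = x * evi B' x"
  using assms(1,2)
proof (induction B)
  case (pCons c B)
  show ?case
  proof (cases "c = 0")
    case True
    then show ?thesis using pCons assms(3) by auto
  next
    case False
    have "of_int c = x * evi (- B) x" using pCons.prems(2) by (simp add: add_eq_0_iff2)
    then show ?thesis using False by blast
  qed
qed simp

locale cyclotomic_prime = prime_power_cyclotomic +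
  fixes P :: "complex set"
  assumes primeideal_P: "primeideal P (integer_ring (cyclotomic_field \<zeta>))" and P_ne_0: "P \<noteq> {0}"
begin

abbreviation R :: "complex ring" where "R \<equiv> integer_ring L"

lemma R_simps [simp]:
  "carrier R = elts L.OK" "monoid.mult R = (*)" "monoid.one R = 1" "ring.zero R = 0" "add R = (+)"
  by (simp_all add: integer_ring_def L.elts_OK)

lemma R_minus: "x \<in> elts L.OK \<Longrightarrow> a_inv R x = - x"
proof -
  interpret P: primeideal P R by (rule primeideal_P)
  show "x \<in> elts L.OK \<Longrightarrow> a_inv R x = - x"
    using P.minus_equality[of "- x" x] by auto
qed

lemma P_OK: "x \<in> P \<Longrightarrow> x \<in> elts L.OK"
  and P_0: "0 \<in> P" and P_add: "x \<in> P \<Longrightarrow> y \<in> P \<Longrightarrow> x + y \<in> P"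
  and P_mult: "a \<in> elts L.OK \<Longrightarrow> x \<in> P \<Longrightarrow> a * x \<in> P"
  and P_prime: "a \<in> elts L.OK \<Longrightarrow> b \<in> elts L.OK \<Longrightarrow> a * b \<in> P \<Longrightarrow> a \<in> P \<or> b \<in> P"
  and one_notin_P: "1 \<notin> P"
proof -
  interpret P: primeideal P R by (rule primeideal_P)
  show "x \<in> P \<Longrightarrow> x \<in> elts L.OK" using P.a_subset by auto
  show "0 \<in> P" using additive_subgroup.zero_closed[OF P.additive_subgroup_axioms] by simp
  show "x \<in> P \<Longrightarrow> y \<in> P \<Longrightarrow> x + y \<in> P"
    using additive_subgroup.a_closed[OF P.additive_subgroup_axioms, of x y] by simp
  show "a \<in> elts L.OK \<Longrightarrow> x \<in> P \<Longrightarrow> a * x \<in> P" using P.I_l_closed[of x a] by simp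
  show "a \<in> elts L.OK \<Longrightarrow> b \<in> elts L.OK \<Longrightarrow> a * b \<in> P \<Longrightarrow> a \<in> P \<or> b \<in> P"
    using P.I_prime[of a b] by simp
  show "1 \<notin> P" using P.one_imp_carrier P.I_notcarr by auto
qed

lemma OK_of_int [simp]: "of_int k \<in> elts L.OK" "of_nat j \<in> elts L.OK" "1 \<in> elts L.OK"
  by (auto simp: L.mem_OK)

lemma OK_zeta: "\<zeta> ^ i \<in> elts L.OK"
  using algebraic_int_zeta by (auto simp: L.mem_OK intro: algebraic_int_power)

lemma OK_mult: "x \<in> elts L.OK \<Longrightarrow> y \<in> elts L.OK \<Longrightarrow> x * y \<in> elts L.OK"
  using elts_mult[of x L.OK y L.OK] by (simp add: L.OK_OK)

lemma OK_power: "x \<in> elts L.OK \<Longrightarrow> x ^ k \<in> elts L.OK"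
  by (induction k) (auto intro: OK_mult)

lemma OK_evi: "x \<in> elts L.OK \<Longrightarrow> evi B x \<in> elts L.OK"
  by (induction B) (auto intro!: elts_add OK_mult)

lemma P_minus: "x \<in> P \<Longrightarrow> - x \<in> P"
  using P_mult[of "-1" x] by (simp add: elts_minus)

lemma P_diff: "x \<in> P \<Longrightarrow> y \<in> P \<Longrightarrow> x - y \<in> P"
  using P_add[of x "- y"] P_minus by simp

lemma P_mult_right: "x \<in> P \<Longrightarrow> a \<in> elts L.OK \<Longrightarrow> x * a \<in> P"
  using P_mult by (simp add: mult.commute)

lemma P_prod:
  "finite A \<Longrightarrow> (\<And>i. i \<in> A \<Longrightarrow> f i \<in> elts L.OK) \<Longrightarrow> prod f A \<in> P \<Longrightarrow> \<exists>i\<in>A. f i \<in> P"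
proof (induction A rule: finite_induct)
  case empty
  then show ?case using one_notin_P by simp
next
  case (insert a A)
  have "prod f A \<in> elts L.OK"
    using insert by (auto simp: L.mem_OK intro!: algebraic_int_prod L.K_prod)
  then show ?case using insert P_prime[of "f a" "prod f A"] by auto
qed

definition JP :: zmod where "JP = Zmod P"

lemma elts_JP: "elts JP = P"
  unfolding JP_def by (rule elts_Zmod) (auto simp: zm_subspace_iff P_0 P_add P_minus)

lemma OK_JP: "L.OK * JP = JP"
  by (rule L.OK_mult_eqI) (auto simp: zmod_mult_le_iff elts_JP P_mult)

lemma JP_le_OK: "JP \<le> L.OK"
  by (rule zmod_leI) (simp add: elts_JP P_OK)

lemma JP_subset_L: "elts JP \<subseteq> L"
  using P_OK OK_subset_L by (auto simp: elts_JP)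

lemma frac_ideal_JP: "L.frac_ideal JP"
proof -
  have "JP \<noteq> 0" using P_ne_0 elts_JP by (metis elts_zero)
  then show ?thesis unfolding L.frac_ideal_def using OK_JP JP_subset_L JP_le_OK
    by (auto intro!: bexI[of _ 1] simp: pr_1)
qed

lemma coprime_in_P_contr: "of_int a \<in> P \<Longrightarrow> of_int b \<in> P \<Longrightarrow> coprime a b \<Longrightarrow> False"
proof -
  assume ab: "of_int a \<in> P" "of_int b \<in> P" "coprime a b"
  obtain u v where "u * a + v * b = 1" using ab(3) by (metis coprime_iff_gcd_eq_1 bezout_int)
  then have "(1 :: complex) = of_int u * of_int a + of_int v * of_int b"
    by (metis of_int_1 of_int_add of_int_mult)
  also have "\<dots> \<in> P" using ab by (intro P_add P_mult) auto
  finally show False using one_notin_P by blast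
qed

lemma ex_prime_in_P:
  obtains q where "Factorial_Ring.prime q" "of_nat q \<in> P"
proof -
  obtain x where x: "x \<in> P" "x \<noteq> 0" using P_0 P_ne_0 by blast
  have "algebraic_int x" using P_OK[OF x(1)] by (simp add: L.mem_OK)
  then obtain B where B: "evi B x = 0" "lead_coeff B = 1"
    unfolding algebraic_int_altdef_ipoly evi_def by blast
  then have "B \<noteq> 0" by auto
  then obtain c B' where c: "c \<noteq> 0" "of_int c = x * evi B' x"
    using int_poly_root_dvd B(1) x(2) by blast
  have "of_int c \<in> P" unfolding c(2) using x(1) P_OK[OF x(1)] by (intro P_mult_right OK_evi)
  then have "of_nat (nat \<bar>c\<bar>) \<in> P" using P_minus by (cases "c \<ge> 0") auto
  moreover have "nat \<bar>c\<bar> > 0" using c(1) by simp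
  moreover have "\<exists>q. Factorial_Ring.prime q \<and> of_nat q \<in> P" if "k > 0" "of_nat k \<in> P" for k :: nat
    using that
  proof (induction k rule: less_induct)
    case (less k)
    have "k \<noteq> 1" using less.prems one_notin_P by auto
    then obtain q where q: "Factorial_Ring.prime q" "q dvd k" by (metis prime_factor_nat)
    then obtain j where j: "k = q * j" by (elim dvdE)
    then have "of_nat q \<in> P \<or> of_nat j \<in> P" using less.prems(2) P_prime[of "of_nat q" "of_nat j"] by simp
    moreover have "j < k" "j > 0" using j less.prems(1) prime_gt_1_nat[OF q(1)] by auto
    ultimately show ?case using less.IH q(1) by blast
  qed
  ultimately show thesis using that by blast
qed

lemma residue_degree_two:
  assumes deg: "residue_degree L \<rat> P = 2"
  shows "\<exists>a b. \<zeta> * \<zeta> - (of_int b * \<zeta> + of_int a) \<in> P"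
    and "\<exists>x\<in>elts L.OK. \<forall>a::int. x - of_int a \<notin> P"
proof -
  interpret P: primeideal P R by (rule primeideal_P)
  interpret Q: domain "R Quot P" by (rule P.quotient_is_domain)
  let ?cl = "\<lambda>x. P +>\<^bsub>R\<^esub> x"
  interpret h: ring_hom_ring R "R Quot P" ?cl by (rule P.rcos_ring_hom_ring)
  have zeroQ: "\<zero>\<^bsub>R Quot P\<^esub> = P" by (simp add: FactRing_def)
  have cl_0: "?cl x = P \<longleftrightarrow> x \<in> P" if "x \<in> elts L.OK" for x
    using that P.a_rcos_const[of x] P.a_rcos_self[of x] by auto
  have cl_add: "?cl (x + y) = ?cl x \<oplus>\<^bsub>R Quot P\<^esub> ?cl y" if "x \<in> elts L.OK" "y \<in> elts L.OK" for x y
    using h.hom_add[of x y] that by simp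
  have cl_mult: "?cl (x * y) = ?cl x \<otimes>\<^bsub>R Quot P\<^esub> ?cl y" if "x \<in> elts L.OK" "y \<in> elts L.OK" for x y
    using h.hom_mult[of x y] that by simp
  have cl_eqD: "x - y \<in> P" if "x \<in> elts L.OK" "y \<in> elts L.OK" "?cl x = ?cl y" for x y
  proof -
    have "?cl (x - y) \<oplus>\<^bsub>R Quot P\<^esub> ?cl y = ?cl x"
      using cl_add[of "x - y" y] that(1,2) by (simp add: elts_diff)
    then have "?cl (x - y) \<oplus>\<^bsub>R Quot P\<^esub> ?cl y = \<zero>\<^bsub>R Quot P\<^esub> \<oplus>\<^bsub>R Quot P\<^esub> ?cl y"
      using that(3) h.hom_closed[of y] that(2) by simp
    then have "?cl (x - y) = \<zero>\<^bsub>R Quot P\<^esub>"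
      using that(1,2) h.hom_closed elts_diff by (subst (asm) Q.add.right_cancel) auto
    then show ?thesis using cl_0[of "x - y"] that(1,2) elts_diff zeroQ by auto
  qed
  have cl_eqI: "?cl x = ?cl y" if "x \<in> elts L.OK" "y \<in> elts L.OK" "x - y \<in> P" for x y
  proof -
    have "?cl x = ?cl (x - y) \<oplus>\<^bsub>R Quot P\<^esub> ?cl y"
      using cl_add[of "x - y" y] that(1,2) by (simp add: elts_diff)
    also have "?cl (x - y) = \<zero>\<^bsub>R Quot P\<^esub>" using cl_0[of "x - y"] that elts_diff zeroQ by auto
    finally show ?thesis using h.hom_closed[of y] that(2) by simp
  qed
  have carrQ: "carrier (R Quot P) = ?cl ` elts L.OK"
    by (auto simp: FactRing_def A_RCOSETS_def')
  have intQ: "integers_of \<rat> = \<int>"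
    using rational_algebraic_int_is_int by (auto simp: integers_of_def elim!: Ints_cases)
  define K0 where "K0 = ?cl ` \<int>"
  have subZ: "subring \<int> R"
    by (rule P.subringI) (auto simp: R_minus elim!: Ints_cases intro: Ints_minus)
  have subK0: "subring K0 (R Quot P)" unfolding K0_def by (rule h.img_is_subring[OF subZ])
  obtain q where q: "Factorial_Ring.prime q" "of_nat q \<in> P" by (rule ex_prime_in_P)
  have one_zero: "\<one>\<^bsub>R Quot P\<^esub> \<noteq> \<zero>\<^bsub>R Quot P\<^esub>" by simp
  have K0_field: "subfield K0 (R Quot P)"
  proof (rule Q.subfieldI)
    show "subcring K0 (R Quot P)"
      using Q.subcringI[OF subK0] Q.m_comm subringE(1)[OF subK0] by auto
    show "Units ((R Quot P)\<lparr>carrier := K0\<rparr>) = K0 - {\<zero>\<^bsub>R Quot P\<^esub>}"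
    proof (intro equalityI subsetI)
      fix u assume u: "u \<in> Units ((R Quot P)\<lparr>carrier := K0\<rparr>)"
      then have "u \<in> K0" "\<exists>v\<in>K0. v \<otimes>\<^bsub>R Quot P\<^esub> u = \<one>\<^bsub>R Quot P\<^esub>" by (auto simp: Units_def)
      then show "u \<in> K0 - {\<zero>\<^bsub>R Quot P\<^esub>}" using one_zero subringE(1)[OF subK0] by auto
    next
      fix u assume u: "u \<in> K0 - {\<zero>\<^bsub>R Quot P\<^esub>}"
      then obtain a where a: "u = ?cl (of_int a)" by (auto simp: K0_def elim!: Ints_cases)
      then have "of_int a \<notin> P" using u cl_0 zeroQ by auto
      have "\<not> int q dvd a"
      proof
        assume "int q dvd a"
        then obtain c where "a = int q * c" by (elim dvdE)
        then show False using \<open>of_int a \<notin> P\<close> P_mult_right[OF q(2), of "of_int c"] by simp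
      qed
      then have "coprime (int q) a" using q(1) by (intro prime_imp_coprime) auto
      then obtain s t where st: "s * int q + t * a = 1" by (metis coprime_iff_gcd_eq_1 bezout_int)
      have "t * a - 1 = - s * int q" using st by (simp add: algebra_simps)
      then have "(of_int (t * a - 1) :: complex) = of_int (- s * int q)" by (simp only:)
      then have "of_int t * of_int a - 1 = (of_int (- s) * of_nat q :: complex)" by simp
      then have "of_int t * of_int a - 1 \<in> P" using P_mult[OF OK_of_int(1) q(2), of "- s"] by (simp only:)
      then have "?cl (of_int t * of_int a) = ?cl 1" by (intro cl_eqI OK_mult) auto
      then have "?cl (of_int t) \<otimes>\<^bsub>R Quot P\<^esub> u = \<one>\<^bsub>R Quot P\<^esub>"
        using cl_mult[of "of_int t" "of_int a"] h.hom_one a by simp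
      moreover have "?cl (of_int t) \<in> K0" by (auto simp: K0_def)
      moreover have "u \<otimes>\<^bsub>R Quot P\<^esub> ?cl (of_int t) = ?cl (of_int t) \<otimes>\<^bsub>R Quot P\<^esub> u"
        using u subringE(1)[OF subK0] \<open>?cl (of_int t) \<in> K0\<close> by (intro Q.m_comm) auto
      ultimately show "u \<in> Units ((R Quot P)\<lparr>carrier := K0\<rparr>)" using u by (auto simp: Units_def)
    qed
  qed
  define Us where "Us = map (\<lambda>i. ?cl (\<zeta> ^ i)) [0..<N]"
  have Us: "set Us \<subseteq> carrier (R Quot P)" using OK_zeta by (auto simp: Us_def carrQ)
  have sumSpan: "?cl (\<Sum>i<k. of_int (c i) * \<zeta> ^ i) \<in> Q.Span K0 Us
      \<and> (\<Sum>i<k. of_int (c i) * \<zeta> ^ i) \<in> elts L.OK" if "k \<le> N" for c :: "nat \<Rightarrow> int" and k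
    using that
  proof (induction k)
    case 0
    have "P \<in> Q.Span K0 Us"
      using subgroup.one_closed[OF Q.Span_is_add_subgroup[OF K0_field Us]] zeroQ by simp
    then show ?case using cl_0[of 0] P_0 by simp
  next
    case (Suc k)
    let ?t = "of_int (c k) * \<zeta> ^ k"
    have t: "?t \<in> elts L.OK" by (intro OK_mult OK_zeta) auto
    have "?cl (\<zeta> ^ k) \<in> set Us" using Suc.prems by (auto simp: Us_def)
    then have "?cl (\<zeta> ^ k) \<in> Q.Span K0 Us" using Q.Span_base_incl[OF K0_field Us] by blast
    then have "?cl (of_int (c k)) \<otimes>\<^bsub>R Quot P\<^esub> ?cl (\<zeta> ^ k) \<in> Q.Span K0 Us"
      using Q.Span_smult_closed[OF K0_field Us] by (auto simp: K0_def simp del: Q.Span.simps)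
    then have "?cl ?t \<in> Q.Span K0 Us" using cl_mult[of "of_int (c k)" "\<zeta> ^ k"] OK_zeta by simp
    then have "?cl (\<Sum>i<k. of_int (c i) * \<zeta> ^ i) \<oplus>\<^bsub>R Quot P\<^esub> ?cl ?t \<in> Q.Span K0 Us"
      using Suc subgroup.m_closed[OF Q.Span_is_add_subgroup[OF K0_field Us]] by (auto simp del: Q.Span.simps)
    then show ?case using Suc t cl_add[of "\<Sum>i<k. of_int (c i) * \<zeta> ^ i" ?t]
      by (auto simp del: Q.Span.simps intro: elts_add)
  qed
  have "carrier (R Quot P) = Q.Span K0 Us"
  proof (intro equalityI)
    show "carrier (R Quot P) \<subseteq> Q.Span K0 Us"
    proof
      fix u assume "u \<in> carrier (R Quot P)"
      then obtain x where x: "x \<in> elts L.OK" "u = ?cl x" by (auto simp: carrQ)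
      then obtain B where "degree B < N" "x = evi B \<zeta>" using integers_of_L by (auto simp: L.mem_OK)
      then have "x = (\<Sum>i<N. of_int (coeff B i) * \<zeta> ^ i)" by (simp add: evi_altdef)
      then show "u \<in> Q.Span K0 Us" using sumSpan[of N "coeff B"] x(2) by simp
    qed
    show "Q.Span K0 Us \<subseteq> carrier (R Quot P)" using Q.Span_in_carrier[of K0 Us] Us subringE(1)[OF subK0] by blast
  qed
  then have fd: "Q.finite_dimension K0 (carrier (R Quot P))"
    using Q.Span_finite_dimension[OF K0_field Us] by simp
  have "Q.dim K0 (carrier (R Quot P)) = 2"
    using deg by (simp add: residue_degree_def intQ K0_def)
  then have dim2: "Q.dimension 2 K0 (carrier (R Quot P))"
    using Q.finite_dimensionE[OF K0_field fd] by (simp add: over_def)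
  show "\<exists>x\<in>elts L.OK. \<forall>a::int. x - of_int a \<notin> P"
  proof (rule ccontr)
    assume "\<not> ?thesis"
    then have all: "\<exists>a::int. x - of_int a \<in> P" if "x \<in> elts L.OK" for x using that by blast
    have "carrier (R Quot P) = K0"
    proof (intro equalityI subsetI)
      fix u assume "u \<in> carrier (R Quot P)"
      then obtain x where x: "x \<in> elts L.OK" "u = ?cl x" by (auto simp: carrQ)
      then obtain a :: int where "x - of_int a \<in> P" using all by blast
      then have "u = ?cl (of_int a)" using x cl_eqI[of x "of_int a"] by simp
      then show "u \<in> K0" by (auto simp: K0_def)
    qed (use subringE(1)[OF subK0] in auto)
    then have "Q.dimension 1 K0 (carrier (R Quot P))" using Q.dimension_one[OF K0_field] by simp
    from Q.dimension_is_inj[OF K0_field dim2 this] show False by simp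
  qed
  have OKz: "\<zeta> \<in> elts L.OK" "\<zeta> * \<zeta> \<in> elts L.OK"
    using OK_zeta[of 1] OK_zeta[of 2] by (simp_all add: power2_eq_square)
  have nd: "\<not> Q.independent K0 [?cl (\<zeta> * \<zeta>), ?cl \<zeta>, ?cl 1]"
  proof
    assume "Q.independent K0 [?cl (\<zeta> * \<zeta>), ?cl \<zeta>, ?cl 1]"
    then have "length [?cl (\<zeta> * \<zeta>), ?cl \<zeta>, ?cl 1] \<le> 2"
      by (rule Q.independent_length_le_dimension[OF K0_field dim2]) (use OKz carrQ in auto)
    then show False by simp
  qed
  have n1: "?cl 1 \<notin> Q.Span K0 []" using one_notin_P cl_0[of 1] zeroQ by auto
  have "?cl \<zeta> \<in> Q.Span K0 [?cl 1] \<or> ?cl (\<zeta> * \<zeta>) \<in> Q.Span K0 [?cl \<zeta>, ?cl 1]"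
  proof (rule ccontr)
    assume neg: "\<not> (?cl \<zeta> \<in> Q.Span K0 [?cl 1] \<or> ?cl (\<zeta> * \<zeta>) \<in> Q.Span K0 [?cl \<zeta>, ?cl 1])"
    have c: "?cl 1 \<in> carrier (R Quot P)" "?cl \<zeta> \<in> carrier (R Quot P)" "?cl (\<zeta> * \<zeta>) \<in> carrier (R Quot P)"
      using OKz carrQ OK_of_int(3) by blast+
    have "Q.independent K0 [?cl 1]" by (rule Q.li_Cons[OF c(1) n1 Q.li_Nil])
    then have "Q.independent K0 [?cl \<zeta>, ?cl 1]" using neg by (intro Q.li_Cons[OF c(2)]) auto
    then have "Q.independent K0 [?cl (\<zeta> * \<zeta>), ?cl \<zeta>, ?cl 1]" using neg by (intro Q.li_Cons[OF c(3)]) auto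
    then show False using nd by blast
  qed
  moreover have span1: "\<exists>a. v = ?cl (of_int a)" if v: "v \<in> Q.Span K0 [?cl 1]" for v
  proof -
    obtain k where k: "k \<in> K0" "v = k \<otimes>\<^bsub>R Quot P\<^esub> ?cl 1 \<oplus>\<^bsub>R Quot P\<^esub> \<zero>\<^bsub>R Quot P\<^esub>"
      using v by (auto simp: Q.line_extension_mem_iff)
    then obtain a where a: "k = ?cl (of_int a)" by (auto simp: K0_def elim!: Ints_cases)
    have "v = ?cl (of_int a * 1)" using k(2) a cl_mult[of "of_int a" 1] h.hom_closed by auto
    then show ?thesis by auto
  qed
  ultimately show "\<exists>a b. \<zeta> * \<zeta> - (of_int b * \<zeta> + of_int a) \<in> P"
  proof (elim disjE)
    assume "?cl \<zeta> \<in> Q.Span K0 [?cl 1]"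
    then obtain a where "?cl \<zeta> = ?cl (of_int a)" using span1 by blast
    then have "\<zeta> - of_int a \<in> P" using cl_eqD OKz by simp
    then have "\<zeta> * (\<zeta> - of_int a) \<in> P" using P_mult OKz by blast
    then have "\<zeta> * \<zeta> - (of_int a * \<zeta> + of_int 0) \<in> P" by (simp add: algebra_simps)
    then show ?thesis by blast
  next
    assume "?cl (\<zeta> * \<zeta>) \<in> Q.Span K0 [?cl \<zeta>, ?cl 1]"
    then have "\<exists>k\<in>K0. \<exists>v\<in>Q.Span K0 [?cl 1]. ?cl (\<zeta> * \<zeta>) = k \<otimes>\<^bsub>R Quot P\<^esub> ?cl \<zeta> \<oplus>\<^bsub>R Quot P\<^esub> v"
      using Q.line_extension_mem_iff[of "?cl (\<zeta> * \<zeta>)" K0 "?cl \<zeta>" "Q.Span K0 [?cl 1]"] by simp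
    then obtain k v where kv: "k \<in> K0" "v \<in> Q.Span K0 [?cl 1]"
      "?cl (\<zeta> * \<zeta>) = k \<otimes>\<^bsub>R Quot P\<^esub> ?cl \<zeta> \<oplus>\<^bsub>R Quot P\<^esub> v" by blast
    obtain b where b: "k = ?cl (of_int b)" using kv(1) by (auto simp: K0_def elim!: Ints_cases)
    obtain a where a: "v = ?cl (of_int a)" using span1[OF kv(2)] by blast
    have "?cl (\<zeta> * \<zeta>) = ?cl (of_int b * \<zeta> + of_int a)"
      using kv(3) a b cl_mult[of "of_int b" \<zeta>] cl_add[of "of_int b * \<zeta>" "of_int a"] OKz OK_mult by simp
    then have "\<zeta> * \<zeta> - (of_int b * \<zeta> + of_int a) \<in> P"
      by (intro cl_eqD OKz elts_add OK_mult) auto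
    then show ?thesis by blast
  qed
qed

lemma q_AI_in_P:
  assumes "of_nat q \<in> P" "q > 0" "x \<in> L" "x \<in> elts (pr (of_nat q) * AI)"
  shows "x \<in> P"
proof -
  obtain a where a: "algebraic_int a" "x = of_nat q * a" using assms(4) by (auto simp: elts_pr_AI)
  have "a = x / of_nat q" using a(2) assms(2) by simp
  then have "a \<in> L" using assms(3) by simp
  then have "a \<in> elts L.OK" using a(1) by (simp add: L.mem_OK)
  then show ?thesis unfolding a(2) by (rule P_mult_right[OF assms(1)])
qed

lemma frobenius_P:
  assumes q: "Factorial_Ring.prime q" "of_nat q \<in> P" "coprime q p" and x: "x \<in> elts L.OK"
  shows "x ^ q - gal q x \<in> P"
proof (rule q_AI_in_P[OF q(2) prime_gt_0_nat[OF q(1)]])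
  have xL: "x \<in> L" using x OK_subset_L by auto
  then show "x ^ q - gal q x \<in> L" using q(3) by auto
  obtain B where B: "x = evi B \<zeta>" using integers_of_L x by (auto simp: L.mem_OK)
  have "gal q x = evi B (\<zeta> ^ q)" using gal_evi[OF q(3), of \<zeta> B] gal_zeta[OF q(3), of 1] by (simp add: B)
  then show "x ^ q - gal q x \<in> elts (pr (of_nat q) * AI)"
    unfolding B using evi_frobenius[OF q(1) algebraic_int_zeta] by simp
qed

lemma int_residue:
  assumes q: "Factorial_Ring.prime q" "of_nat q \<in> P" and t: "t \<in> elts L.OK" "t ^ q - t \<in> P"
  obtains a :: int where "t - of_int a \<in> P"
proof -
  have "(\<Prod>j<q. t - of_nat j) - (t ^ q - t) \<in> P"
    using t(1) prod_minus_residues[OF q(1), of t]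
    by (intro q_AI_in_P[OF q(2) prime_gt_0_nat[OF q(1)]]) (auto simp: L.mem_OK intro!: L.K_prod)
  then have "(\<Prod>j<q. t - of_nat j) \<in> P" using P_add[OF _ t(2)] by fastforce
  then have "\<exists>j\<in>{..<q}. t - of_nat j \<in> P"
    by (intro P_prod elts_diff t(1) OK_of_int) auto
  then obtain j where "t - of_nat j \<in> P" by blast
  then show thesis using that[of "int j"] by simp
qed

lemma prime_above_p:
  assumes "of_nat p \<in> P" "x \<in> elts L.OK"
  obtains a :: int where "x - of_int a \<in> P"
proof -
  have "(\<Prod>k\<in>T. 1 - \<zeta> ^ k) \<in> P" using assms(1) by (simp add: prod_one_minus)
  then have "\<exists>k\<in>T. 1 - \<zeta> ^ k \<in> P"
    by (intro P_prod elts_diff OK_zeta OK_of_int) auto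
  then obtain k where k: "k \<in> T" "1 - \<zeta> ^ k \<in> P" by blast
  obtain a where a: "algebraic_int a" "1 - \<zeta> = (1 - \<zeta> ^ k) * a"
    using one_minus_dvd' k(1) by (auto simp: T_def)
  have "1 - \<zeta> ^ k \<noteq> 0" using a(2) zeta_ne_1 by auto
  then have "a = (1 - \<zeta>) / (1 - \<zeta> ^ k)" using a(2) by simp
  then have "a \<in> L" by auto
  then have "a \<in> elts L.OK" using a(1) by (simp add: L.mem_OK)
  then have pi: "1 - \<zeta> \<in> P" unfolding a(2) by (rule P_mult_right[OF k(2)])
  obtain B where B: "x = evi B \<zeta>" using integers_of_L assms(2) by (auto simp: L.mem_OK)
  have "evi B \<zeta> - evi B 1 \<in> P"
  proof (induction B)
    case (pCons c B)
    have "\<zeta> \<in> elts L.OK" "evi B 1 \<in> elts L.OK" using OK_zeta[of 1] by (auto intro: OK_evi)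
    then have "\<zeta> * (evi B \<zeta> - evi B 1) - evi B 1 * (1 - \<zeta>) \<in> P"
      using pCons.IH pi by (intro P_diff[OF P_mult P_mult])
    then show ?case by (simp add: algebra_simps)
  qed (simp add: P_0)
  moreover have "evi B 1 = of_int (poly B 1)" by (simp add: evi_def)
  ultimately show thesis using that[of "poly B 1"] B by simp
qed

lemma one_minus_root_dvd_n:
  assumes "\<zeta> ^ e \<noteq> 1"
  obtains b where "b \<in> elts L.OK" "(1 - \<zeta> ^ e) * b = of_nat n"
proof -
  let ?x = "\<zeta> ^ e"
  have "?x ^ n = 1" using zeta_pow_eq_1_iff[of "e * n"] by (simp flip: power_mult)
  then have "(\<Sum>i<n. ?x ^ i) = 0" using assms by (simp only: sum_gp_strict) simp
  then have "of_nat n = (\<Sum>i<n. 1 - ?x ^ i)" by (simp add: sum_subtractf)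
  also have "\<dots> = (1 - ?x) * (\<Sum>i<n. \<Sum>j<i. ?x ^ j)"
    by (simp add: one_diff_power_eq sum_distrib_left)
  finally have "of_nat n = (1 - ?x) * (\<Sum>i<n. \<Sum>j<i. ?x ^ j)" .
  moreover have "(\<Sum>i<n. \<Sum>j<i. ?x ^ j) \<in> elts L.OK"
    by (intro elts_sum OK_power OK_zeta)
  ultimately show thesis using that by metis
qed

lemma zeta_separated:
  assumes q: "Factorial_Ring.prime q" "of_nat q \<in> P" "q \<noteq> p" and ij: "\<zeta> ^ i - \<zeta> ^ j \<in> P"
  shows "i mod n = j mod n"
proof (rule ccontr)
  assume "i mod n \<noteq> j mod n"
  then have ne: "\<zeta> ^ i \<noteq> \<zeta> ^ j" by (simp add: zeta_pow_eq_iff)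
  have inv: "\<zeta> ^ j * \<zeta> ^ ((n - 1) * j) = 1"
  proof -
    have "j + (n - 1) * j = n * j" using N_eq(5) by (cases n) auto
    then show ?thesis using zeta_pow_eq_1_iff by (simp flip: power_add)
  qed
  let ?e = "i + (n - 1) * j"
  have eq: "\<zeta> ^ ?e - 1 = (\<zeta> ^ i - \<zeta> ^ j) * \<zeta> ^ ((n - 1) * j)"
    using inv by (simp add: left_diff_distrib power_add)
  then have P: "\<zeta> ^ ?e - 1 \<in> P" using P_mult_right[OF ij OK_zeta] by simp
  have "\<zeta> ^ ?e \<noteq> 1" using eq ne zeta_ne_0 by auto
  then obtain b where b: "b \<in> elts L.OK" "(1 - \<zeta> ^ ?e) * b = of_nat n" by (rule one_minus_root_dvd_n)
  have "1 - \<zeta> ^ ?e \<in> P" using P_minus[OF P] by simp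
  then have "of_nat n \<in> P" using P_mult_right[OF _ b(1)] b(2) by metis
  moreover have "coprime (int n) (int q)"
    using q prime_p by (simp add: n_def primes_coprime)
  ultimately show False using coprime_in_P_contr[of "int n" "int q"] q(2) by simp
qed

lemma prime_below_residue_degree_two:
  assumes deg: "residue_degree L \<rat> P = 2" and q: "Factorial_Ring.prime q" "of_nat q \<in> P"
  shows "q \<noteq> p" and "q mod n = (n - 1) mod n"
proof -
  obtain x0 where x0: "x0 \<in> elts L.OK" "\<And>a::int. x0 - of_int a \<notin> P"
    using residue_degree_two(2)[OF deg] by blast
  show qp: "q \<noteq> p" using prime_above_p[OF _ x0(1)] x0(2) q(2) by blast
  then have cop: "coprime q p" using q(1) prime_p by (simp add: primes_coprime)
  obtain a b where ab: "\<zeta> * \<zeta> - (of_int b * \<zeta> + of_int a) \<in> P"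
    using residue_degree_two(1)[OF deg] by blast
  define f where "f y = y * y - (of_int b * y + of_int a)" for y :: complex
  have fP: "f (\<zeta> ^ (q * i)) \<in> P" if fi: "f (\<zeta> ^ i) \<in> P" for i
  proof -
    have "f (\<zeta> ^ i) ^ q - gal q (f (\<zeta> ^ i)) \<in> P"
      using frobenius_P[OF q cop P_OK[OF fi]] .
    moreover have "f (\<zeta> ^ i) ^ q \<in> P"
      using P_mult[OF OK_power[OF P_OK[OF fi], of "q - 1"] fi] prime_gt_0_nat[OF q(1)]
      by (metis power_minus_mult)
    ultimately have "gal q (f (\<zeta> ^ i)) \<in> P"
      using P_diff[of "f (\<zeta> ^ i) ^ q" "f (\<zeta> ^ i) ^ q - gal q (f (\<zeta> ^ i))"] by simp
    moreover have "gal q (f (\<zeta> ^ i)) = f (\<zeta> ^ (q * i))"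
      unfolding f_def using cop by (simp add: gal_simps gal_zeta gal_of_int)
    ultimately show ?thesis by simp
  qed
  have f0: "f (\<zeta> ^ 1) \<in> P" using ab by (simp add: f_def)
  have f1: "f (\<zeta> ^ q) \<in> P" using fP[OF f0] by simp
  have f2: "f (\<zeta> ^ (q * q)) \<in> P" using fP[OF f1] .
  have root: "\<zeta> ^ i - \<zeta> ^ j \<in> P \<or> \<zeta> ^ i + \<zeta> ^ j - of_int b \<in> P"
    if "f (\<zeta> ^ i) \<in> P" "f (\<zeta> ^ j) \<in> P" for i j
  proof (rule P_prime)
    have "f (\<zeta> ^ i) - f (\<zeta> ^ j) = (\<zeta> ^ i - \<zeta> ^ j) * (\<zeta> ^ i + \<zeta> ^ j - of_int b)"
      by (simp add: f_def algebra_simps)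
    then show "(\<zeta> ^ i - \<zeta> ^ j) * (\<zeta> ^ i + \<zeta> ^ j - of_int b) \<in> P" using P_diff[OF that] by simp
  qed (intro elts_diff elts_add OK_zeta OK_of_int)+
  have "\<zeta> ^ 1 - \<zeta> ^ q \<in> P \<or> \<zeta> ^ 1 - \<zeta> ^ (q * q) \<in> P \<or> \<zeta> ^ q - \<zeta> ^ (q * q) \<in> P"
    using root[OF f0 f1] root[OF f0 f2]
      P_diff[of "\<zeta> ^ 1 + \<zeta> ^ q - of_int b" "\<zeta> ^ 1 + \<zeta> ^ (q * q) - of_int b"] by auto
  then have "1 mod n = q mod n \<or> 1 mod n = q * q mod n \<or> q mod n = q * q mod n"
    using zeta_separated[OF q qp] by blast
  moreover have "1 mod n = q mod n" if "q mod n = q * q mod n"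
  proof -
    have "[q * 1 = q * q] (mod n)" using that by (simp add: cong_def)
    then have "[1 = q] (mod n)" using cop by (subst (asm) cong_mult_lcancel_nat) (simp_all add: coprime_n)
    then show ?thesis by (simp add: cong_def)
  qed
  moreover have "q mod n \<noteq> 1 mod n"
  proof
    assume "q mod n = 1 mod n"
    then have "gal q x0 = x0" using gal_cong[of q 1] gal_one x0(1) OK_subset_L by auto
    then have "x0 ^ q - x0 \<in> P" using frobenius_P[OF q cop x0(1)] by simp
    then show False using int_residue[OF q x0(1)] x0(2) by blast
  qed
  ultimately show "q mod n = (n - 1) mod n" using sqrt_one_mod_n[of q] by auto
qed

end

section \<open>Norms of primes of residue degree two\<close>

lemma zmod_le_mult_if_comaximal:
  assumes "O1 * O1 = O1" "O1 * A = A" "O1 * B = B" "A \<le> O1" "B \<le> O1" "1 \<in> elts (A + B)"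
    and "pr x \<le> A" "pr x \<le> B"
  shows "pr x \<le> A * B"
proof -
  have "1 \<le> A + B" using assms(6) by (simp add: pr_le_iff flip: pr_1)
  then have "pr x * 1 \<le> pr x * (A + B)" by (intro zmod_mult_mono) auto
  then have "pr x \<le> pr x * A + pr x * B" by (simp add: distrib_left)
  moreover have "pr x * A \<le> A * B" using zmod_mult_mono[OF assms(8), of A A] by (simp add: mult.commute)
  moreover have "pr x * B \<le> A * B" using zmod_mult_mono[OF assms(7), of B B] by simp
  ultimately show ?thesis
    by (auto simp: pr_le_iff elts_add_iff dest!: zmod_leD intro: elts_add)
qed

lemma comaximal_mult:
  assumes "A * A \<le> A" "A * C \<le> A" "B * A \<le> A" "1 \<in> elts (A + B)" "1 \<in> elts (A + (C :: zmod))"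
  shows "1 \<in> elts (A + B * C)"
proof -
  obtain a b where ab: "a \<in> elts A" "b \<in> elts B" "1 = a + b" using assms(4) by (auto simp: elts_add_iff)
  obtain a' c where ac: "a' \<in> elts A" "c \<in> elts C" "1 = a' + c" using assms(5) by (auto simp: elts_add_iff)
  have "1 = (a + b) * (a' + c)" using ab(3) ac(3) by (metis mult_1)
  also have "\<dots> = (a * a' + a * c + b * a') + b * c" by (simp add: algebra_simps)
  also have "\<dots> \<in> elts (A + B * C)"
    unfolding elts_add_iff
    using elts_mult[OF ab(1) ac(1)] elts_mult[OF ab(1) ac(2)] elts_mult[OF ab(2) ac(1)]
      elts_mult[OF ab(2) ac(2)] assms(1-3) by (blast dest: zmod_leD intro: elts_add)
  finally show ?thesis .
qed

locale cyclotomic_quadratic_prime = cyclotomic_quadratic p r \<zeta> F w + cyclotomic_prime p r \<zeta> P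
  for p r \<zeta> F w P +
  assumes residue_degree: "residue_degree (cyclotomic_field \<zeta>) \<rat> P = 2"
begin

definition q :: nat where "q = (SOME q. Factorial_Ring.prime q \<and> of_nat q \<in> P)"

lemma prime_q: "Factorial_Ring.prime q" and q_in_P: "of_nat q \<in> P"
proof -
  obtain q0 where "Factorial_Ring.prime q0" "of_nat q0 \<in> P" by (rule ex_prime_in_P)
  then have "\<exists>q. Factorial_Ring.prime q \<and> of_nat q \<in> P" by blast
  then have "Factorial_Ring.prime q \<and> of_nat q \<in> P" unfolding q_def by (rule someI_ex)
  then show "Factorial_Ring.prime q" "of_nat q \<in> P" by auto
qed

lemma q_ne_p: "q \<noteq> p" and q_mod_n: "q mod n = (n - 1) mod n"
  using prime_below_residue_degree_two[OF residue_degree prime_q q_in_P] by auto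

lemma coprime_q_p: "coprime q p"
  using q_ne_p prime_q prime_p by (simp add: primes_coprime)

lemma frobenius_cnj: "x \<in> elts L.OK \<Longrightarrow> x ^ q - cnj x \<in> P"
  using frobenius_P[OF prime_q q_in_P coprime_q_p, of x] gal_cong[OF q_mod_n, of x] gal_cnj[of x]
  by (auto simp: L.mem_OK)

lemma cnj_P: "x \<in> P \<Longrightarrow> cnj x \<in> P"
proof -
  assume x: "x \<in> P"
  have "x ^ q \<in> P"
    using P_mult[OF OK_power[OF P_OK[OF x], of "q - 1"] x] prime_gt_0_nat[OF prime_q]
    by (metis power_minus_mult)
  from P_diff[OF this frobenius_cnj[OF P_OK[OF x]]] show ?thesis by simp
qed

lemma im_JP: "k \<in> T \<Longrightarrow> elts (im k JP) = gal k ` P"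
  using elts_im[OF T_coprime JP_subset_L] by (simp add: elts_JP)

lemma im_JP_ideal: "k \<in> T \<Longrightarrow> L.OK * im k JP = im k JP" "k \<in> T \<Longrightarrow> im k JP \<le> L.OK"
proof -
  show "k \<in> T \<Longrightarrow> L.OK * im k JP = im k JP"
    by (rule L_ideal_image[OF T_coprime OK_JP JP_subset_L])
  show "k \<in> T \<Longrightarrow> im k JP \<le> L.OK"
    using P_OK gal_OK T_coprime by (auto simp: im_JP intro!: zmod_leI)
qed

lemma q_in_im: "k \<in> T \<Longrightarrow> of_nat q \<in> elts (im k JP)"
  using q_in_P gal_of_int[OF T_coprime, of k "int q"] im_JP[of k] by (metis imageI of_int_of_nat_eq)

lemma im_JP_minus: "k \<in> T \<Longrightarrow> elts (im (n - k) JP) = elts (im k JP)"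
proof -
  assume k: "k \<in> T"
  have PL: "x \<in> L" if "x \<in> P" for x using that P_OK OK_subset_L by auto
  have "gal (n - k) ` P = (\<lambda>x. gal k (cnj x)) ` P"
    using gal_minus(3)[OF k] PL by (intro image_cong) auto
  also have "\<dots> = gal k ` cnj ` P" by (simp add: image_image)
  also have "cnj ` P = P"
  proof (intro equalityI subsetI)
    fix x assume "x \<in> P"
    then have "x = cnj (cnj x)" "cnj x \<in> P" using cnj_P by auto
    then show "x \<in> cnj ` P" by blast
  qed (use cnj_P in auto)
  finally show ?thesis using im_JP k gal_minus(1)[OF k w_in_L] by simp
qed

lemma zeta_trace_residue:
  obtains a :: int where "\<zeta> + \<zeta> ^ (n - 1) - of_int a \<in> P"
proof -
  let ?t = "\<zeta> + \<zeta> ^ (n - 1)"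
  have t: "?t \<in> elts L.OK" using OK_zeta[of 1] OK_zeta by (auto intro: elts_add)
  have "cnj ?t = ?t" by (simp only: cnj_zeta complex_cnj_add complex_cnj_inverse inverse_inverse_eq add.commute)
  then have "?t ^ q - ?t \<in> P" using frobenius_cnj[OF t] by simp
  then show thesis using int_residue[OF prime_q q_in_P t] that by blast
qed

text \<open>
  Modulo \<open>P\<close> the element \<open>\<zeta> + 1/\<zeta>\<close> is a rational integer \<open>a\<close>, so the conjugates of \<open>P\<close> by
  \<open>h\<close> and \<open>k\<close> contain \<open>\<zeta>\<^sup>h + \<zeta>\<^sup>-\<^sup>h - a\<close> and \<open>\<zeta>\<^sup>k + \<zeta>\<^sup>-\<^sup>k - a\<close>, whose difference factors
  as \<open>(\<zeta>\<^sup>h - \<zeta>\<^sup>k) (1 - \<zeta>\<^sup>-\<^sup>h\<^sup>-\<^sup>k)\<close>.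
\<close>

lemma comaximal_conjugates:
  assumes h: "h \<in> H" and k: "k \<in> H" and hk: "h \<noteq> k"
  shows "1 \<in> elts (im h JP + im k JP)"
proof -
  obtain a :: int where a: "\<zeta> + \<zeta> ^ (n - 1) - of_int a \<in> P" by (rule zeta_trace_residue)
  have hT: "h \<in> T" "k \<in> T" using h k H_T by auto
  have im_t: "\<zeta> ^ j + \<zeta> ^ (j * (n - 1)) - of_int a \<in> elts (im j JP)" if j: "j \<in> T" for j
  proof -
    have jp: "coprime j p" using j by (rule T_coprime)
    have "gal j (\<zeta> ^ 1 + \<zeta> ^ (n - 1) - of_int a) = \<zeta> ^ (j * 1) + \<zeta> ^ (j * (n - 1)) - of_int a"
      using jp L.K_power[OF zeta_in_L, of 1] by (simp only: gal_simps gal_zeta gal_of_int L.K_power L.K_closed zeta_in_L L.K_of_int)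
    then show ?thesis using a im_JP[OF j] by (metis imageI mult_1_right power_one_right)
  qed
  define A where "A = im h JP + im k JP"
  have ideal: "x * y \<in> elts A" if x: "x \<in> elts L.OK" and y: "y \<in> elts A" for x y
  proof -
    have "x * y \<in> elts (L.OK * A)" using x y by (rule elts_mult)
    then show ?thesis using hT by (simp add: A_def distrib_left im_JP_ideal)
  qed
  have le: "x \<in> elts A" if "x \<in> elts (im h JP) \<or> x \<in> elts (im k JP)" for x
    using that zmod_leD[OF zmod_le_add(1)] zmod_leD[OF zmod_le_add(2)] unfolding A_def by blast
  let ?d = "(\<zeta> ^ h + \<zeta> ^ (h * (n - 1)) - of_int a) - (\<zeta> ^ k + \<zeta> ^ (k * (n - 1)) - of_int a)"
  have d: "?d \<in> elts A"
    by (rule elts_diff[OF le[OF disjI1[OF im_t[OF hT(1)]]] le[OF disjI2[OF im_t[OF hT(2)]]]])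
  let ?e = "h + k * (n - 1)" and ?f = "(h + k) * (n - 1)"
  have inv: "\<zeta> ^ j * \<zeta> ^ (j * (n - 1)) = 1" for j
  proof -
    have "j + j * (n - 1) = n * j" using N_eq(5) by (cases n) (auto simp: algebra_simps)
    then show ?thesis using zeta_pow_eq_1_iff by (simp flip: power_add)
  qed
  have e: "\<zeta> ^ h - \<zeta> ^ k = - (\<zeta> ^ k * (1 - \<zeta> ^ ?e))"
  proof -
    have "\<zeta> ^ k * \<zeta> ^ ?e = \<zeta> ^ h * (\<zeta> ^ k * \<zeta> ^ (k * (n - 1)))" by (simp add: power_add mult_ac)
    then have "\<zeta> ^ k * \<zeta> ^ ?e = \<zeta> ^ h" by (simp only: inv mult_1_right)
    then show ?thesis by (simp only: right_diff_distrib mult_1_right minus_diff_eq)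
  qed
  have d_eq: "?d = (\<zeta> ^ h - \<zeta> ^ k) * (1 - \<zeta> ^ ?f)"
  proof -
    have "\<zeta> ^ h * \<zeta> ^ ?f = \<zeta> ^ (k * (n - 1)) * (\<zeta> ^ h * \<zeta> ^ (h * (n - 1)))"
      by (simp add: power_add add_mult_distrib mult_ac)
    then have 1: "\<zeta> ^ h * \<zeta> ^ ?f = \<zeta> ^ (k * (n - 1))" by (simp only: inv mult_1_right)
    have "\<zeta> ^ k * \<zeta> ^ ?f = \<zeta> ^ (h * (n - 1)) * (\<zeta> ^ k * \<zeta> ^ (k * (n - 1)))"
      by (simp add: power_add add_mult_distrib mult_ac)
    then have 2: "\<zeta> ^ k * \<zeta> ^ ?f = \<zeta> ^ (h * (n - 1))" by (simp only: inv mult_1_right)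
    have "(x + z - b) - (y + u - b) = (x - y) * (1 - f)" if "x * f = u" "y * f = z" for x y z u f b :: complex
      unfolding that[symmetric] by (simp add: algebra_simps)
    from this[OF 1 2] show ?thesis .
  qed
  have "\<zeta> ^ h \<noteq> \<zeta> ^ k" using hk hT by (simp add: zeta_pow_eq_iff T_def)
  then have "\<zeta> ^ ?e \<noteq> 1" using e by auto
  then obtain b where b: "b \<in> elts L.OK" "(1 - \<zeta> ^ ?e) * b = of_nat n" by (rule one_minus_root_dvd_n)
  have "\<zeta> ^ ?f \<noteq> 1"
  proof
    assume f: "\<zeta> ^ ?f = 1"
    have "\<zeta> ^ (h + k) = 1" using inv[of "h + k"] by (simp only: f mult_1_right)
    then have "n dvd h + k" by (simp add: zeta_pow_eq_1_iff)
    then have dvd: "n \<le> h + k" using hT N_eq(5) T_altdef by (intro dvd_imp_le) (auto simp: totatives_def)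
    obtain c where c: "h + k = n * c" using \<open>n dvd h + k\<close> by (elim dvdE)
    have "h < n" "k < n" using hT by (simp_all add: T_def)
    then have "n * c < n * 2" using c by linarith
    then have "c < 2" by simp
    moreover have "c \<noteq> 0" using c dvd N_eq(5) by (intro notI) simp
    ultimately have "c = 1" by simp
    then have "n - k = h" using c by simp
    then show False using H_minus[OF hT(2)] h k by simp
  qed
  then obtain b' where b': "b' \<in> elts L.OK" "(1 - \<zeta> ^ ?f) * b' = of_nat n" by (rule one_minus_root_dvd_n)
  have "- (\<zeta> ^ (k * (n - 1)) * (b * b')) * ?d = (\<zeta> ^ k * \<zeta> ^ (k * (n - 1))) * ((1 - \<zeta> ^ ?e) * b) * ((1 - \<zeta> ^ ?f) * b')"
    unfolding d_eq e by (simp add: mult_ac)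
  then have "- (\<zeta> ^ (k * (n - 1)) * (b * b')) * ?d = of_nat n * of_nat n" by (simp only: inv b(2) b'(2) mult_1)
  moreover have "- (\<zeta> ^ (k * (n - 1)) * (b * b')) * ?d \<in> elts A"
    using b(1) b'(1) by (intro ideal d elts_minus OK_mult OK_zeta)
  ultimately have nA: "of_nat n * of_nat n \<in> elts A" by simp
  have qA: "of_nat q \<in> elts A" using le q_in_im hT by blast
  have "coprime (int n * int n) (int q)"
    using prime_q prime_p q_ne_p by (simp add: n_def primes_coprime)
  then obtain u v where uv: "u * (int n * int n) + v * int q = 1" by (metis coprime_iff_gcd_eq_1 bezout_int)
  have "(1 :: complex) = of_int (u * (int n * int n) + v * int q)" by (simp only: uv of_int_1)
  also have "\<dots> = of_int u * (of_nat n * of_nat n) + of_int v * of_nat q" by simp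
  also have "\<dots> \<in> elts A" using nA qA by (intro elts_add elts_of_int_mult)
  finally show ?thesis unfolding A_def .
qed

lemma pr_q_le_prod:
  assumes "finite S" "S \<subseteq> H"
  shows "pr (of_nat q) \<le> (\<Prod>h\<in>S. im h JP) * L.OK
    \<and> (\<forall>k\<in>H - S. 1 \<in> elts (im k JP + (\<Prod>h\<in>S. im h JP) * L.OK)) \<and> (\<Prod>h\<in>S. im h JP) * L.OK \<le> L.OK"
  using assms
proof (induction S rule: finite_induct)
  case empty
  have "1 \<in> elts (A + L.OK)" for A
    using zmod_leD[OF zmod_le_add(2), of 1 L.OK A] by simp
  then show ?case by (simp add: pr_le_iff)
next
  case (insert h S)
  let ?B = "(\<Prod>h\<in>S. im h JP) * L.OK"
  have hH: "h \<in> H" "h \<in> T" using insert.prems H_T by auto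
  have IH: "pr (of_nat q) \<le> ?B" "\<And>k. k \<in> H - S \<Longrightarrow> 1 \<in> elts (im k JP + ?B)" "?B \<le> L.OK"
    using insert by auto
  have OB: "L.OK * ?B = ?B" by (simp only: L.OK_OK mult.left_commute[of L.OK])
  have eq: "(\<Prod>h\<in>insert h S. im h JP) * L.OK = im h JP * ?B" using insert by (simp add: mult.assoc)
  have "pr (of_nat q) \<le> im h JP * ?B"
  proof (rule zmod_le_mult_if_comaximal[OF L.OK_OK im_JP_ideal(1)[OF hH(2)] OB im_JP_ideal(2)[OF hH(2)] IH(3) _ _ IH(1)])
    show "1 \<in> elts (im h JP + ?B)" using IH(2) hH(1) insert.hyps(2) by blast
    show "pr (of_nat q) \<le> im h JP" using q_in_im[OF hH(2)] by (simp add: pr_le_iff)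
  qed
  moreover have "1 \<in> elts (im k JP + im h JP * ?B)" if k: "k \<in> H - insert h S" for k
  proof (rule comaximal_mult)
    have kT: "k \<in> T" using k H_T by auto
    have absorb: "im k JP * Y \<le> im k JP" if Y: "Y \<le> L.OK" for Y
      using zmod_mult_mono[OF order_refl Y, of "im k JP"] im_JP_ideal(1)[OF kT] by (simp add: mult.commute)
    show "im k JP * im k JP \<le> im k JP" "im k JP * ?B \<le> im k JP" "im h JP * im k JP \<le> im k JP"
      using absorb[OF im_JP_ideal(2)[OF kT]] absorb[OF IH(3)] absorb[OF im_JP_ideal(2)[OF hH(2)]]
      by (auto simp: mult.commute)
    show "1 \<in> elts (im k JP + im h JP)" using k hH by (intro comaximal_conjugates) auto
    show "1 \<in> elts (im k JP + ?B)" using k IH(2) by auto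
  qed
  moreover have "im h JP * ?B \<le> L.OK"
    using zmod_mult_mono[OF im_JP_ideal(2)[OF hH(2)] IH(3)] by (simp add: L.OK_OK)
  ultimately show ?case unfolding eq by blast
qed

lemma inter_conjugates_le:
  assumes "x \<in> elts L.OK" "\<And>h. h \<in> H \<Longrightarrow> x \<in> elts (im h JP)"
  shows "x \<in> elts (pr (of_nat q) * L.OK)"
proof -
  have xL: "x \<in> L" "algebraic_int x" using assms(1) by (auto simp: L.mem_OK)
  have xT: "x \<in> elts (im k JP)" if k: "k \<in> T" for k
  proof (cases "k \<in> H")
    case False
    then have "n - k \<in> H" using H_minus[OF k] by simp
    then show ?thesis using assms(2) im_JP_minus[OF k] by blast
  qed (rule assms(2))
  have sgP: "gal k x \<in> P" if k: "k \<in> T" for k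
  proof -
    obtain l where l: "coprime l p" "k * l mod n = 1 mod n"
      using T_coprime[OF k] by (rule obtain_inverse_mod)
    have "coprime l n" using l(1) by (simp add: coprime_n)
    then have "coprime (l mod n) n" using N_eq(5) by (subst coprime_mod_left_iff) auto
    then have lT: "l mod n \<in> T" using N_eq(5) by (simp add: T_def coprime_n)
    obtain y where y: "y \<in> P" "x = gal (l mod n) y" using xT[OF lT] im_JP[OF lT] by auto
    have "x = gal l y" using y(2) gal_cong[of "l mod n" l y] by simp
    then have "gal k x = y"
      using gal_inverse_gal(1)[OF T_coprime[OF k] l, of y] P_OK[OF y(1)] by (simp add: L.mem_OK)
    then show ?thesis using y(1) by simp
  qed
  have "\<exists>c. Tr (x * z) = of_int (int q * c)" if z: "z \<in> L" "algebraic_int z" for z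
  proof -
    have "gal k (x * z) \<in> P" if k: "k \<in> T" for k
    proof -
      have "gal k (x * z) = gal k x * gal k z" using T_coprime[OF k] xL(1) z(1) by (rule gal_simps(3))
      also have "\<dots> \<in> P"
        using sgP[OF k] gal_OK[OF T_coprime[OF k], of z] z by (intro P_mult_right) (auto simp: L.mem_OK)
      finally show ?thesis .
    qed
    then have "Tr (x * z) \<in> elts JP" unfolding Tr_def by (intro elts_sum) (simp add: elts_JP)
    then have TrP: "Tr (x * z) \<in> P" by (simp add: elts_JP)
    have "Tr (x * z) \<in> \<int>" using xL z by (intro Tr_int algebraic_int_times) auto
    then obtain c where c: "Tr (x * z) = of_int c" by (elim Ints_cases)
    have "int q dvd c"
    proof (rule ccontr)
      assume "\<not> int q dvd c"
      then have "coprime (int q) c" using prime_q by (intro prime_imp_coprime) auto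
      then show False using coprime_in_P_contr[of "int q" c] q_in_P TrP c by simp
    qed
    then show ?thesis using c by (metis dvdE)
  qed
  then obtain y where "y \<in> L" "algebraic_int y" "x = of_nat q * y"
    using dvd_if_Tr_dvd[OF xL prime_q q_ne_p] by blast
  then show ?thesis by (auto simp: elts_pr_mult L.mem_OK)
qed

lemma Nm_JP: "Nm JP = pr (of_nat q) * L.OK"
proof (rule antisym)
  have prod_le: "(\<Prod>h\<in>S. im h JP) * L.OK \<le> im h JP" if "h \<in> S" "S \<subseteq> H" for h S
  proof -
    have S: "finite S" using that(2) finite_H by (rule finite_subset)
    have hT: "h \<in> T" using that H_T by auto
    have "(\<Prod>h\<in>S - {h}. im h JP) * L.OK \<le> L.OK" using pr_q_le_prod[of "S - {h}"] S that by auto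
    then have "im h JP * ((\<Prod>h\<in>S - {h}. im h JP) * L.OK) \<le> im h JP * L.OK" by (intro zmod_mult_mono) auto
    also have "im h JP * L.OK = im h JP" using im_JP_ideal(1)[OF hT] by (simp add: mult.commute)
    finally show ?thesis using S that(1) by (simp add: prod.remove[of S h] mult.assoc)
  qed
  obtain h0 where "h0 \<in> H" using card_H by fastforce
  have "Nm JP * L.OK = Nm JP"
    using Nm_mult[OF JP_subset_L OK_subset_L] OK_JP by (simp add: Nm_OK mult.commute)
  then have NmO: "(\<Prod>h\<in>H. im h JP) * L.OK = Nm JP" by (simp add: Nm_def)
  show "Nm JP \<le> pr (of_nat q) * L.OK"
  proof (rule zmod_leI)
    fix x assume "x \<in> elts (Nm JP)"
    then have x: "x \<in> elts (im h JP)" if "h \<in> H" for h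
      using zmod_leD[OF prod_le[of h H]] that NmO by simp
    have "x \<in> elts L.OK" using x[OF \<open>h0 \<in> H\<close>] zmod_leD[OF im_JP_ideal(2)[OF H_T[OF \<open>h0 \<in> H\<close>]]] by blast
    then show "x \<in> elts (pr (of_nat q) * L.OK)" using x by (rule inter_conjugates_le)
  qed
  have "pr (of_nat q) \<le> Nm JP" using pr_q_le_prod[OF finite_H] NmO by auto
  then have "pr (of_nat q) * L.OK \<le> Nm JP * L.OK" by (intro zmod_mult_mono) auto
  then show "pr (of_nat q) * L.OK \<le> Nm JP" using \<open>Nm JP * L.OK = Nm JP\<close> by simp
qed

end

section \<open>Descent to the quadratic subfield\<close>

context algebraic_number_field
begin

lemma inv_class_group:
  assumes "frac_ideal I" "frac_ideal J" "I * J = OK"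
  shows "inv\<^bsub>class_group K\<^esub> (ideal_cls I) = ideal_cls J"
proof (rule monoid.inv_char[OF class_group_monoid])
  show "ideal_cls I \<otimes>\<^bsub>class_group K\<^esub> ideal_cls J = \<one>\<^bsub>class_group K\<^esub>"
    "ideal_cls J \<otimes>\<^bsub>class_group K\<^esub> ideal_cls I = \<one>\<^bsub>class_group K\<^esub>"
    using assms by (simp_all add: mult_class_group one_class_group mult.commute)
qed (use assms in \<open>auto simp: carrier_class_group\<close>)

lemma frac_ideal_prod:
  "finite A \<Longrightarrow> (\<And>i. i \<in> A \<Longrightarrow> frac_ideal (f i)) \<Longrightarrow> frac_ideal (prod f A * OK)"
  by (induction A rule: finite_induct) (auto simp: frac_ideal_OK frac_ideal_mult mult.assoc)

end

context cyclotomic_quadratic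
begin

text \<open>
  The ideals whose norm to \<open>F\<close> becomes principal with a generator in \<open>F\<close>; the norm is formed
  inside \<open>L\<close>, as the product of the conjugates over \<open>F\<close>.
\<close>

definition principal_norm :: "zmod \<Rightarrow> bool"
  where "principal_norm J \<longleftrightarrow> L.frac_ideal J \<and> (\<exists>b\<in>F - {0}. Nm J = pr b * L.OK)"

lemma principal_norm_OK: "principal_norm L.OK"
  unfolding principal_norm_def using L.frac_ideal_OK
  by (auto simp: Nm_OK pr_1 intro!: bexI[of _ 1])

lemma principal_norm_mult:
  assumes "principal_norm I" "principal_norm J"
  shows "principal_norm (I * J)"
proof -
  obtain b c where bc: "b \<in> F" "b \<noteq> 0" "Nm I = pr b * L.OK" "c \<in> F" "c \<noteq> 0" "Nm J = pr c * L.OK"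
    using assms by (auto simp: principal_norm_def)
  have frac: "L.frac_ideal I" "L.frac_ideal J" using assms by (auto simp: principal_norm_def)
  have "Nm (I * J) = (pr b * L.OK) * (pr c * L.OK)"
    using Nm_mult[OF L.frac_idealD(3)[OF frac(1)] L.frac_idealD(3)[OF frac(2)]] bc by simp
  also have "\<dots> = pr (b * c) * (L.OK * L.OK)" by (simp only: pr_mult mult_ac)
  finally have "Nm (I * J) = pr (b * c) * L.OK" by (simp add: L.OK_OK)
  moreover have "b * c \<in> F - {0}" using bc by auto
  ultimately show ?thesis unfolding principal_norm_def using L.frac_ideal_mult[OF frac] by blast
qed

lemma principal_norm_prime:
  assumes P: "P \<in> field_primes L" "residue_degree L \<rat> P = 2"
  obtains J J' where "elts J = P" "principal_norm J" "principal_norm J'" "J * J' = L.OK"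
proof -
  have "cyclotomic_prime p r \<zeta> P"
    using P by (intro cyclotomic_prime.intro cyclotomic_prime_axioms.intro prime_power_cyclotomic_axioms)
      (auto simp: field_primes_def)
  then interpret P: cyclotomic_quadratic_prime p r \<zeta> F w P
    using P(2) by (intro cyclotomic_quadratic_prime.intro cyclotomic_quadratic_prime_axioms.intro
      cyclotomic_quadratic_axioms)
  define J where "J = P.JP"
  let ?q = "of_nat P.q :: complex"
  have q0: "?q \<noteq> 0" using prime_gt_0_nat[OF P.prime_q] by simp
  have J: "L.frac_ideal J" "Nm J = pr ?q * L.OK"
    using P.frac_ideal_JP P.Nm_JP by (simp_all add: J_def)
  have one_H: "1 \<in> H" using N_eq(5) gal_one[OF w_in_L] by (simp add: H_def T_def)
  define J' where "J' = pr (inverse ?q) * ((\<Prod>h\<in>H - {1}. im h J) * L.OK)"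
  have "L.frac_ideal ((\<Prod>h\<in>H - {1}. im h J) * L.OK)"
    using finite_H im_frac_ideal[OF H_coprime J(1)] by (intro L.frac_ideal_prod) auto
  then have J': "L.frac_ideal J'"
    unfolding J'_def using q0 by (intro L.frac_ideal_pr_mult) auto
  have "Nm J = im 1 J * (\<Prod>h\<in>H - {1}. im h J)"
    unfolding Nm_def using finite_H one_H by (rule prod.remove)
  then have "J * ((\<Prod>h\<in>H - {1}. im h J) * L.OK) = Nm J * L.OK"
    using im_1[OF L.frac_idealD(3)[OF J(1)]] by (simp only: mult.assoc)
  also have "\<dots> = pr ?q * L.OK" by (simp only: J(2) mult.assoc L.OK_OK)
  finally have "J * J' = pr (inverse ?q) * (pr ?q * L.OK)"
    unfolding J'_def by (simp only: mult.left_commute[of J])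
  then have JJ': "J * J' = L.OK" by (simp add: pr_inverse_mult(2)[OF q0])
  have "Nm J' * L.OK = Nm J'"
    using Nm_mult[OF L.frac_idealD(3)[OF J'] OK_subset_L] L.frac_idealD(2)[OF J'] by (simp add: Nm_OK)
  moreover have "Nm J * Nm J' = L.OK"
    using Nm_mult[OF L.frac_idealD(3)[OF J(1)] L.frac_idealD(3)[OF J']] JJ' by (simp add: Nm_OK)
  ultimately have "pr ?q * Nm J' = L.OK" by (simp add: J(2) mult.assoc mult.commute[of L.OK])
  then have "Nm J' = pr (inverse ?q) * L.OK" using pr_inverse_mult(2)[OF q0, of "Nm J'"] by simp
  then have "principal_norm J'" unfolding principal_norm_def using J' q0 by auto
  moreover have "principal_norm J" unfolding principal_norm_def using J q0 by auto
  moreover have "elts J = P" by (simp add: J_def P.elts_JP)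
  ultimately show thesis using that JJ' by blast
qed

lemma generated_principal_norm:
  assumes "C \<in> generate (class_group L) (ideal_class L ` {P \<in> field_primes L. unramified L \<rat> P \<and> residue_degree L \<rat> P = 2})"
  shows "\<exists>J. principal_norm J \<and> C = L.ideal_cls J"
  using assms
proof induction
  case one
  then show ?case using principal_norm_OK L.one_class_group by auto
next
  case (incl h)
  then obtain P where "P \<in> field_primes L" "residue_degree L \<rat> P = 2" "h = ideal_class L P" by auto
  then show ?case using principal_norm_prime[of P] unfolding L.ideal_cls_def by metis
next
  case (inv h)
  then obtain P where P: "P \<in> field_primes L" "residue_degree L \<rat> P = 2" "h = ideal_class L P" by auto
  obtain J J' where J: "elts J = P" "principal_norm J" "principal_norm J'" "J * J' = L.OK"
    using principal_norm_prime[OF P(1,2)] .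
  then have "inv\<^bsub>class_group L\<^esub> (L.ideal_cls J) = L.ideal_cls J'"
    by (intro L.inv_class_group) (auto simp: principal_norm_def)
  moreover have "h = L.ideal_cls J" using P(3) J(1) by (simp add: L.ideal_cls_def)
  ultimately show ?case using J(3) by blast
next
  case (eng h1 h2)
  then obtain I J where "principal_norm I" "h1 = L.ideal_cls I" "principal_norm J" "h2 = L.ideal_cls J" by blast
  moreover from this have "h1 \<otimes>\<^bsub>class_group L\<^esub> h2 = L.ideal_cls (I * J)"
    by (simp add: L.mult_class_group principal_norm_def)
  ultimately show ?case using principal_norm_mult by blast
qed

lemma power_principal:
  assumes gen: "2 \<in> generating_residue_degrees L \<rat>" and I: "frac_ideal I"
  shows "\<exists>b\<in>F - {0}. I ^ (N div 2) = pr b * OK"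
proof -
  have E: "L.frac_ideal (I * L.OK)" using I by (rule extension_frac_ideal)
  then have "L.ideal_cls (I * L.OK) \<in> carrier (class_group L)" by (auto simp: L.carrier_class_group)
  also have "\<dots> = generate (class_group L)
      (ideal_class L ` {P \<in> field_primes L. unramified L \<rat> P \<and> residue_degree L \<rat> P = 2})"
    using gen by (simp add: generating_residue_degrees_def)
  finally obtain J where J: "principal_norm J" "L.ideal_cls (I * L.OK) = L.ideal_cls J"
    using generated_principal_norm by blast
  obtain b where b: "b \<in> F" "b \<noteq> 0" "Nm J = pr b * L.OK" and JL: "L.frac_ideal J"
    using J(1) by (auto simp: principal_norm_def)
  obtain a where a: "a \<in> L" "a \<noteq> 0" "I * L.OK = pr a * J"
    using L.ideal_cls_eq_iff[OF E JL] J(2) by auto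
  have "I ^ (N div 2) * L.OK = Nm (I * L.OK)"
    using Nm_extension[OF frac_idealD(3)[OF I]] by simp
  also have "\<dots> = pr (nm a) * (pr b * L.OK)"
    unfolding a(3) using Nm_pr_mult[OF a(1) L.frac_idealD(3)[OF JL]] b(3) by simp
  also have "\<dots> = pr (nm a * b) * L.OK" by (simp add: pr_mult mult.assoc)
  finally have eq: "I ^ (N div 2) * L.OK = pr (nm a * b) * L.OK" .
  have nb: "nm a * b \<in> F" "nm a * b \<noteq> 0" using a b nm_in_F nm_ne_0 by auto
  have "I ^ (N div 2) = pr (nm a * b) * OK"
    using frac_ideal_power[OF I card_H(2)] nb eq by (rule contract_principal)
  then show ?thesis using nb by blast
qed

end

theorem corollary1p7:
  fixes p r n :: nat and \<zeta> :: complex and F :: "complex set"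
  assumes "Factorial_Ring.prime p" and "p mod 4 = 3" and "r \<ge> 1" and "n = p ^ r"
    and "primitive_root_of_unity n \<zeta>"
    and "2 \<in> generating_residue_degrees (cyclotomic_field \<zeta>) \<rat>"
    and "quadratic_field F" and "F \<subseteq> cyclotomic_field \<zeta>"
  shows "\<forall>q::nat. Factorial_Ring.prime q \<and> q dvd class_number F \<longrightarrow> q dvd totient n div 2"
proof (intro allI impI)
  fix q :: nat assume q: "Factorial_Ring.prime q \<and> q dvd class_number F"
  have "odd p" using assms(2) by presburger
  then interpret Z: prime_power_cyclotomic p r \<zeta>
    using assms by unfold_locales auto
  obtain w where "imaginary_quadratic_field F w"
    using Z.quadratic_subfield_imaginary[OF assms(2,7,8)] .
  then interpret F: imaginary_quadratic_field F w .
  interpret ZF: cyclotomic_quadratic p r \<zeta> F w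
    by unfold_locales (use assms in auto)
  have "q dvd Z.N div 2"
    using F.prime_dvd_class_number[OF conjunct1[OF q] conjunct2[OF q] ZF.card_H(2)
        ZF.power_principal[OF assms(6)]] .
  then show "q dvd totient n div 2"
    using Z.totient_n by (simp add: Z.n_def assms(4))
qed

end
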